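(* Let $t>0$, $\nu,\rho\in\mathbb Z_+^N$, and let $p$ be a polynomial on $\mathbb R^N$ of degree less than $|\nu|$. Then (1) $\int_{\mathbb R^N}R_\nu(t,y)S_\rho(t,y)\,dP_t^\Gamma(0,\cdot)(y)=\nu!\,\delta_{\nu,\rho}$; (2) $\int_{\mathbb R^N}p(y)S_\nu(t,y)\,dP_t^\Gamma(0,\cdot)(y)=\int_{\mathbb R^N}p(y)R_\nu(t,y)\,dP_t^\Gamma(0,\cdot)(y)=0$.
   Context: Setting: $R\subset\mathbb R^N$ a root system normalized by $|\alpha|^2=2$, reflection group $W$, positive subsystem $R_+$, $W$-invariant multiplicity $k\ge0$; Dunkl operators $T_if(x)=\partial_if(x)+\sum_{\alpha\in R_+}k(\alpha)\alpha_i\frac{f(x)-f(\sigma_\alpha x)}{\langle\alpha,x\rangle}$; $V$ the unique linear isomorphism of polynomials with $V\mathcal P_n=\mathcal P_n$, $V1=1$, $T_iV=V\partial_i$; moment functions $m_\nu=V(x^\nu)$; Dunkl kernel $K(x,y)=\sum_\nu\frac{m_\nu(x)}{\nu!}y^\nu$. With $\gamma=\sum_{\alpha\in R_+}k(\alpha)$, $w_k(x)=\prod_{\alpha\in R_+}|\langle\alpha,x\rangle|^{2k(\alpha)}$, $c_k=(\int e^{-|x|^2}w_k)^{-1}$, the centered $k$-Gaussian is $dP_t^\Gamma(0,\cdot)(y)=\frac{c_k}{(4t)^{\gamma+N/2}}e^{-|y|^2/4t}w_k(y)dy$. Let $a_\lambda(t)=\frac{(2\mu)!}{\mu!}(-t)^{|\mu|}$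 if $\lambda=2\mu$, $\mu\in\mathbb Z_+^N$, and $0$ otherwise. Appell characters: $R_\nu(t,x)=\sum_{\rho\le\nu}\binom{\nu}{\rho}a_{\nu-\rho}(t)m_\rho(x)$ (equivalently $K(x,-iy)e^{t|y|^2}=\sum_\nu\frac{(-iy)^\nu}{\nu!}R_\nu(t,x)$). Appell cocharacters ($t>0$): $S_\nu(t,y)$ defined by $e^{-|x|^2/4t}K(x,y/2t)=\sum_\nu\frac{m_\nu(x)}{\nu!}S_\nu(t,y)$, i.e. $S_\nu(t,y)=T_x^\nu\big(e^{-|x|^2/4t}K(x,y/2t)\big)|_{x=0}$. *)

theory Defs
  imports "HOL-Analysis.Analysis"
begin

definition mono :: "('n::finite \<Rightarrow> nat) \<Rightarrow> real^'n \<Rightarrow> real" where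
  "mono \<nu> x = (\<Prod>i\<in>UNIV. (x$i) ^ (\<nu> i))"

definition mdeg :: "('n::finite \<Rightarrow> nat) \<Rightarrow> nat" where
  "mdeg \<nu> = (\<Sum>i\<in>UNIV. \<nu> i)"

definition mfact :: "('n::finite \<Rightarrow> nat) \<Rightarrow> real" where
  "mfact \<nu> = (\<Prod>i\<in>UNIV. fact (\<nu> i))"

definition mbinom :: "('n::finite \<Rightarrow> nat) \<Rightarrow> ('n \<Rightarrow> nat) \<Rightarrow> real" where
  "mbinom \<nu> \<rho> = (\<Prod>i\<in>UNIV. real (\<nu> i choose \<rho> i))"

definition polyfun :: "(real^'n::finite \<Rightarrow> real) \<Rightarrow> bool" where
  "polyfun p \<longleftrightarrow> (\<exists>c. finite {\<nu>. c \<nu> \<noteq> 0} \<and>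
      p = (\<lambda>x. \<Sum>\<nu>\<in>{\<nu>. c \<nu> \<noteq> 0}. c \<nu> * mono \<nu> x))"

definition homog_polyfun :: "nat \<Rightarrow> (real^'n::finite \<Rightarrow> real) \<Rightarrow> bool" where
  "homog_polyfun n p \<longleftrightarrow> (\<exists>c. finite {\<nu>. c \<nu> \<noteq> 0} \<and> (\<forall>\<nu>. c \<nu> \<noteq> 0 \<longrightarrow> mdeg \<nu> = n) \<and>
      p = (\<lambda>x. \<Sum>\<nu>\<in>{\<nu>. c \<nu> \<noteq> 0}. c \<nu> * mono \<nu> x))"

definition polyfun_deg_lt :: "nat \<Rightarrow> (real^'n::finite \<Rightarrow> real) \<Rightarrow> bool" where
  "polyfun_deg_lt d p \<longleftrightarrow> (\<exists>c. finite {\<nu>. c \<nu> \<noteq> 0} \<and> (\<forall>\<nu>. c \<nu> \<noteq> 0 \<longrightarrow> mdeg \<nu> < d) \<and>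
      p = (\<lambda>x. \<Sum>\<nu>\<in>{\<nu>. c \<nu> \<noteq> 0}. c \<nu> * mono \<nu> x))"

definition reflection :: "real^'n::finite \<Rightarrow> real^'n \<Rightarrow> real^'n" where
  "reflection \<alpha> x = x - (\<alpha> \<bullet> x) *\<^sub>R \<alpha>"   \<comment> \<open>valid since |alpha|^2 = 2\<close>

definition root_system :: "(real^'n::finite) set \<Rightarrow> bool" where
  "root_system R \<longleftrightarrow> finite R \<and> 0 \<notin> R \<and> (\<forall>\<alpha>\<in>R. \<alpha> \<bullet> \<alpha> = 2) \<and>
     (\<forall>\<alpha>\<in>R. reflection \<alpha> ` R = R) \<and>
     (\<forall>\<alpha>\<in>R. \<forall>c::real. c *\<^sub>R \<alpha> \<in> R \<longleftrightarrow> c = 1 \<or> c = -1)"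

definition positive_subsystem :: "(real^'n::finite) set \<Rightarrow> (real^'n) set \<Rightarrow> bool" where
  "positive_subsystem R Rp \<longleftrightarrow>
     (\<exists>\<beta>. (\<forall>\<alpha>\<in>R. \<alpha> \<bullet> \<beta> \<noteq> 0) \<and> Rp = {\<alpha>\<in>R. \<alpha> \<bullet> \<beta> > 0})"

text \<open>W-invariant nonnegative multiplicity (invariance under the generating reflections)\<close>
definition multiplicity :: "(real^'n::finite) set \<Rightarrow> (real^'n \<Rightarrow> real) \<Rightarrow> bool" where
  "multiplicity R k \<longleftrightarrow> (\<forall>\<alpha>\<in>R. k \<alpha> \<ge> 0) \<and>
     (\<forall>\<alpha>\<in>R. \<forall>\<beta>\<in>R. k (reflection \<beta> \<alpha>) = k \<alpha>)"

definition partial_deriv :: "'n::finite \<Rightarrow> (real^'n \<Rightarrow> real) \<Rightarrow> real^'n \<Rightarrow> real" where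
  "partial_deriv i f x = deriv (\<lambda>s. f (x + s *\<^sub>R axis i 1)) 0"

text \<open>Dunkl operator T_i; the formula is used only off the hyperplanes
  <alpha,x> = 0, where it is literally defined.\<close>
definition dunkl :: "'n::finite \<Rightarrow> (real^'n) set \<Rightarrow> (real^'n \<Rightarrow> real) \<Rightarrow> (real^'n \<Rightarrow> real)
                      \<Rightarrow> real^'n \<Rightarrow> real" where
  "dunkl i Rp k f x = partial_deriv i f x +
     (\<Sum>\<alpha>\<in>Rp. k \<alpha> * (\<alpha>$i) * (f x - f (reflection \<alpha> x)) / (\<alpha> \<bullet> x))"

text \<open>V: linear on polynomials, V P_n = P_n, V 1 = 1, T_i V = V partial_i on polynomials.
  Since T_i V p and V partial_i p are polynomials, equality off the hyperplanes
  (a dense set) is equality as polynomials.\<close>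
definition intertwiner :: "(real^'n::finite) set \<Rightarrow> (real^'n \<Rightarrow> real)
      \<Rightarrow> ((real^'n \<Rightarrow> real) \<Rightarrow> real^'n \<Rightarrow> real) \<Rightarrow> bool" where
  "intertwiner Rp k V \<longleftrightarrow>
     (\<forall>p q a b. polyfun p \<longrightarrow> polyfun q \<longrightarrow>
        V (\<lambda>x. a * p x + b * q x) = (\<lambda>x. a * V p x + b * V q x)) \<and>
     (\<forall>n. V ` {p. homog_polyfun n p} = {p. homog_polyfun n p}) \<and>
     V (\<lambda>x. 1) = (\<lambda>x. 1) \<and>
     (\<forall>i p x. polyfun p \<longrightarrow> (\<forall>\<alpha>\<in>Rp. \<alpha> \<bullet> x \<noteq> 0) \<longrightarrow>
        dunkl i Rp k (V p) x = V (partial_deriv i p) x)"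

definition moment :: "((real^'n::finite \<Rightarrow> real) \<Rightarrow> real^'n \<Rightarrow> real) \<Rightarrow> ('n \<Rightarrow> nat) \<Rightarrow> real^'n \<Rightarrow> real" where
  "moment V \<nu> = V (mono \<nu>)"

definition dunkl_kernel :: "((real^'n::finite \<Rightarrow> real) \<Rightarrow> real^'n \<Rightarrow> real) \<Rightarrow> real^'n \<Rightarrow> real^'n \<Rightarrow> real" where
  "dunkl_kernel V x y = (\<Sum>\<^sub>\<infinity>\<nu>. moment V \<nu> x / mfact \<nu> * mono \<nu> y)"

definition a_coef :: "real \<Rightarrow> ('n::finite \<Rightarrow> nat) \<Rightarrow> real" where
  "a_coef t \<kappa> = (if (\<forall>i. even (\<kappa> i))
      then mfact \<kappa> / mfact (\<lambda>i. \<kappa> i div 2) * (- t) ^ mdeg (\<lambda>i. \<kappa> i div 2)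
      else 0)"

definition appell_char :: "((real^'n::finite \<Rightarrow> real) \<Rightarrow> real^'n \<Rightarrow> real) \<Rightarrow> real \<Rightarrow> ('n \<Rightarrow> nat)
      \<Rightarrow> real^'n \<Rightarrow> real" where
  "appell_char V t \<nu> x = (\<Sum>\<rho>\<in>{\<rho>. \<rho> \<le> \<nu>}. mbinom \<nu> \<rho> * a_coef t (\<lambda>i. \<nu> i - \<rho> i) * moment V \<rho> x)"

definition appell_cochar :: "((real^'n::finite \<Rightarrow> real) \<Rightarrow> real^'n \<Rightarrow> real) \<Rightarrow> real \<Rightarrow> ('n \<Rightarrow> nat)
      \<Rightarrow> real^'n \<Rightarrow> real" where
  "appell_cochar V t \<nu> y = (THE c. \<forall>x.
      ((\<lambda>\<kappa>. moment V \<kappa> x / mfact \<kappa> * c \<kappa>) has_sum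
        (exp (- (norm x ^ 2) / (4 * t)) * dunkl_kernel V x ((1 / (2 * t)) *\<^sub>R y))) UNIV) \<nu>"

definition weight :: "(real^'n::finite) set \<Rightarrow> (real^'n \<Rightarrow> real) \<Rightarrow> real^'n \<Rightarrow> real" where
  "weight Rp k x = (\<Prod>\<alpha>\<in>Rp. if k \<alpha> = 0 then 1 else \<bar>\<alpha> \<bullet> x\<bar> powr (2 * k \<alpha>))"

definition gamma_k :: "(real^'n::finite) set \<Rightarrow> (real^'n \<Rightarrow> real) \<Rightarrow> real" where
  "gamma_k Rp k = (\<Sum>\<alpha>\<in>Rp. k \<alpha>)"

definition c_k :: "(real^'n::finite) set \<Rightarrow> (real^'n \<Rightarrow> real) \<Rightarrow> real" where
  "c_k Rp k = 1 / (LINT x|lborel. exp (- (norm x ^ 2)) * weight Rp k x)"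

definition gauss_density :: "(real^'n::finite) set \<Rightarrow> (real^'n \<Rightarrow> real) \<Rightarrow> real \<Rightarrow> real^'n \<Rightarrow> real" where
  "gauss_density Rp k t y = c_k Rp k / (4 * t) powr (gamma_k Rp k + real CARD('n) / 2)
      * exp (- (norm y ^ 2) / (4 * t)) * weight Rp k y"

end

theory Submission
  imports Defs "HOL-Probability.Distributions"
begin

text \<open>
  Write \<open>E\<close> for integration against the \<open>k\<close>-Gaussian.  Integration by parts makes \<open>y\<^sub>i / 2t - T\<^sub>i\<close> the
  \<open>E\<close>-adjoint of \<open>T\<^sub>i\<close>.  The generating function shows that \<open>S\<^sub>\<nu> = (2t)\<^sup>-\<^sup>|\<^sup>\<nu>\<^sup>| exp (- t \<Delta>) y\<^sup>\<nu>\<close> with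
  \<open>\<Delta> = \<Sum> T\<^sub>i\<^sup>2\<close>, and \<open>[\<Delta>, y\<^sub>i] = 2 T\<^sub>i\<close> turns this into the raising relation
  \<open>S\<^bsub>\<nu> + e\<^sub>i\<^esub> = (y\<^sub>i / 2t - T\<^sub>i) S\<^sub>\<nu>\<close>.  Together with the lowering relation
  \<open>T\<^sub>i R\<^sub>\<nu> = \<nu>\<^sub>i R\<^bsub>\<nu> - e\<^sub>i\<^esub>\<close> and \<open>E R\<^sub>\<nu> = \<delta>\<^bsub>\<nu>,0\<^esub>\<close> this gives biorthogonality by induction, and orthogonality
  to lower degrees because \<open>T\<^sub>i\<close> lowers degrees.  Absolute convergence of the generating function, which
  makes \<open>S\<^sub>\<nu>\<close> well defined, rests on \<open>\<bar>m\<^sub>\<nu> x\<bar> \<le> \<bar>x\<bar>\<^sup>|\<^sup>\<nu>\<^sup>|\<close>, a consequence of the Euler identity and a maximum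
  principle.
\<close>

section \<open>Multi-indices\<close>

text \<open>The quotients in a Dunkl operator are singular on the root hyperplanes, and the
  hypothesis on \<open>V\<close> speaks only of points off them. Replacing each quotient by its
  continuous extension gives operators that map polynomials to polynomials and can be iterated; the
  intertwining relation then extends by density. Commutativity of these operators is not computed
  from the root system but inherited from partial derivatives through \<open>V\<close>, because the
  moments of degree \<open>n\<close> span the homogeneous polynomials of degree \<open>n\<close>.
  The generating function requires the kernel to be a joint eigenfunction in its second variable
  too, while the moments give this directly only in the first. It is proved degree by degree from a
  uniqueness principle: a homogeneous polynomial of positive degree killed by all Dunkl operators is
  zero, which again rests on the maximum principle and so on \<open>k \<ge> 0\<close>. Finally,
  \<open>E R_\<nu>\<close> reduces to the values \<open>E m_\<rho>\<close>, which come from the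
  integrated Euler identity: its reflection terms cancel by invariance of the measure, so these
  values do not depend on \<open>k\<close>.\<close>

definition inc :: "'n \<Rightarrow> ('n::finite \<Rightarrow> nat) \<Rightarrow> 'n \<Rightarrow> nat" where
  "inc i \<kappa> = \<kappa>(i := Suc (\<kappa> i))"

lemma prod_fun_upd_UNIV:
  fixes f :: "'n::finite \<Rightarrow> 'b \<Rightarrow> 'c::comm_monoid_mult"
  shows "(\<Prod>j\<in>UNIV. f j ((\<kappa>(i := a)) j)) = f i a * (\<Prod>j\<in>UNIV - {i}. f j (\<kappa> j))"
  by (subst prod.remove[of _ i]) (auto intro!: prod.cong)

lemma prod_remove_UNIV:
  fixes f :: "'n::finite \<Rightarrow> 'c::comm_monoid_mult"
  shows "(\<Prod>j\<in>UNIV. f j) = f i * (\<Prod>j\<in>UNIV - {i}. f j)"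
  by (subst prod.remove[of _ i]) auto

lemma mono_inc: "mono (inc i \<kappa>) x = x $ i * mono \<kappa> x"
  unfolding mono_def inc_def
  by (subst prod_fun_upd_UNIV, subst prod_remove_UNIV[of _ i]) simp

lemma mfact_inc: "mfact (inc i \<kappa>) = real (Suc (\<kappa> i)) * mfact \<kappa>"
  unfolding mfact_def inc_def
  by (subst prod_fun_upd_UNIV, subst prod_remove_UNIV[of _ i]) simp

lemma mdeg_inc [simp]: "mdeg (inc i \<kappa>) = Suc (mdeg \<kappa>)"
  unfolding mdeg_def inc_def
  by (simp add: sum.remove[of UNIV i])

lemma mfact_pos [simp]: "mfact \<kappa> > 0"
  unfolding mfact_def by (intro prod_pos) auto

lemma mfact_nonzero [simp]: "mfact \<kappa> \<noteq> 0"
  by (metis less_irrefl mfact_pos)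

lemma mfact_nonneg [simp]: "mfact \<kappa> \<ge> 0"
  by (rule less_imp_le) (rule mfact_pos)

lemma inc_apply [simp]: "inc i \<kappa> i = Suc (\<kappa> i)" "j \<noteq> i \<Longrightarrow> inc i \<kappa> j = \<kappa> j"
  by (auto simp: inc_def)

lemma inc_inject [simp]: "inc i \<kappa> = inc i \<mu> \<longleftrightarrow> \<kappa> = \<mu>"
  by (auto simp: inc_def fun_eq_iff split: if_splits)

lemma inc_decomp: "\<kappa> i \<noteq> 0 \<Longrightarrow> \<exists>\<mu>. \<kappa> = inc i \<mu>"
  by (intro exI[of _ "\<kappa>(i := \<kappa> i - 1)"]) (auto simp: inc_def)

lemma inc_diff_one [simp]: "(inc i \<kappa>)(i := \<kappa> i) = \<kappa>"
  by (auto simp: inc_def)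

lemma mdeg_eq_0_iff: "mdeg \<kappa> = 0 \<longleftrightarrow> \<kappa> = (\<lambda>_. 0)"
  by (auto simp: mdeg_def)

lemma mono_zero [simp]: "mono (\<lambda>_. 0) = (\<lambda>x. 1)"
  and mfact_zero [simp]: "mfact (\<lambda>_. 0) = 1"
  and mdeg_zero [simp]: "mdeg (\<lambda>_. 0) = 0"
  by (auto simp: mono_def mfact_def mdeg_def)

text \<open>The raising and lowering relations change one exponent by one; this is the induction
  that fits them.\<close>

lemma multiindex_induct [case_names zero inc]:
  assumes "P (\<lambda>_. 0)" and "\<And>i \<kappa>. P \<kappa> \<Longrightarrow> P (inc i \<kappa>)"
  shows "P \<kappa>"
proof (induction "mdeg \<kappa>" arbitrary: \<kappa>)
  case 0
  then have "\<kappa> = (\<lambda>_. 0)" by (simp add: mdeg_eq_0_iff[symmetric])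
  then show ?case using assms(1) by simp
next
  case (Suc n)
  then have "mdeg \<kappa> \<noteq> 0" by simp
  then have "\<kappa> \<noteq> (\<lambda>_. 0)" unfolding mdeg_eq_0_iff .
  then obtain i where "\<kappa> i \<noteq> 0" by (auto simp: fun_eq_iff)
  then obtain \<mu> where "\<kappa> = inc i \<mu>" using inc_decomp by blast
  then show ?case using Suc assms(2) by simp
qed

lemma le_mdeg: "\<kappa> i \<le> mdeg \<kappa>"
  unfolding mdeg_def by (rule member_le_sum) auto

lemma finite_mdeg [simp]: "finite {\<kappa>::'n::finite \<Rightarrow> nat. mdeg \<kappa> = n}"
proof (rule finite_subset)
  show "{\<kappa>::'n \<Rightarrow> nat. mdeg \<kappa> = n} \<subseteq> PiE UNIV (\<lambda>_. {..n})"
    using le_mdeg by auto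
qed (auto intro: finite_PiE)

lemma mdeg_level_zero: "{\<kappa>. mdeg \<kappa> = 0} = {\<lambda>_. 0}"
  by (auto simp: mdeg_eq_0_iff)

text \<open>Termwise differentiation of an exponential series: the factor \<open>\<kappa> i\<close>
  removes the indices that are not of the form \<open>inc i \<mu>\<close> and cancels one factor of
  the factorial on the others.\<close>

lemma sum_mdeg_Suc:
  fixes g :: "('n::finite \<Rightarrow> nat) \<Rightarrow> real"
  shows "(\<Sum>\<kappa> | mdeg \<kappa> = Suc n. real (\<kappa> i) / mfact \<kappa> * g \<kappa>)
       = (\<Sum>\<mu> | mdeg \<mu> = n. g (inc i \<mu>) / mfact \<mu>)"
proof -
  have "(\<Sum>\<kappa> | mdeg \<kappa> = Suc n. real (\<kappa> i) / mfact \<kappa> * g \<kappa>)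
     = (\<Sum>\<kappa>\<in>inc i ` {\<mu>. mdeg \<mu> = n}. real (\<kappa> i) / mfact \<kappa> * g \<kappa>)"
  proof (rule sum.mono_neutral_right)
    show "\<forall>\<kappa>\<in>{\<kappa>. mdeg \<kappa> = Suc n} - inc i ` {\<mu>. mdeg \<mu> = n}. real (\<kappa> i) / mfact \<kappa> * g \<kappa> = 0"
    proof
      fix \<kappa> :: "'n \<Rightarrow> nat" assume *: "\<kappa> \<in> {\<kappa>. mdeg \<kappa> = Suc n} - inc i ` {\<mu>. mdeg \<mu> = n}"
      have "\<kappa> i = 0"
      proof (rule ccontr)
        assume "\<kappa> i \<noteq> 0"
        then obtain \<mu> where "\<kappa> = inc i \<mu>" using inc_decomp by blast
        with * show False by auto
      qed
      then show "real (\<kappa> i) / mfact \<kappa> * g \<kappa> = 0" by simp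
    qed
  qed auto
  also have "\<dots> = (\<Sum>\<mu> | mdeg \<mu> = n. real (inc i \<mu> i) / mfact (inc i \<mu>) * g (inc i \<mu>))"
    by (subst sum.reindex) (auto simp: inj_on_def)
  also have "\<dots> = (\<Sum>\<mu> | mdeg \<mu> = n. g (inc i \<mu>) / mfact \<mu>)"
    by (intro sum.cong) (auto simp: mfact_inc simp del: of_nat_Suc)
  finally show ?thesis .
qed

text \<open>The multinomial theorem at the point with all coordinates 1. Writing
  \<open>Suc n\<close> as the sum of the \<open>\<kappa> i\<close> reduces level
  \<open>Suc n\<close> to level \<open>n\<close>, once for each coordinate.\<close>

lemma sum_inverse_mfact:
  "(\<Sum>\<kappa>::'n::finite \<Rightarrow> nat | mdeg \<kappa> = n. 1 / mfact \<kappa>) = real CARD('n) ^ n / fact n"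
proof (induction n)
  case 0
  then show ?case by (simp add: mdeg_level_zero)
next
  case (Suc n)
  have "real (Suc n) * (\<Sum>\<kappa>::'n \<Rightarrow> nat | mdeg \<kappa> = Suc n. 1 / mfact \<kappa>)
      = (\<Sum>\<kappa>::'n \<Rightarrow> nat | mdeg \<kappa> = Suc n. \<Sum>i\<in>UNIV. real (\<kappa> i) / mfact \<kappa> * 1)"
    unfolding sum_distrib_left
  proof (intro sum.cong refl)
    fix \<kappa> :: "'n \<Rightarrow> nat" assume "\<kappa> \<in> {\<kappa>. mdeg \<kappa> = Suc n}"
    then have "real (Suc n) = (\<Sum>i\<in>UNIV. real (\<kappa> i))"
      unfolding mdeg_def by (metis (mono_tags, lifting) mem_Collect_eq of_nat_sum)
    then show "real (Suc n) * (1 / mfact \<kappa>) = (\<Sum>i\<in>UNIV. real (\<kappa> i) / mfact \<kappa> * 1)"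
      by (simp add: sum_divide_distrib)
  qed
  also have "\<dots> = (\<Sum>i\<in>(UNIV::'n set). \<Sum>\<kappa>::'n \<Rightarrow> nat | mdeg \<kappa> = Suc n. real (\<kappa> i) / mfact \<kappa> * 1)"
    by (rule sum.swap)
  also have "\<dots> = real CARD('n) * (real CARD('n) ^ n / fact n)"
    by (simp only: sum_mdeg_Suc[where g = "\<lambda>_. 1"] Suc sum_constant)
  finally have "(\<Sum>\<kappa>::'n \<Rightarrow> nat | mdeg \<kappa> = Suc n. 1 / mfact \<kappa>)
      = (real CARD('n) * (real CARD('n) ^ n / fact n)) / real (Suc n)"
    by (simp only: nonzero_eq_divide_eq of_nat_neq_0 mult.commute not_False_eq_True)
  then show ?case by (simp add: mult.commute)
qed

section \<open>Polynomial functions, reflections and divided differences\<close>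

abbreviation "pf \<equiv> real_polynomial_function"

lemmas pf_add = real_polynomial_function.intros(3)
  and pf_mult = real_polynomial_function.intros(4)
  and pf_sum = real_polynomial_function_sum

lemma pf_inner [intro]: "pf (\<lambda>x. a \<bullet> x)"
  by (rule real_polynomial_function.intros(1)) (rule bounded_linear_inner_right)

lemma pf_nth [intro]: "pf (\<lambda>x::real^'n. x $ i)"
  by (rule real_polynomial_function.intros(1)) (rule bounded_linear_vec_nth)

lemma pf_cmult [intro]: "pf f \<Longrightarrow> pf (\<lambda>x. c * f x)"
  by (rule pf_mult) auto

lemma pf_continuous: "pf f \<Longrightarrow> continuous_on UNIV f"
  using continuous_real_polymonial_function continuous_at_imp_continuous_on by blast

lemma pf_mono [intro]: "pf (mono \<kappa>)"
  unfolding mono_def by (intro real_polynomial_function_prod real_polynomial_function_power pf_nth) auto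

lemma linear_reflection: "linear (reflection \<alpha>)"
  by (rule linearI) (auto simp: reflection_def algebra_simps inner_simps)

lemma bounded_linear_reflection: "bounded_linear (reflection \<alpha>)"
  using linear_reflection linear_conv_bounded_linear by blast

lemma pf_compose_reflection: "pf f \<Longrightarrow> pf (\<lambda>x. f (reflection \<alpha> x))"
  using real_polynomial_function_compose[of "reflection \<alpha>" f]
    polynomial_function_bounded_linear[OF bounded_linear_reflection[of \<alpha>]]
  by (simp add: o_def)

lemma reflection_reflection: "\<alpha> \<bullet> \<alpha> = 2 \<Longrightarrow> reflection \<alpha> (reflection \<alpha> x) = x"
  by (simp add: reflection_def inner_simps)

lemma inner_reflection: "a \<bullet> reflection \<alpha> x = reflection \<alpha> a \<bullet> x"
  by (simp add: reflection_def inner_simps inner_commute)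

lemma inner_reflection_reflection: "\<alpha> \<bullet> \<alpha> = 2 \<Longrightarrow> reflection \<alpha> x \<bullet> reflection \<alpha> y = x \<bullet> y"
  by (simp add: inner_reflection reflection_reflection)

lemma norm_reflection: "\<alpha> \<bullet> \<alpha> = 2 \<Longrightarrow> norm (reflection \<alpha> x) = norm x"
  by (simp add: norm_eq_sqrt_inner inner_reflection_reflection)

lemma reflection_self: "\<alpha> \<bullet> \<alpha> = 2 \<Longrightarrow> reflection \<alpha> \<alpha> = - \<alpha>"
  by (simp add: reflection_def scaleR_2)

lemma reflection_uminus_root: "reflection (- \<alpha>) x = reflection \<alpha> x"
  by (simp add: reflection_def)

lemma reflection_conjugate:
  "\<beta> \<bullet> \<beta> = 2 \<Longrightarrow> reflection (reflection \<beta> \<alpha>) (reflection \<beta> x) = reflection \<beta> (reflection \<alpha> x)"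
  by (simp add: inner_reflection_reflection reflection_def[of "reflection \<beta> \<alpha>"])
     (simp add: reflection_def[of \<alpha>] linear_diff[OF linear_reflection] linear_cmul[OF linear_reflection])

text \<open>On the line through \<open>x\<close> in direction \<open>\<beta>\<close> each form
  \<open>\<alpha> \<bullet> x\<close> has at most one zero, so small nonzero parameters avoid all
  hyperplanes. This is how identities known only where \<open>dunkl\<close> is literally defined
  become identities everywhere.\<close>

lemma continuous_eq_off_hyperplanes:
  fixes f g :: "'a::real_inner \<Rightarrow> real"
  assumes fin: "finite A" and \<beta>: "\<And>\<alpha>. \<alpha> \<in> A \<Longrightarrow> \<alpha> \<bullet> \<beta> \<noteq> 0"
    and f: "continuous_on UNIV f" and g: "continuous_on UNIV g"
    and eq: "\<And>x. (\<forall>\<alpha>\<in>A. \<alpha> \<bullet> x \<noteq> 0) \<Longrightarrow> f x = g x"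
  shows "f = g"
proof
  fix x
  define \<phi> where "\<phi> s = f (x + s *\<^sub>R \<beta>) - g (x + s *\<^sub>R \<beta>)" for s
  have "continuous_on UNIV \<phi>"
    unfolding \<phi>_def
    by (intro continuous_intros continuous_on_compose2[OF f] continuous_on_compose2[OF g]) auto
  then have lim: "(\<phi> \<longlongrightarrow> \<phi> 0) (at 0)"
    by (simp add: continuous_on_def)
  have "eventually (\<lambda>s. \<alpha> \<bullet> (x + s *\<^sub>R \<beta>) \<noteq> 0) (at (0::real))" if "\<alpha> \<in> A" for \<alpha>
  proof (cases "\<alpha> \<bullet> x = 0")
    case True
    then show ?thesis using \<beta>[OF that] by (auto simp: eventually_at_filter inner_simps)
  next
    case False
    have "((\<lambda>s::real. \<alpha> \<bullet> (x + s *\<^sub>R \<beta>)) \<longlongrightarrow> \<alpha> \<bullet> (x + 0 *\<^sub>R \<beta>)) (at 0)"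
      by (intro tendsto_intros)
    then show ?thesis using False by (intro tendsto_imp_eventually_ne) auto
  qed
  then have "eventually (\<lambda>s. \<forall>\<alpha>\<in>A. \<alpha> \<bullet> (x + s *\<^sub>R \<beta>) \<noteq> 0) (at (0::real))"
    using fin by (simp add: eventually_ball_finite)
  then have "eventually (\<lambda>s. \<phi> s = 0) (at 0)"
    by eventually_elim (auto simp: \<phi>_def eq)
  then have "(\<phi> \<longlongrightarrow> 0) (at 0)" by (rule tendsto_eventually)
  with lim have "\<phi> 0 = 0" using tendsto_unique trivial_limit_at by blast
  then show "f x = g x" by (simp add: \<phi>_def)
qed

text \<open>The continuous extension of the difference quotient across the hyperplane of
  \<open>\<alpha>\<close>. For \<open>\<alpha> \<noteq> 0\<close> continuity determines it uniquely,
  so the choice operator returns any continuous factor that can be exhibited.\<close>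

definition divdiff :: "real^'n::finite \<Rightarrow> (real^'n \<Rightarrow> real) \<Rightarrow> real^'n \<Rightarrow> real" where
  "divdiff \<alpha> f = (SOME h. continuous_on UNIV h \<and> (\<forall>x. f x - f (reflection \<alpha> x) = (\<alpha> \<bullet> x) * h x))"

lemma divdiff_eqI:
  assumes "\<alpha> \<noteq> 0" "continuous_on UNIV h" "\<And>x. f x - f (reflection \<alpha> x) = (\<alpha> \<bullet> x) * h x"
  shows "divdiff \<alpha> f = h"
proof -
  have "continuous_on UNIV (divdiff \<alpha> f) \<and> (\<forall>x. f x - f (reflection \<alpha> x) = (\<alpha> \<bullet> x) * divdiff \<alpha> f x)"
    unfolding divdiff_def by (rule someI[of _ h]) (use assms in auto)
  then show ?thesis
    using assms
    by (intro continuous_eq_off_hyperplanes[of "{\<alpha>}" \<alpha>]) (simp_all, metis mult_left_cancel)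
qed

text \<open>For linear \<open>f\<close> the factor is the constant \<open>f \<alpha>\<close>,
  because the reflection moves \<open>x\<close> by a multiple of \<open>\<alpha>\<close>. Products
  obey a Leibniz rule in which one factor is taken at the reflected point.\<close>

lemma pf_divdiff_ex:
  assumes "pf f"
  shows "\<exists>h. pf h \<and> (\<forall>x. f x - f (reflection \<alpha> x) = (\<alpha> \<bullet> x) * h x)"
  using assms
proof induction
  case (linear f)
  have "linear f" by (simp add: linear bounded_linear.linear)
  then have "f x - f (reflection \<alpha> x) = (\<alpha> \<bullet> x) * f \<alpha>" for x
    by (simp add: reflection_def linear_diff linear_cmul)
  then show ?case by (intro exI[of _ "\<lambda>_. f \<alpha>"]) auto
next
  case (const c)
  show ?case by (intro exI[of _ "\<lambda>_. 0"]) auto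
next
  case (add f g)
  then obtain h1 h2 where h: "pf h1" "pf h2" "\<And>x. f x - f (reflection \<alpha> x) = (\<alpha> \<bullet> x) * h1 x"
    "\<And>x. g x - g (reflection \<alpha> x) = (\<alpha> \<bullet> x) * h2 x" by blast
  have "f x + g x - (f (reflection \<alpha> x) + g (reflection \<alpha> x)) = (\<alpha> \<bullet> x) * (h1 x + h2 x)" for x
    using h(3,4)[of x] unfolding distrib_left by linarith
  then show ?case using h by (intro exI[of _ "\<lambda>x. h1 x + h2 x"]) auto
next
  case (mult f g)
  then obtain h1 h2 where h: "pf h1" "pf h2" "\<And>x. f x - f (reflection \<alpha> x) = (\<alpha> \<bullet> x) * h1 x"
    "\<And>x. g x - g (reflection \<alpha> x) = (\<alpha> \<bullet> x) * h2 x" by blast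
  have "f x * g x - f (reflection \<alpha> x) * g (reflection \<alpha> x)
      = (\<alpha> \<bullet> x) * (h1 x * g x + f (reflection \<alpha> x) * h2 x)" for x
  proof -
    have "f x * g x - f (reflection \<alpha> x) * g (reflection \<alpha> x)
      = (f x - f (reflection \<alpha> x)) * g x + f (reflection \<alpha> x) * (g x - g (reflection \<alpha> x))"
      by (simp add: algebra_simps)
    then show ?thesis unfolding h by (simp add: algebra_simps)
  qed
  moreover have "pf (\<lambda>x. h1 x * g x + f (reflection \<alpha> x) * h2 x)"
    using h mult by (intro pf_add pf_mult pf_compose_reflection)
  ultimately show ?case by blast
qed

lemma divdiff_pf:
  assumes "pf f" "\<alpha> \<noteq> 0"
  shows pf_divdiff: "pf (divdiff \<alpha> f)"
    and divdiff_mult: "f x - f (reflection \<alpha> x) = (\<alpha> \<bullet> x) * divdiff \<alpha> f x"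
proof -
  obtain h where h: "pf h" "\<And>x. f x - f (reflection \<alpha> x) = (\<alpha> \<bullet> x) * h x"
    using pf_divdiff_ex[OF assms(1)] by blast
  then have "divdiff \<alpha> f = h" using assms(2) by (intro divdiff_eqI) (auto intro: pf_continuous)
  then show "pf (divdiff \<alpha> f)" "f x - f (reflection \<alpha> x) = (\<alpha> \<bullet> x) * divdiff \<alpha> f x"
    using h by auto
qed

section \<open>Partial derivatives of polynomial functions\<close>

lemma partial_deriv_ex:
  fixes f :: "real^'n::finite \<Rightarrow> real"
  assumes "pf f"
  shows "\<exists>g. pf g \<and> (\<forall>x. ((\<lambda>s. f (x + s *\<^sub>R axis i 1)) has_real_derivative g x) (at 0))"
  using assms
proof induction
  case (linear f)
  have "linear f" by (simp add: linear bounded_linear.linear)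
  then have "(\<lambda>s. f (x + s *\<^sub>R axis i 1)) = (\<lambda>s. f x + s * f (axis i 1))" for x
    by (simp add: linear_add linear_cmul)
  then show ?case by (intro exI[of _ "\<lambda>_. f (axis i 1)"]) (auto intro!: derivative_eq_intros)
next
  case (const c)
  show ?case by (intro exI[of _ "\<lambda>_. 0"]) auto
next
  case (add f g)
  then obtain h1 h2 where "pf h1" "pf h2"
    "\<And>x. ((\<lambda>s. f (x + s *\<^sub>R axis i 1)) has_real_derivative h1 x) (at 0)"
    "\<And>x. ((\<lambda>s. g (x + s *\<^sub>R axis i 1)) has_real_derivative h2 x) (at 0)" by blast
  then show ?case by (intro exI[of _ "\<lambda>x. h1 x + h2 x"]) (auto intro!: DERIV_add)
next
  case (mult f g)
  then obtain h1 h2 where h: "pf h1" "pf h2"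
    "\<And>x. ((\<lambda>s. f (x + s *\<^sub>R axis i 1)) has_real_derivative h1 x) (at 0)"
    "\<And>x. ((\<lambda>s. g (x + s *\<^sub>R axis i 1)) has_real_derivative h2 x) (at 0)" by blast
  then have "((\<lambda>s. f (x + s *\<^sub>R axis i 1) * g (x + s *\<^sub>R axis i 1)) has_real_derivative
      h1 x * g x + h2 x * f x) (at 0)" for x
    using DERIV_mult[OF h(3)[of x] h(4)[of x]] by simp
  then show ?case using h mult by (intro exI[of _ "\<lambda>x. h1 x * g x + h2 x * f x"]) auto
qed

lemma partial_deriv_eqI:
  "(\<And>x. ((\<lambda>s. f (x + s *\<^sub>R axis i 1)) has_real_derivative g x) (at 0)) \<Longrightarrow> partial_deriv i f = g"
  unfolding partial_deriv_def using DERIV_imp_deriv by blast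

lemma partial_deriv_pf:
  assumes "pf f"
  shows pf_partial_deriv: "pf (partial_deriv i f)"
    and has_partial_deriv: "((\<lambda>s. f (x + s *\<^sub>R axis i 1)) has_real_derivative partial_deriv i f x) (at 0)"
  using partial_deriv_ex[OF assms, of i] partial_deriv_eqI[of f i] by metis+

lemma has_partial_deriv_at:
  assumes "\<And>x. ((\<lambda>s. f (x + s *\<^sub>R axis i 1)) has_real_derivative g x) (at 0)"
  shows "((\<lambda>s. f (x + s *\<^sub>R axis i 1)) has_real_derivative g (x + s *\<^sub>R axis i 1)) (at s)"
proof -
  have "((\<lambda>u. f ((x + s *\<^sub>R axis i 1) + u *\<^sub>R axis i 1)) has_real_derivative g (x + s *\<^sub>R axis i 1)) (at 0)"
    by (rule assms)
  then have "((\<lambda>u. f (x + (u + s) *\<^sub>R axis i 1)) has_real_derivative g (x + s *\<^sub>R axis i 1)) (at 0)"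
    by (simp add: algebra_simps)
  then show ?thesis using DERIV_shift[of "\<lambda>u. f (x + u *\<^sub>R axis i 1)" _ 0 s] by simp
qed

lemma partial_deriv_mult:
  assumes "pf f" "pf g"
  shows "partial_deriv i (\<lambda>x. f x * g x) = (\<lambda>x. partial_deriv i f x * g x + partial_deriv i g x * f x)"
  using DERIV_mult[OF has_partial_deriv[OF assms(1)] has_partial_deriv[OF assms(2)]]
  by (intro partial_deriv_eqI) simp

lemma partial_deriv_inner: "partial_deriv i (\<lambda>x. a \<bullet> x) = (\<lambda>x. a $ i)"
  by (intro partial_deriv_eqI) (auto intro!: derivative_eq_intros simp: inner_simps inner_axis)

text \<open>For \<open>\<kappa> i = 0\<close> the truncated exponent is harmless, as the coefficient
  is 0.\<close>

lemma partial_deriv_mono: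
  "partial_deriv i (mono \<kappa>) = (\<lambda>x. real (\<kappa> i) * mono (\<kappa>(i := \<kappa> i - 1)) x)"
proof (induction \<kappa> rule: multiindex_induct)
  case zero
  show ?case by (auto intro!: partial_deriv_eqI)
next
  case (inc j \<kappa>)
  have eq: "mono (inc j \<kappa>) = (\<lambda>x. (axis j 1 \<bullet> x) * mono \<kappa> x)"
    by (simp add: mono_inc inner_axis' fun_eq_iff)
  have pd: "partial_deriv i (mono (inc j \<kappa>)) x
      = axis j 1 $ i * mono \<kappa> x + real (\<kappa> i) * mono (\<kappa>(i := \<kappa> i - 1)) x * (x $ j)" for x
    unfolding eq by (subst partial_deriv_mult) (auto simp: inc partial_deriv_inner inner_axis' fun_upd_def)
  show ?case
  proof
    fix x
    show "partial_deriv i (mono (inc j \<kappa>)) x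
      = real (inc j \<kappa> i) * mono ((inc j \<kappa>)(i := inc j \<kappa> i - 1)) x"
    proof (cases "i = j")
      case True
      have "real (\<kappa> i) * mono (\<kappa>(i := \<kappa> i - 1)) x * (x $ i) = real (\<kappa> i) * mono \<kappa> x"
      proof (cases "\<kappa> i = 0")
        case False
        then have "\<kappa> = inc i (\<kappa>(i := \<kappa> i - 1))" by (auto simp: inc_def)
        then show ?thesis using mono_inc[of i "\<kappa>(i := \<kappa> i - 1)" x] by simp
      qed simp
      then show ?thesis using True unfolding pd by (simp add: axis_def algebra_simps)
    next
      case False
      then have "(inc j \<kappa>)(i := \<kappa> i - 1) = inc j (\<kappa>(i := \<kappa> i - 1))" by (auto simp: inc_def)
      then show ?thesis using False unfolding pd by (simp add: axis_def mono_inc)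
    qed
  qed
qed

lemma partial_deriv_add:
  assumes "pf f" "pf g"
  shows "partial_deriv i (\<lambda>x. f x + g x) = (\<lambda>x. partial_deriv i f x + partial_deriv i g x)"
  by (intro partial_deriv_eqI DERIV_add has_partial_deriv assms)

lemma partial_deriv_cmult:
  assumes "pf f"
  shows "partial_deriv i (\<lambda>x. c * f x) = (\<lambda>x. c * partial_deriv i f x)"
  by (intro partial_deriv_eqI DERIV_cmult has_partial_deriv assms)

lemma partial_deriv_const: "partial_deriv i (\<lambda>x. c) = (\<lambda>x. 0)"
  by (intro partial_deriv_eqI) simp

lemma divdiff_add:
  assumes "pf f" "pf g" "\<alpha> \<noteq> 0"
  shows "divdiff \<alpha> (\<lambda>x. f x + g x) = (\<lambda>x. divdiff \<alpha> f x + divdiff \<alpha> g x)"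
proof (rule divdiff_eqI)
  fix x
  show "f x + g x - (f (reflection \<alpha> x) + g (reflection \<alpha> x))
      = (\<alpha> \<bullet> x) * (divdiff \<alpha> f x + divdiff \<alpha> g x)"
    using divdiff_mult[OF assms(1,3), of x] divdiff_mult[OF assms(2,3), of x]
    unfolding distrib_left by linarith
qed (auto intro!: pf_continuous pf_divdiff assms)

lemma divdiff_cmult:
  assumes "pf f" "\<alpha> \<noteq> 0"
  shows "divdiff \<alpha> (\<lambda>x. c * f x) = (\<lambda>x. c * divdiff \<alpha> f x)"
proof (rule divdiff_eqI)
  fix x
  show "c * f x - c * f (reflection \<alpha> x) = (\<alpha> \<bullet> x) * (c * divdiff \<alpha> f x)"
    using divdiff_mult[OF assms, of x] by (metis mult.left_commute right_diff_distrib)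
qed (auto intro!: pf_continuous pf_divdiff assms)

lemma divdiff_const: "\<alpha> \<noteq> 0 \<Longrightarrow> divdiff \<alpha> (\<lambda>x. c) = (\<lambda>x. 0)"
  by (rule divdiff_eqI) auto

text \<open>The reflected value of \<open>f\<close> on the right is the source of all reflection
  terms in the commutators of Dunkl operators with linear forms; its coefficient is the divided
  difference of \<open>a \<bullet> x\<close>.\<close>

lemma divdiff_inner_mult:
  assumes "pf f" "\<alpha> \<noteq> 0"
  shows "divdiff \<alpha> (\<lambda>x. (a \<bullet> x) * f x) = (\<lambda>x. (a \<bullet> x) * divdiff \<alpha> f x + (a \<bullet> \<alpha>) * f (reflection \<alpha> x))"
proof (rule divdiff_eqI)
  fix x
  have eq: "a \<bullet> x - a \<bullet> reflection \<alpha> x = (\<alpha> \<bullet> x) * (a \<bullet> \<alpha>)"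
    by (simp add: reflection_def inner_simps)
  have "(a \<bullet> x) * f x - (a \<bullet> reflection \<alpha> x) * f (reflection \<alpha> x)
      = (a \<bullet> x) * (f x - f (reflection \<alpha> x)) + (a \<bullet> x - a \<bullet> reflection \<alpha> x) * f (reflection \<alpha> x)"
    by (simp add: algebra_simps)
  also have "\<dots> = (\<alpha> \<bullet> x) * ((a \<bullet> x) * divdiff \<alpha> f x + (a \<bullet> \<alpha>) * f (reflection \<alpha> x))"
    unfolding eq divdiff_mult[OF assms, of x] by (simp add: algebra_simps)
  finally show "(a \<bullet> x) * f x - (a \<bullet> reflection \<alpha> x) * f (reflection \<alpha> x)
      = (\<alpha> \<bullet> x) * ((a \<bullet> x) * divdiff \<alpha> f x + (a \<bullet> \<alpha>) * f (reflection \<alpha> x))" .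
next
  have "pf (\<lambda>x. (a \<bullet> x) * divdiff \<alpha> f x + (a \<bullet> \<alpha>) * f (reflection \<alpha> x))"
    by (intro pf_add pf_mult pf_inner pf_divdiff pf_cmult
        pf_compose_reflection[OF assms(1)] assms)
  then show "continuous_on UNIV (\<lambda>x. (a \<bullet> x) * divdiff \<alpha> f x + (a \<bullet> \<alpha>) * f (reflection \<alpha> x))"
    by (rule pf_continuous)
qed (fact assms)

text \<open>Homogeneous polynomials of degree \<open>n\<close> that are combinations of products of \<open>n\<close> linear
  forms \<open>a \<bullet> x\<close> with \<open>norm a \<le> 1\<close>, the coefficients having absolute sum at most \<open>B\<close>.  Measured in
  this norm, a Dunkl operator grows only linearly with the degree.\<close>

inductive hpoly :: "nat \<Rightarrow> real \<Rightarrow> (real^'n::finite \<Rightarrow> real) \<Rightarrow> bool" where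
  hpoly_const: "hpoly 0 \<bar>c\<bar> (\<lambda>x. c)"
| hpoly_inner: "norm a \<le> 1 \<Longrightarrow> hpoly n B f \<Longrightarrow> hpoly (Suc n) B (\<lambda>x. (a \<bullet> x) * f x)"
| hpoly_add: "hpoly n B f \<Longrightarrow> hpoly n C g \<Longrightarrow> hpoly n (B + C) (\<lambda>x. f x + g x)"
| hpoly_cmult: "hpoly n B f \<Longrightarrow> hpoly n (\<bar>c\<bar> * B) (\<lambda>x. c * f x)"
| hpoly_weaken: "hpoly n B f \<Longrightarrow> B \<le> C \<Longrightarrow> hpoly n C f"

lemma hpoly_pf: "hpoly n B f \<Longrightarrow> pf f"
  by (induction rule: hpoly.induct) auto

lemma hpoly_nonneg: "hpoly n B f \<Longrightarrow> B \<ge> 0"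
  by (induction rule: hpoly.induct) auto

lemma hpoly_bound: "hpoly n B f \<Longrightarrow> \<bar>f x\<bar> \<le> B * norm x ^ n"
proof (induction rule: hpoly.induct)
  case (hpoly_inner a n B f)
  have "\<bar>a \<bullet> x\<bar> \<le> norm x"
    using Cauchy_Schwarz_ineq2[of a x] mult_right_mono[OF hpoly_inner(1), of "norm x"] by simp
  then have "\<bar>a \<bullet> x\<bar> * \<bar>f x\<bar> \<le> norm x * (B * norm x ^ n)"
    using hpoly_inner by (intro mult_mono) auto
  then show ?case by (simp add: abs_mult algebra_simps)
next
  case (hpoly_add n B f C g)
  then show ?case by (simp add: algebra_simps)
next
  case (hpoly_cmult n B f c)
  then show ?case using mult_left_mono[of _ _ "\<bar>c\<bar>"] by (simp add: abs_mult mult.assoc)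
next
  case (hpoly_weaken n B f C)
  then show ?case by (meson mult_right_mono norm_ge_zero order_trans zero_le_power)
qed auto

lemma hpoly_scaleR: "hpoly n B f \<Longrightarrow> f (s *\<^sub>R x) = s ^ n * f x"
  by (induction rule: hpoly.induct) (auto simp: algebra_simps)

lemma hpoly_reflection:
  assumes "\<alpha> \<bullet> \<alpha> = 2"
  shows "hpoly n B f \<Longrightarrow> hpoly n B (\<lambda>x. f (reflection \<alpha> x))"
proof (induction rule: hpoly.induct)
  case (hpoly_inner a n B f)
  then have "hpoly (Suc n) B (\<lambda>x. (reflection \<alpha> a \<bullet> x) * f (reflection \<alpha> x))"
    by (intro hpoly.hpoly_inner) (auto simp: norm_reflection assms)
  then show ?case by (simp add: inner_reflection)
qed (auto intro: hpoly.intros)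

lemma hpoly_zero: "hpoly n 0 (\<lambda>x. 0)"
proof (induction n)
  case 0
  then show ?case using hpoly_const[of 0] by simp
next
  case (Suc n)
  then show ?case using hpoly_inner[OF _ Suc, of 0] by simp
qed

lemma hpoly_diff: "hpoly n B f \<Longrightarrow> hpoly n C g \<Longrightarrow> hpoly n (B + C) (\<lambda>x. f x - g x)"
  using hpoly_add[of n B f C "\<lambda>x. -1 * g x"] hpoly_cmult[of n C g "-1"] by simp

lemma hpoly_sum:
  assumes "finite I" "\<And>i. i \<in> I \<Longrightarrow> hpoly n (B i) (f i)"
  shows "hpoly n (\<Sum>i\<in>I. B i) (\<lambda>x. \<Sum>i\<in>I. f i x)"
  using assms by (induction I rule: finite_induct) (auto intro: hpoly_zero hpoly_add)

lemma hpoly_mono: "hpoly (mdeg \<kappa>) 1 (mono \<kappa>)"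
proof (induction \<kappa> rule: multiindex_induct)
  case zero
  then show ?case using hpoly_const[of 1] by simp
next
  case (inc i \<kappa>)
  have "mono (inc i \<kappa>) = (\<lambda>x. (axis i 1 \<bullet> x) * mono \<kappa> x)"
    by (simp add: mono_inc inner_axis' fun_eq_iff)
  then show ?case using hpoly_inner[OF _ inc, of "axis i 1"] by (simp add: norm_axis_1)
qed

section \<open>Homogeneous polynomials as sums over a full degree level\<close>

lemma homog_polyfun_iff:
  "homog_polyfun n f \<longleftrightarrow> (\<exists>c. f = (\<lambda>x. \<Sum>\<kappa> | mdeg \<kappa> = n. c \<kappa> * mono \<kappa> x))"
proof
  assume "homog_polyfun n f"
  then obtain c where c: "\<And>\<nu>. c \<nu> \<noteq> 0 \<Longrightarrow> mdeg \<nu> = n" "f = (\<lambda>x. \<Sum>\<nu>\<in>{\<nu>. c \<nu> \<noteq> 0}. c \<nu> * mono \<nu> x)"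
    unfolding homog_polyfun_def by blast
  have "f = (\<lambda>x. \<Sum>\<kappa> | mdeg \<kappa> = n. c \<kappa> * mono \<kappa> x)"
    unfolding c(2) using c(1) by (intro ext sum.mono_neutral_left) auto
  then show "\<exists>c. f = (\<lambda>x. \<Sum>\<kappa> | mdeg \<kappa> = n. c \<kappa> * mono \<kappa> x)" by blast
next
  assume "\<exists>c. f = (\<lambda>x. \<Sum>\<kappa> | mdeg \<kappa> = n. c \<kappa> * mono \<kappa> x)"
  then obtain c where c: "f = (\<lambda>x. \<Sum>\<kappa> | mdeg \<kappa> = n. c \<kappa> * mono \<kappa> x)" by blast
  define d where "d \<kappa> = (if mdeg \<kappa> = n then c \<kappa> else 0)" for \<kappa>
  have sub: "{\<kappa>. d \<kappa> \<noteq> 0} \<subseteq> {\<kappa>. mdeg \<kappa> = n}" by (auto simp: d_def)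
  then have "finite {\<kappa>. d \<kappa> \<noteq> 0}" by (rule finite_subset) simp
  moreover have "f = (\<lambda>x. \<Sum>\<kappa>\<in>{\<kappa>. d \<kappa> \<noteq> 0}. d \<kappa> * mono \<kappa> x)"
    unfolding c by (intro ext sum.mono_neutral_cong_right[OF finite_mdeg sub]) (auto simp: d_def)
  ultimately show "homog_polyfun n f"
    unfolding homog_polyfun_def by (intro exI[of _ d]) (auto simp: d_def)
qed

lemma homog_polyfun_hpoly: "homog_polyfun n f \<Longrightarrow> \<exists>B. hpoly n B f"
proof -
  assume "homog_polyfun n f"
  then obtain c where f: "f = (\<lambda>x. \<Sum>\<kappa> | mdeg \<kappa> = n. c \<kappa> * mono \<kappa> x)"
    unfolding homog_polyfun_iff by blast
  have "hpoly n (\<Sum>\<kappa> | mdeg \<kappa> = n. \<bar>c \<kappa>\<bar> * 1) f"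
    unfolding f
  proof (intro hpoly_sum hpoly_cmult)
    fix \<kappa> :: "'a \<Rightarrow> nat" assume "\<kappa> \<in> {\<kappa>. mdeg \<kappa> = n}"
    then show "hpoly n 1 (mono \<kappa>)" using hpoly_mono[of \<kappa>] by simp
  qed simp
  then show ?thesis by blast
qed

lemma homog_polyfun_mono: "homog_polyfun (mdeg \<kappa>) (mono \<kappa>)"
proof -
  have "(\<Sum>\<mu> | mdeg \<mu> = mdeg \<kappa>. (if \<mu> = \<kappa> then 1 else 0) * mono \<mu> x)
      = (\<Sum>\<mu> | mdeg \<mu> = mdeg \<kappa>. if \<mu> = \<kappa> then mono \<mu> x else 0)" for x
    by (intro sum.cong) auto
  then have "mono \<kappa> = (\<lambda>x. \<Sum>\<mu> | mdeg \<mu> = mdeg \<kappa>. (if \<mu> = \<kappa> then 1 else 0) * mono \<mu> x)"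
    by simp
  then show ?thesis
    unfolding homog_polyfun_iff by (intro exI[of _ "\<lambda>\<mu>. if \<mu> = \<kappa> then 1 else 0"])
qed

lemma homog_polyfun_add:
  "homog_polyfun n f \<Longrightarrow> homog_polyfun n g \<Longrightarrow> homog_polyfun n (\<lambda>x. f x + g x)"
  unfolding homog_polyfun_iff
proof (elim exE)
  fix c d assume "f = (\<lambda>x. \<Sum>\<kappa> | mdeg \<kappa> = n. c \<kappa> * mono \<kappa> x)"
    "g = (\<lambda>x. \<Sum>\<kappa> | mdeg \<kappa> = n. d \<kappa> * mono \<kappa> x)"
  then show "\<exists>c. (\<lambda>x. f x + g x) = (\<lambda>x. \<Sum>\<kappa> | mdeg \<kappa> = n. c \<kappa> * mono \<kappa> x)"
    by (intro exI[of _ "\<lambda>\<kappa>. c \<kappa> + d \<kappa>"]) (auto simp: sum.distrib distrib_right)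
qed

lemma homog_polyfun_cmult:
  "homog_polyfun n f \<Longrightarrow> homog_polyfun n (\<lambda>x. a * f x)"
  unfolding homog_polyfun_iff
proof (elim exE)
  fix c assume "f = (\<lambda>x. \<Sum>\<kappa> | mdeg \<kappa> = n. c \<kappa> * mono \<kappa> x)"
  then show "\<exists>c. (\<lambda>x. a * f x) = (\<lambda>x. \<Sum>\<kappa> | mdeg \<kappa> = n. c \<kappa> * mono \<kappa> x)"
    by (intro exI[of _ "\<lambda>\<kappa>. a * c \<kappa>"]) (auto simp: sum_distrib_left mult.assoc)
qed

lemma homog_polyfun_zero: "homog_polyfun n (\<lambda>x. 0)"
  unfolding homog_polyfun_iff by (intro exI[of _ "\<lambda>_. 0"]) auto

lemma homog_polyfun_sum:
  assumes "finite I" "\<And>i. i \<in> I \<Longrightarrow> homog_polyfun n (f i)"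
  shows "homog_polyfun n (\<lambda>x. \<Sum>i\<in>I. f i x)"
  using assms by (induction I rule: finite_induct) (auto intro: homog_polyfun_zero homog_polyfun_add)

lemma inner_mult_mono_sum:
  "(a \<bullet> x) * (\<Sum>\<kappa>\<in>I. c \<kappa> * mono \<kappa> x) = (\<Sum>i\<in>UNIV. \<Sum>\<kappa>\<in>I. (a $ i * c \<kappa>) * mono (inc i \<kappa>) x)"
proof -
  have "(a \<bullet> x) * (\<Sum>\<kappa>\<in>I. c \<kappa> * mono \<kappa> x)
      = (\<Sum>i\<in>UNIV. (a $ i * x $ i) * (\<Sum>\<kappa>\<in>I. c \<kappa> * mono \<kappa> x))"
    by (simp add: inner_vec_def sum_distrib_right)
  also have "\<dots> = (\<Sum>i\<in>UNIV. \<Sum>\<kappa>\<in>I. (a $ i * c \<kappa>) * mono (inc i \<kappa>) x)"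
    unfolding sum_distrib_left by (intro sum.cong refl) (simp add: mono_inc)
  finally show ?thesis .
qed

lemma hpoly_homog_polyfun: "hpoly n B f \<Longrightarrow> homog_polyfun n f"
proof (induction rule: hpoly.induct)
  case (hpoly_const c)
  then show ?case using homog_polyfun_cmult[OF homog_polyfun_mono[of "\<lambda>_. 0"], of c] by simp
next
  case (hpoly_inner a n B f)
  then obtain c where f: "f = (\<lambda>x. \<Sum>\<kappa> | mdeg \<kappa> = n. c \<kappa> * mono \<kappa> x)"
    unfolding homog_polyfun_iff by blast
  show ?case
    unfolding f inner_mult_mono_sum
  proof (intro homog_polyfun_sum homog_polyfun_cmult)
    fix i :: 'a and \<kappa> :: "'a \<Rightarrow> nat" assume "\<kappa> \<in> {\<kappa>. mdeg \<kappa> = n}"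
    then show "homog_polyfun (Suc n) (mono (inc i \<kappa>))" using homog_polyfun_mono[of "inc i \<kappa>"] by simp
  qed auto
qed (auto intro: homog_polyfun_add homog_polyfun_cmult)

section \<open>Dunkl operators\<close>

locale dunkl_setting =
  fixes R Rp :: "(real^'n::finite) set" and k :: "real^'n \<Rightarrow> real"
  assumes root_system: "root_system R" and positive: "positive_subsystem R Rp"
    and multiplicity: "multiplicity R k"
begin

section \<open>Roots, multiplicities and sums over the positive subsystem\<close>

lemma finite_R: "finite R" and root_norm: "\<alpha> \<in> R \<Longrightarrow> \<alpha> \<bullet> \<alpha> = 2"
  and root_nonzero: "\<alpha> \<in> R \<Longrightarrow> \<alpha> \<noteq> 0"
  and reflection_image: "\<alpha> \<in> R \<Longrightarrow> reflection \<alpha> ` R = R"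
  using root_system unfolding root_system_def by auto

lemma Rp_subset: "Rp \<subseteq> R" and finite_Rp: "finite Rp"
  and k_nonneg: "\<alpha> \<in> R \<Longrightarrow> k \<alpha> \<ge> 0"
  and k_reflection: "\<alpha> \<in> R \<Longrightarrow> \<beta> \<in> R \<Longrightarrow> k (reflection \<beta> \<alpha>) = k \<alpha>"
  using positive multiplicity finite_R unfolding positive_subsystem_def multiplicity_def by auto

lemma Rp_root: "\<alpha> \<in> Rp \<Longrightarrow> \<alpha> \<in> R"
  using Rp_subset by blast

lemma reflection_root: "\<alpha> \<in> R \<Longrightarrow> \<beta> \<in> R \<Longrightarrow> reflection \<beta> \<alpha> \<in> R"
  using reflection_image by blast

lemma uminus_root: "\<alpha> \<in> R \<Longrightarrow> - \<alpha> \<in> R"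
  using reflection_root[of \<alpha> \<alpha>] by (simp add: reflection_self root_norm)

lemma k_uminus: "\<alpha> \<in> R \<Longrightarrow> k (- \<alpha>) = k \<alpha>"
  using k_reflection[of \<alpha> \<alpha>] by (simp add: reflection_self root_norm)

text \<open>\<open>R\<close> is the disjoint union of \<open>Rp\<close> and its negatives, according
  to the sign of the product with the regular vector \<open>\<beta>\<close>.\<close>

lemma sum_Rp_even:
  fixes g :: "real^'n \<Rightarrow> real"
  assumes even: "\<And>\<alpha>. \<alpha> \<in> R \<Longrightarrow> g (- \<alpha>) = g \<alpha>"
  shows "2 * (\<Sum>\<alpha>\<in>Rp. g \<alpha>) = (\<Sum>\<alpha>\<in>R. g \<alpha>)"
proof -
  obtain \<beta> where \<beta>: "\<And>\<alpha>. \<alpha> \<in> R \<Longrightarrow> \<alpha> \<bullet> \<beta> \<noteq> 0" and Rp: "Rp = {\<alpha>\<in>R. \<alpha> \<bullet> \<beta> > 0}"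
    using positive unfolding positive_subsystem_def by blast
  have R: "R = Rp \<union> uminus ` Rp"
  proof (intro set_eqI iffI)
    fix \<alpha> assume "\<alpha> \<in> R"
    show "\<alpha> \<in> Rp \<union> uminus ` Rp"
    proof (cases "\<alpha> \<bullet> \<beta> > 0")
      case False
      then have "- \<alpha> \<in> Rp"
        using \<beta>[OF \<open>\<alpha> \<in> R\<close>] uminus_root[OF \<open>\<alpha> \<in> R\<close>] by (simp add: Rp)
      then show ?thesis by (metis UnI2 image_eqI minus_minus)
    qed (use \<open>\<alpha> \<in> R\<close> Rp in auto)
  qed (use Rp uminus_root in auto)
  have "Rp \<inter> uminus ` Rp = {}" by (auto simp: Rp)
  then have "(\<Sum>\<alpha>\<in>R. g \<alpha>) = (\<Sum>\<alpha>\<in>Rp. g \<alpha>) + (\<Sum>\<alpha>\<in>uminus ` Rp. g \<alpha>)"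
    by (subst R) (auto intro!: sum.union_disjoint finite_Rp)
  also have "(\<Sum>\<alpha>\<in>uminus ` Rp. g \<alpha>) = (\<Sum>\<alpha>\<in>Rp. g \<alpha>)"
    by (subst sum.reindex) (auto intro!: sum.cong even Rp_root)
  finally show ?thesis by simp
qed

text \<open>A reflection permutes \<open>R\<close> but in general not \<open>Rp\<close>, so the
  reindexing takes place in the full root system, where an even summand is counted twice.\<close>

lemma sum_Rp_reflection:
  fixes g :: "real^'n \<Rightarrow> real"
  assumes even: "\<And>\<alpha>. \<alpha> \<in> R \<Longrightarrow> g (- \<alpha>) = g \<alpha>" and \<beta>: "\<beta> \<in> R"
  shows "(\<Sum>\<alpha>\<in>Rp. g (reflection \<beta> \<alpha>)) = (\<Sum>\<alpha>\<in>Rp. g \<alpha>)"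
proof -
  have "2 * (\<Sum>\<alpha>\<in>Rp. g (reflection \<beta> \<alpha>)) = (\<Sum>\<alpha>\<in>R. g (reflection \<beta> \<alpha>))"
    by (rule sum_Rp_even[of "\<lambda>\<alpha>. g (reflection \<beta> \<alpha>)"])
       (simp add: linear_neg[OF linear_reflection] even reflection_root \<beta>)
  also have "\<dots> = (\<Sum>\<alpha>\<in>reflection \<beta> ` R. g \<alpha>)"
    by (subst sum.reindex) (auto intro!: inj_on_inverseI[of _ "reflection \<beta>"] simp: reflection_reflection root_norm \<beta>)
  also have "\<dots> = 2 * (\<Sum>\<alpha>\<in>Rp. g \<alpha>)"
    using sum_Rp_even[of g] even by (simp add: reflection_image \<beta>)
  finally show ?thesis by simp
qed

text \<open>\<open>dunkl\<close> with its quotients extended continuously, so that polynomials go to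
  polynomials and the operators can be composed.\<close>

definition T :: "'n \<Rightarrow> (real^'n \<Rightarrow> real) \<Rightarrow> real^'n \<Rightarrow> real" where
  "T i f x = partial_deriv i f x + (\<Sum>\<alpha>\<in>Rp. k \<alpha> * \<alpha> $ i * divdiff \<alpha> f x)"

lemma pf_T: "pf f \<Longrightarrow> pf (T i f)"
  unfolding T_def[abs_def]
  by (intro pf_add pf_partial_deriv pf_sum
      finite_Rp pf_cmult pf_divdiff) (auto simp: root_nonzero Rp_root)

lemma T_eq_dunkl:
  assumes "pf f" "\<forall>\<alpha>\<in>Rp. \<alpha> \<bullet> x \<noteq> 0"
  shows "dunkl i Rp k f x = T i f x"
proof -
  have "k \<alpha> * (\<alpha>$i) * (f x - f (reflection \<alpha> x)) / (\<alpha> \<bullet> x) = k \<alpha> * \<alpha> $ i * divdiff \<alpha> f x"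
    if "\<alpha> \<in> Rp" for \<alpha>
    using divdiff_mult[OF assms(1) root_nonzero[OF Rp_root[OF that]], of x] assms(2) that by simp
  then show ?thesis unfolding dunkl_def T_def by simp
qed

lemma T_add: "pf f \<Longrightarrow> pf g \<Longrightarrow> T i (\<lambda>x. f x + g x) = (\<lambda>x. T i f x + T i g x)"
proof
  fix x assume *: "pf f" "pf g"
  have "divdiff \<alpha> (\<lambda>x. f x + g x) x = divdiff \<alpha> f x + divdiff \<alpha> g x" if "\<alpha> \<in> Rp" for \<alpha>
    using divdiff_add[OF * root_nonzero[OF Rp_root[OF that]]] by simp
  then show "T i (\<lambda>x. f x + g x) x = T i f x + T i g x"
    by (simp add: T_def partial_deriv_add * distrib_left sum.distrib)
qed

lemma T_cmult: "pf f \<Longrightarrow> T i (\<lambda>x. c * f x) = (\<lambda>x. c * T i f x)"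
proof
  fix x assume *: "pf f"
  have "divdiff \<alpha> (\<lambda>x. c * f x) x = c * divdiff \<alpha> f x" if "\<alpha> \<in> Rp" for \<alpha>
    using divdiff_cmult[OF * root_nonzero[OF Rp_root[OF that]]] by simp
  then show "T i (\<lambda>x. c * f x) x = c * T i f x"
    by (simp add: T_def partial_deriv_cmult * distrib_left sum_distrib_left mult.left_commute)
qed

lemma T_const: "T i (\<lambda>x. c) = (\<lambda>x. 0)"
  by (auto simp: T_def partial_deriv_const divdiff_const root_nonzero Rp_root)

lemma T_diff: "pf f \<Longrightarrow> pf g \<Longrightarrow> T i (\<lambda>x. f x - g x) = (\<lambda>x. T i f x - T i g x)"
  using T_add[of f "\<lambda>x. -1 * g x"] T_cmult[of g i "-1"] by (simp add: real_polynomial_function_minus)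

lemma T_sum:
  assumes "finite I" "\<And>j. j \<in> I \<Longrightarrow> pf (f j)"
  shows "T i (\<lambda>x. \<Sum>j\<in>I. f j x) = (\<lambda>x. \<Sum>j\<in>I. T i (f j) x)"
  using assms
proof (induction I rule: finite_induct)
  case (insert a I)
  then show ?case by (simp add: T_add pf_sum)
qed (simp add: T_const)

lemma T_inner_mult:
  assumes "pf f"
  shows "T i (\<lambda>x. (a \<bullet> x) * f x) =
    (\<lambda>x. (a \<bullet> x) * T i f x + a $ i * f x + (\<Sum>\<alpha>\<in>Rp. (k \<alpha> * \<alpha> $ i * (a \<bullet> \<alpha>)) * f (reflection \<alpha> x)))"
proof
  fix x
  have "divdiff \<alpha> (\<lambda>x. (a \<bullet> x) * f x) x = (a \<bullet> x) * divdiff \<alpha> f x + (a \<bullet> \<alpha>) * f (reflection \<alpha> x)"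
    if "\<alpha> \<in> Rp" for \<alpha>
    using divdiff_inner_mult[OF assms root_nonzero[OF Rp_root[OF that]]] by simp
  then show "T i (\<lambda>x. (a \<bullet> x) * f x) x = (a \<bullet> x) * T i f x + a $ i * f x
      + (\<Sum>\<alpha>\<in>Rp. (k \<alpha> * \<alpha> $ i * (a \<bullet> \<alpha>)) * f (reflection \<alpha> x))"
    by (simp add: T_def partial_deriv_mult assms pf_inner partial_deriv_inner distrib_left
        sum.distrib sum_distrib_left algebra_simps)
qed

text \<open>Reflections mix coordinates, so equivariance and the Euler identity concern directions
  rather than single indices.\<close>

definition Tdir :: "real^'n \<Rightarrow> (real^'n \<Rightarrow> real) \<Rightarrow> real^'n \<Rightarrow> real" where
  "Tdir \<xi> f x = (\<Sum>i\<in>UNIV. \<xi> $ i * T i f x)"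

lemma Tdir_add: "pf f \<Longrightarrow> pf g \<Longrightarrow> Tdir \<xi> (\<lambda>x. f x + g x) x = Tdir \<xi> f x + Tdir \<xi> g x"
  by (simp add: Tdir_def T_add distrib_left sum.distrib)

lemma Tdir_cmult: "pf f \<Longrightarrow> Tdir \<xi> (\<lambda>x. c * f x) x = c * Tdir \<xi> f x"
  by (simp add: Tdir_def T_cmult sum_distrib_left mult.left_commute)

lemma Tdir_const: "Tdir \<xi> (\<lambda>x. c) x = 0"
  by (simp add: Tdir_def T_const)

lemma Tdir_inner_mult:
  assumes "pf f"
  shows "Tdir \<xi> (\<lambda>x. (a \<bullet> x) * f x) x =
    (a \<bullet> x) * Tdir \<xi> f x + (a \<bullet> \<xi>) * f x + (\<Sum>\<alpha>\<in>Rp. (k \<alpha> * (\<alpha> \<bullet> \<xi>) * (a \<bullet> \<alpha>)) * f (reflection \<alpha> x))"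
proof -
  have "(\<Sum>i\<in>UNIV. \<xi> $ i * (\<Sum>\<alpha>\<in>Rp. (k \<alpha> * \<alpha> $ i * (a \<bullet> \<alpha>)) * f (reflection \<alpha> x)))
      = (\<Sum>\<alpha>\<in>Rp. \<Sum>i\<in>UNIV. \<xi> $ i * ((k \<alpha> * \<alpha> $ i * (a \<bullet> \<alpha>)) * f (reflection \<alpha> x)))"
    unfolding sum_distrib_left by (rule sum.swap)
  also have "\<dots> = (\<Sum>\<alpha>\<in>Rp. (k \<alpha> * (\<alpha> \<bullet> \<xi>) * (a \<bullet> \<alpha>)) * f (reflection \<alpha> x))"
    unfolding inner_vec_def[of _ \<xi>] inner_real_def sum_distrib_left sum_distrib_right
    by (intro sum.cong refl) (simp add: mult_ac)
  finally show ?thesis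
    unfolding Tdir_def T_inner_mult[OF assms]
    by (simp add: distrib_left sum.distrib inner_vec_def[of a \<xi>] sum_distrib_left sum_distrib_right mult_ac)
qed

text \<open>Equivariance of Dunkl operators. Conjugation by a reflection turns the reflection in
  \<open>\<alpha>\<close> into the one in the reflected root, and invariance of \<open>k\<close>
  allows the sum over positive roots to be reindexed accordingly.\<close>

lemma Tdir_reflection:
  assumes \<beta>: "\<beta> \<in> R"
  shows "hpoly n B f \<Longrightarrow> Tdir \<xi> (\<lambda>x. f (reflection \<beta> x)) x = Tdir (reflection \<beta> \<xi>) f (reflection \<beta> x)"
proof (induction arbitrary: x rule: hpoly.induct)
  case (hpoly_inner a n B f)
  have pf: "pf f" "pf (\<lambda>x. f (reflection \<beta> x))"
    using hpoly_inner hpoly_pf pf_compose_reflection by blast+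
  define g where "g \<alpha> = (k \<alpha> * (\<alpha> \<bullet> reflection \<beta> \<xi>) * (a \<bullet> \<alpha>)) * f (reflection \<alpha> (reflection \<beta> x))" for \<alpha>
  have "(\<Sum>\<alpha>\<in>Rp. g \<alpha>) = (\<Sum>\<alpha>\<in>Rp. g (reflection \<beta> \<alpha>))"
    by (rule sum_Rp_reflection[symmetric]) (auto simp: g_def k_uminus reflection_uminus_root \<beta>)
  also have "\<dots> = (\<Sum>\<alpha>\<in>Rp. (k \<alpha> * (\<alpha> \<bullet> \<xi>) * (reflection \<beta> a \<bullet> \<alpha>)) * f (reflection \<beta> (reflection \<alpha> x)))"
    by (intro sum.cong refl)
       (simp add: g_def k_reflection Rp_root \<beta> root_norm reflection_conjugate
         inner_reflection_reflection inner_reflection[of a])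
  finally have *: "(\<Sum>\<alpha>\<in>Rp. (k \<alpha> * (\<alpha> \<bullet> reflection \<beta> \<xi>) * (a \<bullet> \<alpha>)) * f (reflection \<alpha> (reflection \<beta> x)))
      = (\<Sum>\<alpha>\<in>Rp. (k \<alpha> * (\<alpha> \<bullet> \<xi>) * (reflection \<beta> a \<bullet> \<alpha>)) * f (reflection \<beta> (reflection \<alpha> x)))"
    unfolding g_def .
  show ?case
    unfolding inner_reflection[of a \<beta>] Tdir_inner_mult[OF pf(1)] Tdir_inner_mult[OF pf(2)] *
    by (simp add: hpoly_inner inner_reflection)
next
  case (hpoly_add n B f C g)
  then show ?case
    using Tdir_add[OF pf_compose_reflection[of f \<beta>] pf_compose_reflection[of g \<beta>]]
    by (simp add: Tdir_add hpoly_pf)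
next
  case (hpoly_cmult n B f c)
  then show ?case
    using Tdir_cmult[OF pf_compose_reflection[of f \<beta>]] by (simp add: Tdir_cmult hpoly_pf)
qed (auto simp: Tdir_const)

text \<open>Euler identity. In direction \<open>x\<close> the product
  \<open>\<alpha> \<bullet> x\<close> cancels the denominators, so divided differences become plain
  differences, and the derivative part becomes the degree.\<close>

lemma Tdir_self_hpoly:
  "hpoly n B f \<Longrightarrow> Tdir x f x = real n * f x + (\<Sum>\<alpha>\<in>Rp. k \<alpha> * (f x - f (reflection \<alpha> x)))"
proof (induction rule: hpoly.induct)
  case (hpoly_inner a n B f)
  have "(\<Sum>\<alpha>\<in>Rp. k \<alpha> * ((a \<bullet> x) * f x - (a \<bullet> reflection \<alpha> x) * f (reflection \<alpha> x)))
     = (a \<bullet> x) * (\<Sum>\<alpha>\<in>Rp. k \<alpha> * (f x - f (reflection \<alpha> x)))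
       + (\<Sum>\<alpha>\<in>Rp. (k \<alpha> * (\<alpha> \<bullet> x) * (a \<bullet> \<alpha>)) * f (reflection \<alpha> x))"
    unfolding sum_distrib_left sum.distrib[symmetric]
    by (intro sum.cong refl) (simp add: reflection_def inner_simps algebra_simps)
  then show ?case
    unfolding Tdir_inner_mult[OF hpoly_pf[OF hpoly_inner(2)]] hpoly_inner(3)
    by (simp add: algebra_simps)
next
  case (hpoly_add n B f C g)
  have "(\<Sum>\<alpha>\<in>Rp. k \<alpha> * (f x + g x - (f (reflection \<alpha> x) + g (reflection \<alpha> x))))
     = (\<Sum>\<alpha>\<in>Rp. k \<alpha> * (f x - f (reflection \<alpha> x))) + (\<Sum>\<alpha>\<in>Rp. k \<alpha> * (g x - g (reflection \<alpha> x)))"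
    unfolding sum.distrib[symmetric] by (intro sum.cong refl) (simp add: algebra_simps)
  then show ?case using hpoly_add by (simp add: Tdir_add hpoly_pf algebra_simps)
next
  case (hpoly_cmult n B f c)
  have "(\<Sum>\<alpha>\<in>Rp. k \<alpha> * (c * f x - c * f (reflection \<alpha> x))) = c * (\<Sum>\<alpha>\<in>Rp. k \<alpha> * (f x - f (reflection \<alpha> x)))"
    unfolding sum_distrib_left by (intro sum.cong refl) (simp add: algebra_simps)
  then show ?case using hpoly_cmult by (simp add: Tdir_cmult hpoly_pf algebra_simps)
qed (auto simp: Tdir_const)

text \<open>Maximum principle: at a point of the sphere where \<open>\<bar>f\<bar>\<close> is maximal, the difference part of
  the Euler identity has the sign of \<open>f\<close> because \<open>k \<ge> 0\<close>.\<close>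

lemma hpoly_max_principle:
  assumes f: "hpoly n B f" and n: "n > 0" and C: "\<And>x. norm x = 1 \<Longrightarrow> \<bar>Tdir x f x\<bar> \<le> real n * C"
  shows "\<bar>f x\<bar> \<le> C * norm x ^ n"
proof -
  have cont: "continuous_on (sphere 0 1) (\<lambda>x. \<bar>f x\<bar>)"
    by (intro continuous_intros continuous_on_subset[OF pf_continuous[OF hpoly_pf[OF f]]]) simp
  have "sphere (0::real^'n) 1 \<noteq> {}"
    by simp
  then obtain x0 where x0: "norm x0 = 1" and max: "\<And>y. norm y = 1 \<Longrightarrow> \<bar>f y\<bar> \<le> \<bar>f x0\<bar>"
    using continuous_attains_sup[OF compact_sphere _ cont] by auto
  have "real n * \<bar>f x0\<bar> \<le> sgn (f x0) * Tdir x0 f x0"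
  proof -
    have "0 \<le> sgn (f x0) * (f x0 - f (reflection \<alpha> x0))" if "\<alpha> \<in> Rp" for \<alpha>
    proof -
      have "norm (reflection \<alpha> x0) = 1" using x0 that by (simp add: norm_reflection root_norm Rp_root)
      then have "\<bar>f (reflection \<alpha> x0)\<bar> \<le> \<bar>f x0\<bar>" by (rule max)
      then show ?thesis by (auto simp: sgn_real_def)
    qed
    then have "0 \<le> (\<Sum>\<alpha>\<in>Rp. k \<alpha> * (sgn (f x0) * (f x0 - f (reflection \<alpha> x0))))"
      by (intro sum_nonneg, intro mult_nonneg_nonneg[of "k _"]) (auto simp: k_nonneg Rp_root)
    also have "\<dots> = sgn (f x0) * (\<Sum>\<alpha>\<in>Rp. k \<alpha> * (f x0 - f (reflection \<alpha> x0)))"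
      by (simp add: sum_distrib_left mult.left_commute)
    finally show ?thesis
      unfolding Tdir_self_hpoly[OF f] by (simp add: distrib_left abs_sgn mult_ac)
  qed
  also have "\<dots> \<le> \<bar>Tdir x0 f x0\<bar>" by (auto simp: sgn_real_def)
  also have "\<dots> \<le> real n * C" by (rule C[OF x0])
  finally have C0: "\<bar>f x0\<bar> \<le> C" using n by simp
  show ?thesis
  proof (cases "x = 0")
    case True
    then show ?thesis using hpoly_bound[OF f, of 0] n by (simp add: power_0_left)
  next
    case False
    define y where "y = (1 / norm x) *\<^sub>R x"
    have "norm y = 1" "x = norm x *\<^sub>R y" using False by (auto simp: y_def)
    then have "\<bar>f x\<bar> = norm x ^ n * \<bar>f y\<bar>" by (metis abs_mult abs_norm_cancel hpoly_scaleR[OF f] power_abs)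
    also have "\<dots> \<le> norm x ^ n * C"
      using max[OF \<open>norm y = 1\<close>] C0 by (intro mult_left_mono) auto
    finally show ?thesis by (simp add: mult.commute)
  qed
qed

text \<open>The maximum principle with bound 0. It is the uniqueness principle behind the kernel
  identities: homogeneous polynomials of the same positive degree agree once all Dunkl operators
  agree on them.\<close>

lemma hpoly_eq_0:
  assumes "hpoly n B f" "n > 0" "\<And>i x. T i f x = 0"
  shows "f x = 0"
  using hpoly_max_principle[of n B f 0 x] assms by (simp add: Tdir_def)

lemma hpoly_0_const: "hpoly n B f \<Longrightarrow> n = 0 \<Longrightarrow> f = (\<lambda>x. f 0)"
proof
  fix x assume "hpoly n B f" "n = 0"
  then show "f x = f 0" using hpoly_scaleR[of n B f 0 x] by simp
qed

text \<open>The cost of one linear factor: 1 for differentiating \<open>a \<bullet> x\<close>, and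
  \<open>2 k \<alpha>\<close> for each reflection term, since a root has norm \<open>sqrt 2\<close>
  and enters the coefficient twice.\<close>

definition T_growth :: real where
  "T_growth = 1 + 2 * (\<Sum>\<alpha>\<in>Rp. k \<alpha>)"

lemma T_growth_ge_1: "T_growth \<ge> 1"
  unfolding T_growth_def by (auto intro!: sum_nonneg k_nonneg Rp_root)

lemma T_hpoly_0: "hpoly 0 B f \<Longrightarrow> T i f = (\<lambda>x. 0)"
  by (subst hpoly_0_const) (auto simp: T_const)

text \<open>By the product rule each of the \<open>n\<close> linear factors contributes at most
  \<open>T_growth\<close>. Reflected polynomials stay in the class with the same bound because
  reflections preserve \<open>norm a \<le> 1\<close>.\<close>

lemma T_hpoly: "hpoly n B f \<Longrightarrow> n > 0 \<Longrightarrow> hpoly (n - 1) (T_growth * real n * B) (T i f)"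
proof (induction rule: hpoly.induct)
  case (hpoly_inner a n B f)
  have B: "B \<ge> 0" using hpoly_inner hpoly_nonneg by blast
  have 1: "hpoly n (T_growth * real n * B) (\<lambda>x. (a \<bullet> x) * T i f x)"
  \<comment> \<open>The induction hypothesis covers positive degree only; in degree 0 the Dunkl
    operator gives 0.\<close>
  proof (cases n)
    case 0
    then show ?thesis using T_hpoly_0[of B f i] hpoly_inner hpoly_zero[of 0] by simp
  next
    case (Suc m)
    then show ?thesis using hpoly.hpoly_inner[OF hpoly_inner(1) hpoly_inner(3)] by simp
  qed
  have "\<bar>a $ i\<bar> \<le> 1" using component_le_norm_cart[of a i] hpoly_inner(1) by simp
  then have 2: "hpoly n (1 * B) (\<lambda>x. a $ i * f x)"
    using B by (intro hpoly_weaken[OF hpoly.hpoly_cmult[OF hpoly_inner(2)]] mult_right_mono) auto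
  have 3: "hpoly n (\<Sum>\<alpha>\<in>Rp. (2 * k \<alpha>) * B)
      (\<lambda>x. \<Sum>\<alpha>\<in>Rp. (k \<alpha> * \<alpha> $ i * (a \<bullet> \<alpha>)) * f (reflection \<alpha> x))"
  proof (intro hpoly_sum finite_Rp)
    fix \<alpha> assume \<alpha>: "\<alpha> \<in> Rp"
    then have na: "norm \<alpha> = sqrt 2" by (simp add: norm_eq_sqrt_inner root_norm Rp_root)
    have "\<bar>\<alpha> $ i\<bar> \<le> sqrt 2" using component_le_norm_cart[of \<alpha> i] na by simp
    moreover have "\<bar>a \<bullet> \<alpha>\<bar> \<le> sqrt 2"
      using Cauchy_Schwarz_ineq2[of a \<alpha>] mult_right_mono[OF hpoly_inner(1) norm_ge_zero[of \<alpha>]]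
      unfolding na by linarith
    ultimately have "\<bar>\<alpha> $ i\<bar> * \<bar>a \<bullet> \<alpha>\<bar> \<le> sqrt 2 * sqrt 2" by (intro mult_mono) auto
    then have "k \<alpha> * (\<bar>\<alpha> $ i\<bar> * \<bar>a \<bullet> \<alpha>\<bar>) \<le> k \<alpha> * 2"
      using \<alpha> by (intro mult_left_mono) (auto simp: k_nonneg Rp_root)
    then have le: "\<bar>k \<alpha> * \<alpha> $ i * (a \<bullet> \<alpha>)\<bar> \<le> 2 * k \<alpha>"
      using \<alpha> by (simp add: abs_mult k_nonneg Rp_root mult_ac)
    show "hpoly n (2 * k \<alpha> * B) (\<lambda>x. (k \<alpha> * \<alpha> $ i * (a \<bullet> \<alpha>)) * f (reflection \<alpha> x))"
      by (rule hpoly_weaken[OF hpoly.hpoly_cmult[OF hpoly_reflection[OF _ hpoly_inner(2)]]])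
         (use le B \<alpha> in \<open>auto intro!: mult_right_mono simp: root_norm Rp_root\<close>)
  qed
  have "hpoly n (T_growth * real n * B + 1 * B + (\<Sum>\<alpha>\<in>Rp. (2 * k \<alpha>) * B)) (T i (\<lambda>x. (a \<bullet> x) * f x))"
    unfolding T_inner_mult[OF hpoly_pf[OF hpoly_inner(2)]] by (intro hpoly_add 1 2 3)
  moreover have "T_growth * real n * B + 1 * B + (\<Sum>\<alpha>\<in>Rp. (2 * k \<alpha>) * B)
      = T_growth * real (Suc n) * B"
    unfolding T_growth_def sum_distrib_right[symmetric] sum_distrib_left[symmetric]
    by (simp add: algebra_simps)
  ultimately show ?case by simp
next
  case (hpoly_add n B f C g)
  then show ?case using hpoly.hpoly_add[of "n - 1" _ "T i f" _ "T i g"]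
    by (simp add: T_add hpoly_pf distrib_left)
next
  case (hpoly_cmult n B f c)
  then show ?case using hpoly.hpoly_cmult[of "n - 1" "T_growth * real n * B" "T i f" c]
    by (simp add: T_cmult hpoly_pf mult_ac)
next
  case (hpoly_weaken n B f C)
  then show ?case
    using T_growth_ge_1 by (intro hpoly.hpoly_weaken[OF hpoly_weaken(3)] mult_left_mono) auto
qed auto

section \<open>The Dunkl Laplacian and its commutator with a linear form\<close>

definition lap :: "(real^'n \<Rightarrow> real) \<Rightarrow> real^'n \<Rightarrow> real" where
  "lap f x = (\<Sum>i\<in>UNIV. T i (T i f) x)"

lemma pf_lap: "pf f \<Longrightarrow> pf (lap f)"
  unfolding lap_def[abs_def] by (intro pf_sum pf_T) auto

lemma lap_add: "pf f \<Longrightarrow> pf g \<Longrightarrow> lap (\<lambda>x. f x + g x) = (\<lambda>x. lap f x + lap g x)"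
  by (auto simp: lap_def T_add pf_T sum.distrib)

lemma lap_cmult: "pf f \<Longrightarrow> lap (\<lambda>x. c * f x) = (\<lambda>x. c * lap f x)"
  by (auto simp: lap_def T_cmult pf_T sum_distrib_left)

lemma lap_zero: "lap (\<lambda>x. 0) = (\<lambda>x. 0)"
  by (auto simp: lap_def T_const)

lemma lap_sum:
  assumes "finite I" "\<And>j. j \<in> I \<Longrightarrow> pf (f j)"
  shows "lap (\<lambda>x. \<Sum>j\<in>I. f j x) = (\<lambda>x. \<Sum>j\<in>I. lap (f j) x)"
  using assms
proof (induction I rule: finite_induct)
  case (insert a I)
  then show ?case by (simp add: lap_add pf_sum)
qed (simp add: lap_zero)

text \<open>The reflection terms cancel in pairs since \<open>T\<^sub>\<alpha> (f \<circ> \<sigma>\<^sub>\<alpha>) = - (T\<^sub>\<alpha> f) \<circ> \<sigma>\<^sub>\<alpha>\<close>.\<close>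

lemma lap_inner_mult:
  assumes "hpoly n B f"
  shows "lap (\<lambda>x. (a \<bullet> x) * f x) = (\<lambda>x. (a \<bullet> x) * lap f x + 2 * Tdir a f x)"
proof
  fix x
  have pf: "pf f" using assms hpoly_pf by blast
  have pfs: "pf (\<lambda>x. \<Sum>\<alpha>\<in>Rp. (k \<alpha> * \<alpha> $ j * (a \<bullet> \<alpha>)) * f (reflection \<alpha> x))" for j
    by (intro pf_sum pf_cmult pf_compose_reflection[OF pf] finite_Rp)
  have pf2: "pf (\<lambda>x. (a \<bullet> x) * T j f x)" "pf (\<lambda>x. a $ j * f x)" for j
    by (intro pf_mult pf_inner pf_cmult pf_T pf)+
  have "T j (T j (\<lambda>x. (a \<bullet> x) * f x)) x =
      (a \<bullet> x) * T j (T j f) x + 2 * (a $ j * T j f x)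
      + ((\<Sum>\<alpha>\<in>Rp. (k \<alpha> * \<alpha> $ j * (a \<bullet> \<alpha>)) * T j f (reflection \<alpha> x))
      + (\<Sum>\<alpha>\<in>Rp. (k \<alpha> * \<alpha> $ j * (a \<bullet> \<alpha>)) * T j (\<lambda>x. f (reflection \<alpha> x)) x))" for j
  proof -
    have "T j (T j (\<lambda>x. (a \<bullet> x) * f x)) x =
       T j (\<lambda>x. (a \<bullet> x) * T j f x) x + T j (\<lambda>x. a $ j * f x) x
       + T j (\<lambda>x. \<Sum>\<alpha>\<in>Rp. (k \<alpha> * \<alpha> $ j * (a \<bullet> \<alpha>)) * f (reflection \<alpha> x)) x"
      unfolding T_inner_mult[OF pf]
      by (simp add: T_add pfs pf2 pf_add)
    also have "T j (\<lambda>x. \<Sum>\<alpha>\<in>Rp. (k \<alpha> * \<alpha> $ j * (a \<bullet> \<alpha>)) * f (reflection \<alpha> x)) x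
      = (\<Sum>\<alpha>\<in>Rp. (k \<alpha> * \<alpha> $ j * (a \<bullet> \<alpha>)) * T j (\<lambda>x. f (reflection \<alpha> x)) x)"
      by (subst T_sum) (auto intro!: finite_Rp pf_cmult pf_compose_reflection[OF pf] simp: T_cmult[OF pf_compose_reflection[OF pf]])
    finally show ?thesis
      by (simp add: T_inner_mult pf_T pf T_cmult)
  qed
  then have "lap (\<lambda>x. (a \<bullet> x) * f x) x = (a \<bullet> x) * lap f x + 2 * Tdir a f x
      + ((\<Sum>j\<in>UNIV. \<Sum>\<alpha>\<in>Rp. (k \<alpha> * \<alpha> $ j * (a \<bullet> \<alpha>)) * T j f (reflection \<alpha> x))
      + (\<Sum>j\<in>UNIV. \<Sum>\<alpha>\<in>Rp. (k \<alpha> * \<alpha> $ j * (a \<bullet> \<alpha>)) * T j (\<lambda>x. f (reflection \<alpha> x)) x))"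
    by (simp add: lap_def Tdir_def sum.distrib sum_distrib_left)
  also have "(\<Sum>j\<in>UNIV. \<Sum>\<alpha>\<in>Rp. (k \<alpha> * \<alpha> $ j * (a \<bullet> \<alpha>)) * T j f (reflection \<alpha> x))
      = (\<Sum>\<alpha>\<in>Rp. k \<alpha> * (a \<bullet> \<alpha>) * Tdir \<alpha> f (reflection \<alpha> x))"
    unfolding Tdir_def sum_distrib_left by (subst sum.swap) (intro sum.cong refl, simp add: mult_ac)
  also have "(\<Sum>j\<in>UNIV. \<Sum>\<alpha>\<in>Rp. (k \<alpha> * \<alpha> $ j * (a \<bullet> \<alpha>)) * T j (\<lambda>x. f (reflection \<alpha> x)) x)
      = (\<Sum>\<alpha>\<in>Rp. k \<alpha> * (a \<bullet> \<alpha>) * Tdir \<alpha> (\<lambda>x. f (reflection \<alpha> x)) x)"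
    unfolding Tdir_def sum_distrib_left by (subst sum.swap) (intro sum.cong refl, simp add: mult_ac)
  also have "\<dots> = (\<Sum>\<alpha>\<in>Rp. - (k \<alpha> * (a \<bullet> \<alpha>) * Tdir \<alpha> f (reflection \<alpha> x)))"
  proof (intro sum.cong refl)
    fix \<alpha> assume \<alpha>: "\<alpha> \<in> Rp"
    have "Tdir \<alpha> (\<lambda>x. f (reflection \<alpha> x)) x = Tdir (- \<alpha>) f (reflection \<alpha> x)"
      using Tdir_reflection[OF Rp_root[OF \<alpha>] assms, of \<alpha>] \<alpha> by (simp add: reflection_self root_norm Rp_root)
    then show "k \<alpha> * (a \<bullet> \<alpha>) * Tdir \<alpha> (\<lambda>x. f (reflection \<alpha> x)) x
        = - (k \<alpha> * (a \<bullet> \<alpha>) * Tdir \<alpha> f (reflection \<alpha> x))"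
      by (simp add: Tdir_def sum_negf)
  qed
  finally show "lap (\<lambda>x. (a \<bullet> x) * f x) x = (a \<bullet> x) * lap f x + 2 * Tdir a f x"
    by (simp add: sum_negf)
qed

end

section \<open>Integration against Gaussian densities\<close>

abbreviation gauss :: "real \<Rightarrow> 'a::real_normed_vector \<Rightarrow> real" where
  "gauss b x \<equiv> exp (- b * (norm x)\<^sup>2)"

lemma integrable_exp_square: "b > 0 \<Longrightarrow> integrable lborel (\<lambda>x::real. exp (- b * x\<^sup>2))"
proof -
  assume b: "b > 0"
  \<comment> \<open>The deviation with \<open>2 \<sigma>^2 = 1 / b\<close>, for which the normal
    density is a multiple of the integrand.\<close>
  define \<sigma> where "\<sigma> = 1 / sqrt (2 * b)"
  have "\<sigma> > 0" using b by (simp add: \<sigma>_def)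
  then have "integrable lborel (\<lambda>x. sqrt (2 * pi * \<sigma>\<^sup>2) * normal_density 0 \<sigma> x)"
    by (intro integrable_mult_right) simp
  moreover have "(\<lambda>x. sqrt (2 * pi * \<sigma>\<^sup>2) * normal_density 0 \<sigma> x) = (\<lambda>x. exp (- b * x\<^sup>2))"
    using b by (auto simp: normal_density_def \<sigma>_def power_divide real_sqrt_divide fun_eq_iff)
  ultimately show ?thesis by simp
qed

lemma integrable_gauss:
  assumes "b > 0"
  shows "integrable lborel (\<lambda>x::'a::euclidean_space. gauss b x)"
proof -
  interpret product_sigma_finite "\<lambda>_::'a. lborel :: real measure" ..
  have "integrable (\<Pi>\<^sub>M i\<in>(Basis::'a set). lborel) (\<lambda>x. \<Prod>i\<in>Basis. exp (- b * (x i)\<^sup>2))"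
    by (intro product_integrable_prod integrable_exp_square assms) auto
  moreover have "(\<Prod>i\<in>Basis. exp (- b * (x i)\<^sup>2)) = exp (- b * (norm (\<Sum>i\<in>(Basis::'a set). x i *\<^sub>R i))\<^sup>2)" for x :: "'a \<Rightarrow> real"
  proof -
    have "(norm (\<Sum>i\<in>(Basis::'a set). x i *\<^sub>R i))\<^sup>2 = (\<Sum>i\<in>Basis. (x i)\<^sup>2)"
      by (subst power2_norm_eq_inner, subst euclidean_inner) (simp add: power2_eq_square)
    then show ?thesis by (simp add: sum_distrib_left exp_sum[symmetric])
  qed
  ultimately show ?thesis
    by (subst lborel_eq, subst integrable_distr_eq) auto
qed

section \<open>Invariance of Lebesgue measure under translations and reflections\<close>

lemma nn_integral_lborel_plus:
  fixes f :: "'a::euclidean_space \<Rightarrow> ennreal"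
  assumes [measurable]: "f \<in> borel_measurable borel"
  shows "(\<integral>\<^sup>+x. f (x + c) \<partial>lborel) = (\<integral>\<^sup>+x. f x \<partial>lborel)"
proof -
  have "(\<integral>\<^sup>+x. f x \<partial>lborel) = (\<integral>\<^sup>+x. f x \<partial>distr lborel borel ((+) c))"
    by (simp add: lborel_distr_plus)
  also have "\<dots> = (\<integral>\<^sup>+x. f (x + c) \<partial>lborel)"
    by (subst nn_integral_distr) (auto simp: add.commute)
  finally show ?thesis by simp
qed

lemma nn_integral_lborel_diff:
  fixes f :: "'a::euclidean_space \<Rightarrow> ennreal"
  assumes [measurable]: "f \<in> borel_measurable borel"
  shows "(\<integral>\<^sup>+x. f (c - x) \<partial>lborel) = (\<integral>\<^sup>+x. f x \<partial>lborel)"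
proof -
  have "(lborel :: 'a measure) = distr lborel borel (\<lambda>x. c - x)"
    by (subst lborel_affine[of "-1" c]) (auto simp: density_1)
  then have "(\<integral>\<^sup>+x. f x \<partial>lborel) = (\<integral>\<^sup>+x. f x \<partial>distr lborel borel (\<lambda>x. c - x))"
    by simp
  also have "\<dots> = (\<integral>\<^sup>+x. f (c - x) \<partial>lborel)"
    by (subst nn_integral_distr) auto
  finally show ?thesis by simp
qed

text \<open>Haar uniqueness: Fubini and translation invariance give
  \<open>\<lambda>(f) \<lambda>(g \<circ> \<sigma>) = \<lambda>(g) \<lambda>(f \<circ> \<sigma>)\<close>, and the indicator \<open>g\<close> of the unit ball is invariant.\<close>

lemma nn_integral_reflection:
  fixes f :: "real^'n::finite \<Rightarrow> ennreal"
  assumes [measurable]: "f \<in> borel_measurable borel" and \<alpha>: "\<alpha> \<bullet> \<alpha> = 2"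
  shows "(\<integral>\<^sup>+x. f (reflection \<alpha> x) \<partial>lborel) = (\<integral>\<^sup>+x. f x \<partial>lborel)"
proof -
  let ?s = "reflection \<alpha>"
  have [measurable]: "?s \<in> borel_measurable borel"
    by (intro borel_measurable_continuous_onI linear_continuous_on bounded_linear_reflection)
  define g :: "real^'n \<Rightarrow> ennreal" where "g = indicator (ball 0 1)"
  have [measurable]: "g \<in> borel_measurable borel" unfolding g_def by (rule borel_measurable_indicator) simp
  have g_inv: "g (?s x) = g x" for x
    using \<alpha> by (auto simp: g_def norm_reflection split: split_indicator)
  have g_pos: "(\<integral>\<^sup>+x. g x \<partial>lborel) = emeasure lborel (ball (0::real^'n) 1)"
    unfolding g_def by simp
  have "(\<integral>\<^sup>+x. f x \<partial>lborel) * (\<integral>\<^sup>+x. g x \<partial>lborel) = (\<integral>\<^sup>+y. (\<integral>\<^sup>+x. f x * g (?s y) \<partial>lborel) \<partial>lborel)"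
    by (simp add: nn_integral_multc nn_integral_cmult g_inv)
  also have "\<dots> = (\<integral>\<^sup>+y. (\<integral>\<^sup>+x. f (x + ?s y) * g (?s y) \<partial>lborel) \<partial>lborel)"
    by (simp add: nn_integral_multc nn_integral_lborel_plus)
  also have "\<dots> = (\<integral>\<^sup>+x. (\<integral>\<^sup>+y. f (x + ?s y) * g (?s y) \<partial>lborel) \<partial>lborel)"
    by (rule lborel_pair.Fubini') measurable
  also have "\<dots> = (\<integral>\<^sup>+x. (\<integral>\<^sup>+y. f (?s y) * g (?s y - x) \<partial>lborel) \<partial>lborel)"
  proof (rule nn_integral_cong)
    fix x :: "real^'n"
    \<comment> \<open>The translation is by \<open>?s x\<close> because the linear involution
      \<open>?s\<close> carries it to \<open>x\<close>, which then cancels in the argument of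
      \<open>g\<close>.\<close>
    have "(\<integral>\<^sup>+y. f (?s y) * g (?s y - x) \<partial>lborel) = (\<integral>\<^sup>+y. f (?s (y + ?s x)) * g (?s (y + ?s x) - x) \<partial>lborel)"
      by (rule nn_integral_lborel_plus[symmetric]) measurable
    also have "\<dots> = (\<integral>\<^sup>+y. f (x + ?s y) * g (?s y) \<partial>lborel)"
      using \<alpha> by (simp add: linear_add[OF linear_reflection] reflection_reflection add.commute)
    finally show "(\<integral>\<^sup>+y. f (x + ?s y) * g (?s y) \<partial>lborel) = (\<integral>\<^sup>+y. f (?s y) * g (?s y - x) \<partial>lborel)" ..
  qed
  also have "\<dots> = (\<integral>\<^sup>+y. (\<integral>\<^sup>+x. f (?s y) * g (?s y - x) \<partial>lborel) \<partial>lborel)"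
    by (rule lborel_pair.Fubini'[symmetric]) measurable
  also have "\<dots> = (\<integral>\<^sup>+x. f (?s x) \<partial>lborel) * (\<integral>\<^sup>+x. g x \<partial>lborel)"
    by (simp add: nn_integral_cmult nn_integral_lborel_diff nn_integral_multc)
  finally have "(\<integral>\<^sup>+x. f x \<partial>lborel) * emeasure lborel (ball (0::real^'n) 1)
      = (\<integral>\<^sup>+x. f (?s x) \<partial>lborel) * emeasure lborel (ball (0::real^'n) 1)"
    unfolding g_pos .
  moreover have "emeasure lborel (ball (0::real^'n) 1) \<noteq> 0" "emeasure lborel (ball (0::real^'n) 1) \<noteq> \<infinity>"
    using emeasure_lborel_ball_finite[of "0::real^'n" 1] content_ball_pos[of 1 "0::real^'n"]
    by (auto simp: measure_def)
  ultimately show ?thesis by (auto simp: ennreal_mult_cancel_left mult.commute[of _ "emeasure _ _"])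
qed

lemma lborel_reflection:
  fixes \<alpha> :: "real^'n::finite"
  assumes \<alpha>: "\<alpha> \<bullet> \<alpha> = 2"
  shows "distr lborel borel (reflection \<alpha>) = lborel"
proof (rule measure_eqI)
  have [measurable]: "reflection \<alpha> \<in> borel_measurable borel"
    by (intro borel_measurable_continuous_onI linear_continuous_on bounded_linear_reflection)
  fix A assume "A \<in> sets (distr lborel borel (reflection \<alpha>))"
  then have [measurable]: "A \<in> sets borel" by simp
  have "emeasure (distr lborel borel (reflection \<alpha>)) A = (\<integral>\<^sup>+x. indicator A x \<partial>distr lborel borel (reflection \<alpha>))"
    by simp
  also have "\<dots> = (\<integral>\<^sup>+x. indicator A (reflection \<alpha> x) \<partial>lborel)"
    by (subst nn_integral_distr) auto
  also have "\<dots> = (\<integral>\<^sup>+x. indicator A x \<partial>lborel)"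
    by (rule nn_integral_reflection[OF _ \<alpha>]) measurable
  finally show "emeasure (distr lborel borel (reflection \<alpha>)) A = emeasure lborel A" by simp
qed simp

lemma integral_reflection:
  fixes f :: "real^'n::finite \<Rightarrow> real"
  assumes [measurable]: "f \<in> borel_measurable borel" and \<alpha>: "\<alpha> \<bullet> \<alpha> = 2"
  shows "(LINT x|lborel. f (reflection \<alpha> x)) = (LINT x|lborel. f x)"
proof -
  have [measurable]: "reflection \<alpha> \<in> borel_measurable borel"
    by (intro borel_measurable_continuous_onI linear_continuous_on bounded_linear_reflection)
  have "(LINT x|lborel. f x) = (LINT x|distr lborel borel (reflection \<alpha>). f x)"
    by (simp add: lborel_reflection \<alpha>)
  also have "\<dots> = (LINT x|lborel. f (reflection \<alpha> x))"
    by (rule integral_distr) auto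
  finally show ?thesis by simp
qed

lemma integral_lborel_plus:
  fixes f :: "'a::euclidean_space \<Rightarrow> real"
  assumes [measurable]: "f \<in> borel_measurable borel"
  shows "(LINT x|lborel. f (x + c)) = (LINT x|lborel. f x)"
    and "integrable lborel f \<Longrightarrow> integrable lborel (\<lambda>x. f (x + c))"
proof -
  have "(LINT x|lborel. f x) = (LINT x|distr lborel borel ((+) c). f x)"
    by (simp add: lborel_distr_plus)
  also have "\<dots> = (LINT x|lborel. f (x + c))"
    by (subst integral_distr) (auto simp: add.commute)
  finally show "(LINT x|lborel. f (x + c)) = (LINT x|lborel. f x)" by simp
  assume "integrable lborel f"
  then have "integrable (distr lborel borel ((+) c)) f" by (simp add: lborel_distr_plus)
  then show "integrable lborel (\<lambda>x. f (x + c))"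
    by (subst (asm) integrable_distr_eq) (auto simp: add.commute)
qed

text \<open>A class closed under sums and products that contains the polynomials, the weight and its
  regularisations, and whose members are integrable against every Gaussian.\<close>

definition exp_growth :: "('a::euclidean_space \<Rightarrow> real) \<Rightarrow> bool" where
  "exp_growth f \<longleftrightarrow> f \<in> borel_measurable borel \<and> (\<exists>C c. \<forall>x. \<bar>f x\<bar> \<le> C * exp (c * norm x))"

lemma exp_growthI:
  "f \<in> borel_measurable borel \<Longrightarrow> (\<And>x. \<bar>f x\<bar> \<le> C * exp (c * norm x)) \<Longrightarrow> exp_growth f"
  unfolding exp_growth_def by blast

lemma exp_growth_nonneg:
  fixes f :: "'a::euclidean_space \<Rightarrow> real"
  assumes "exp_growth f"
  shows "\<exists>C c. f \<in> borel_measurable borel \<and> C \<ge> 0 \<and> c \<ge> 0 \<and> (\<forall>x. \<bar>f x\<bar> \<le> C * exp (c * norm x))"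
proof -
  obtain C c where *: "f \<in> borel_measurable borel" "\<And>x. \<bar>f x\<bar> \<le> C * exp (c * norm x)"
    using assms unfolding exp_growth_def by blast
  show ?thesis
  proof (rule exI[of _ "\<bar>C\<bar>"], rule exI[of _ "\<bar>c\<bar>"], intro conjI allI)
    fix x :: 'a
    have "C * exp (c * norm x) \<le> \<bar>C\<bar> * exp (\<bar>c\<bar> * norm x)"
      by (intro mult_mono) (auto intro!: mult_right_mono)
    then show "\<bar>f x\<bar> \<le> \<bar>C\<bar> * exp (\<bar>c\<bar> * norm x)" using *(2)[of x] by linarith
  qed (use * in auto)
qed

lemma exp_growth_measurable: "exp_growth f \<Longrightarrow> f \<in> borel_measurable borel"
  unfolding exp_growth_def by blast

lemma exp_growth_mult:
  fixes f g :: "'a::euclidean_space \<Rightarrow> real"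
  assumes "exp_growth f" "exp_growth g"
  shows "exp_growth (\<lambda>x. f x * g x)"
proof -
  obtain C c where f: "f \<in> borel_measurable borel" "C \<ge> 0" "\<And>x. \<bar>f x\<bar> \<le> C * exp (c * norm x)"
    using exp_growth_nonneg[OF assms(1)] by blast
  obtain D d where g: "g \<in> borel_measurable borel" "D \<ge> 0" "\<And>x. \<bar>g x\<bar> \<le> D * exp (d * norm x)"
    using exp_growth_nonneg[OF assms(2)] by blast
  show ?thesis
  proof (rule exp_growthI)
    fix x :: 'a
    have "\<bar>f x * g x\<bar> \<le> (C * exp (c * norm x)) * (D * exp (d * norm x))"
      unfolding abs_mult using f g by (intro mult_mono) auto
    also have "\<dots> = (C * D) * exp ((c + d) * norm x)"
      by (simp add: distrib_right exp_add)
    finally show "\<bar>f x * g x\<bar> \<le> (C * D) * exp ((c + d) * norm x)" .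
  qed (use f(1) g(1) in measurable)
qed

lemma exp_growth_add:
  fixes f g :: "'a::euclidean_space \<Rightarrow> real"
  assumes "exp_growth f" "exp_growth g"
  shows "exp_growth (\<lambda>x. f x + g x)"
proof -
  obtain C c where f: "f \<in> borel_measurable borel" "C \<ge> 0" "c \<ge> 0" "\<And>x. \<bar>f x\<bar> \<le> C * exp (c * norm x)"
    using exp_growth_nonneg[OF assms(1)] by blast
  obtain D d where g: "g \<in> borel_measurable borel" "D \<ge> 0" "d \<ge> 0" "\<And>x. \<bar>g x\<bar> \<le> D * exp (d * norm x)"
    using exp_growth_nonneg[OF assms(2)] by blast
  show ?thesis
  proof (rule exp_growthI)
    fix x :: 'a
    have "C * exp (c * norm x) \<le> C * exp ((c + d) * norm x)" "D * exp (d * norm x) \<le> D * exp ((c + d) * norm x)"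
      using f g by (auto intro!: mult_left_mono mult_right_mono)
    then show "\<bar>f x + g x\<bar> \<le> (C + D) * exp ((c + d) * norm x)"
      using f(4)[of x] g(4)[of x] unfolding distrib_right[of C D] by linarith
  qed (use f(1) g(1) in measurable)
qed

lemma exp_growth_bounded:
  assumes "f \<in> borel_measurable borel" "\<And>x. \<bar>f x\<bar> \<le> C"
  shows "exp_growth f"
  using assms by (intro exp_growthI[of _ C 0]) auto

lemma exp_growth_const: "exp_growth (\<lambda>x. c)"
  by (rule exp_growth_bounded[of _ "\<bar>c\<bar>"]) auto

lemma exp_growth_pf:
  fixes f :: "'a::euclidean_space \<Rightarrow> real"
  shows "pf f \<Longrightarrow> exp_growth f"
proof (induction rule: real_polynomial_function.induct)
  case (linear f)
  then obtain K where K: "\<And>x. norm (f x) \<le> norm x * K" "K > 0" using bounded_linear.pos_bounded by blast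
  show ?case
  proof (rule exp_growthI[of _ K 1])
    fix x :: 'a
    have "norm x \<le> exp (norm x)" using exp_ge_add_one_self[of "norm x"] by linarith
    then have "norm x * K \<le> exp (norm x) * K" using K by (intro mult_right_mono) auto
    then show "\<bar>f x\<bar> \<le> K * exp (1 * norm x)" using K(1)[of x] by (simp add: mult.commute)
  qed (use linear linear_continuous_on borel_measurable_continuous_onI in blast)
qed (auto intro: exp_growth_const exp_growth_add exp_growth_mult)

text \<open>Completing the square: half of the Gaussian decay is given up to absorb the exponential
  growth.\<close>

lemma exp_gauss_bound:
  fixes b c :: real
  assumes "b > 0"
  shows "exp (c * r) * exp (- b * r\<^sup>2) \<le> exp (c\<^sup>2 / (2 * b)) * exp (- (b / 2) * r\<^sup>2)"
proof -
  have "0 \<le> (b * r - c)\<^sup>2 / (2 * b)" using assms by simp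
  also have "\<dots> = c\<^sup>2 / (2 * b) + (b / 2) * r\<^sup>2 - c * r"
    using assms by (simp add: power2_eq_square field_simps)
  finally show ?thesis by (simp add: exp_add[symmetric])
qed

lemma integrable_exp_gauss:
  assumes "b > 0"
  shows "integrable lborel (\<lambda>x::'a::euclidean_space. exp (c * norm x) * gauss b x)"
proof (rule Bochner_Integration.integrable_bound)
  show "integrable lborel (\<lambda>x::'a. exp (c\<^sup>2 / (2 * b)) * exp (- (b / 2) * (norm x)\<^sup>2))"
    using assms by (intro integrable_mult_right integrable_gauss) auto
  show "AE x::'a in lborel. norm (exp (c * norm x) * gauss b x)
      \<le> norm (exp (c\<^sup>2 / (2 * b)) * exp (- (b / 2) * (norm x)\<^sup>2))"
    using exp_gauss_bound[OF assms, of c] by simp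
qed auto

lemma integrable_exp_growth:
  assumes "exp_growth f" "b > 0"
  shows "integrable lborel (\<lambda>x. f x * gauss b x)"
proof -
  obtain C c where f: "f \<in> borel_measurable borel" "C \<ge> 0" "\<And>x. \<bar>f x\<bar> \<le> C * exp (c * norm x)"
    using exp_growth_nonneg[OF assms(1)] by blast
  note [measurable] = f(1)
  show ?thesis
  proof (rule Bochner_Integration.integrable_bound)
    show "integrable lborel (\<lambda>x::'a. C * (exp (c * norm x) * gauss b x))"
      by (intro integrable_mult_right integrable_exp_gauss assms)
    show "AE x in lborel. norm (f x * gauss b x)
        \<le> norm (C * (exp (c * norm x) * gauss b x))"
    proof (rule AE_I2)
      fix x :: 'a
      have "\<bar>f x\<bar> * gauss b x \<le> (C * exp (c * norm x)) * gauss b x"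
        by (intro mult_right_mono f) auto
      then show "norm (f x * gauss b x) \<le> norm (C * (exp (c * norm x) * gauss b x))"
        using f(2) by (simp add: abs_mult mult.assoc)
    qed
  qed measurable
qed

text \<open>Obtained from translation invariance by differentiating under the integral sign.\<close>

lemma integral_partial_derivative_eq_0:
  fixes F F' :: "real^'n::finite \<Rightarrow> real"
  assumes F: "integrable lborel F" and b: "b > 0"
    and F': "exp_growth G" "\<And>x. F' x = G x * gauss b x"
    and deriv: "\<And>x. ((\<lambda>s. F (x + s *\<^sub>R axis i 1)) has_real_derivative F' x) (at 0)"
  shows "(LINT x|lborel. F' x) = 0"
proof -
  obtain C c where G: "G \<in> borel_measurable borel" "C \<ge> 0" "c \<ge> 0" "\<And>x. \<bar>G x\<bar> \<le> C * exp (c * norm x)"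
    using exp_growth_nonneg[OF F'(1)] by blast
  have [measurable]: "F \<in> borel_measurable borel" using F by auto
  have [measurable]: "F' \<in> borel_measurable borel" unfolding F'(2)[abs_def] using G(1) by measurable
  define e where "e = axis i (1::real)"
  have ne: "norm e = 1" by (simp add: e_def norm_axis_1)
  define h where "h n = 1 / real (Suc n)" for n
  have h: "h n > 0" "h n \<le> 1" for n by (auto simp: h_def)
  define u where "u n x = (F (x + h n *\<^sub>R e) - F x) / h n" for n x
  \<comment> \<open>Dominates all shifts by at most 1. The growth bound loses \<open>exp c\<close>,
    and \<open>|x|^2 / 2 - 1 \<le> |x + s e|^2\<close> costs \<open>exp b\<close> together with half
    of the decay.\<close>
  define w where "w x = (C * exp c * exp b) * (exp (c * norm x) * exp (- (b / 2) * (norm x)\<^sup>2))" for x :: "real^'n"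
  have F'_bound: "\<bar>F' (x + s *\<^sub>R e)\<bar> \<le> w x" if s: "0 \<le> s" "s \<le> 1" for x s
  proof -
    have nse: "norm (s *\<^sub>R e) \<le> 1" using s ne by simp
    have up: "norm (x + s *\<^sub>R e) \<le> norm x + 1" using norm_triangle_ineq[of x "s *\<^sub>R e"] nse by linarith
    have "norm x \<le> norm (x + s *\<^sub>R e) + 1" using norm_triangle_ineq4[of "x + s *\<^sub>R e" "s *\<^sub>R e"] nse by simp
    then have "(norm x)\<^sup>2 \<le> (norm (x + s *\<^sub>R e) + 1)\<^sup>2" by (intro power_mono) auto
    also have "\<dots> \<le> 2 * (norm (x + s *\<^sub>R e))\<^sup>2 + 2"
      using zero_le_power2[of "norm (x + s *\<^sub>R e) - 1"] by (simp add: power2_eq_square algebra_simps)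
    finally have "(norm x)\<^sup>2 / 2 - 1 \<le> (norm (x + s *\<^sub>R e))\<^sup>2" by simp
    then have "b * ((norm x)\<^sup>2 / 2 - 1) \<le> b * (norm (x + s *\<^sub>R e))\<^sup>2" using b by (intro mult_left_mono) auto
    then have "exp (- b * (norm (x + s *\<^sub>R e))\<^sup>2) \<le> exp b * exp (- (b / 2) * (norm x)\<^sup>2)"
      by (simp add: algebra_simps exp_add[symmetric])
    moreover have "exp (c * norm (x + s *\<^sub>R e)) \<le> exp (c * (norm x + 1))"
      using up G(3) by (simp add: mult_left_mono)
    ultimately have "C * exp (c * norm (x + s *\<^sub>R e)) * exp (- b * (norm (x + s *\<^sub>R e))\<^sup>2)
        \<le> C * exp (c * (norm x + 1)) * (exp b * exp (- (b / 2) * (norm x)\<^sup>2))"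
      using G(2) by (intro mult_mono mult_left_mono) auto
    also have "\<dots> = w x" by (simp add: w_def distrib_left exp_add mult_ac)
    finally have "C * exp (c * norm (x + s *\<^sub>R e)) * exp (- b * (norm (x + s *\<^sub>R e))\<^sup>2) \<le> w x" .
    moreover have "\<bar>F' (x + s *\<^sub>R e)\<bar> \<le> C * exp (c * norm (x + s *\<^sub>R e)) * exp (- b * (norm (x + s *\<^sub>R e))\<^sup>2)"
      unfolding F'(2) abs_mult using G(4)[of "x + s *\<^sub>R e"] by (simp add: mult_right_mono)
    ultimately show ?thesis by linarith
  qed
  have "(\<lambda>n. LINT x|lborel. u n x) \<longlonglongrightarrow> (LINT x|lborel. F' x)"
  proof (rule integral_dominated_convergence)
    show "integrable lborel w"
      unfolding w_def using b by (intro integrable_mult_right integrable_exp_gauss) auto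
    show "AE x in lborel. (\<lambda>n. u n x) \<longlonglongrightarrow> F' x"
    proof (rule AE_I2)
      fix x :: "real^'n"
      have *: "((\<lambda>s. (F (x + s *\<^sub>R e) - F x) / s) \<longlongrightarrow> F' x) (at 0)"
        using deriv[of x] by (simp add: DERIV_def e_def)
      have "filterlim h (at 0) sequentially"
        unfolding filterlim_at
      proof
        show "h \<longlonglongrightarrow> 0" unfolding h_def using LIMSEQ_inverse_real_of_nat by (simp add: inverse_eq_divide)
      qed (use h in \<open>auto simp: less_imp_neq[symmetric]\<close>)
      then show "(\<lambda>n. u n x) \<longlonglongrightarrow> F' x" unfolding u_def by (rule filterlim_compose[OF *])
    qed
    show "AE x in lborel. norm (u n x) \<le> w x" for n
    proof (rule AE_I2)
      fix x :: "real^'n"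
      \<comment> \<open>Each difference quotient is a value of \<open>F'\<close> at an intermediate
        point, hence subject to the uniform bound.\<close>
      have "\<exists>z>0. z < h n \<and> F (x + h n *\<^sub>R e) - F (x + 0 *\<^sub>R e) = (h n - 0) * F' (x + z *\<^sub>R e)"
        unfolding e_def by (rule MVT2) (use h has_partial_deriv_at[of F i F', OF deriv] in auto)
      then obtain z where z: "0 < z" "z < h n" "F (x + h n *\<^sub>R e) - F x = h n * F' (x + z *\<^sub>R e)"
        by auto
      have "u n x = F' (x + z *\<^sub>R e)" unfolding u_def z(3) using h(1)[of n] by simp
      then show "norm (u n x) \<le> w x" using F'_bound[of z x] z h(2)[of n] by simp
    qed
  qed (auto simp: u_def)
  moreover have "(LINT x|lborel. u n x) = 0" for n
    unfolding u_def by (simp add: integral_lborel_plus F)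
  ultimately show ?thesis by (simp add: tendsto_const_iff)
qed

section \<open>The intertwining operator and its moments\<close>

lemma homog_polyfun_imp_polyfun: "homog_polyfun n p \<Longrightarrow> polyfun p"
  unfolding homog_polyfun_def polyfun_def by blast

locale dunkl_intertwined = dunkl_setting R Rp k
  for R Rp :: "(real^'n::finite) set" and k :: "real^'n \<Rightarrow> real" +
  fixes V :: "(real^'n \<Rightarrow> real) \<Rightarrow> real^'n \<Rightarrow> real"
  assumes intertwiner: "intertwiner Rp k V"
begin

abbreviation m :: "('n \<Rightarrow> nat) \<Rightarrow> real^'n \<Rightarrow> real" where
  "m \<equiv> moment V"

lemma V_lincomb: "polyfun p \<Longrightarrow> polyfun q \<Longrightarrow>
    V (\<lambda>x. a * p x + b * q x) = (\<lambda>x. a * V p x + b * V q x)"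
  and V_image: "V ` {p. homog_polyfun n p} = {p. homog_polyfun n p}"
  and V_one: "V (\<lambda>x. 1) = (\<lambda>x. 1)"
  and V_dunkl: "polyfun p \<Longrightarrow> (\<forall>\<alpha>\<in>Rp. \<alpha> \<bullet> x \<noteq> 0) \<Longrightarrow>
        dunkl i Rp k (V p) x = V (partial_deriv i p) x"
  using intertwiner unfolding intertwiner_def by blast+

lemma V_cmult: "polyfun p \<Longrightarrow> V (\<lambda>x. a * p x) = (\<lambda>x. a * V p x)"
  using V_lincomb[of p p a 0] by simp

lemma V_mono_sum:
  assumes "finite I" "I \<subseteq> {\<kappa>. mdeg \<kappa> = n}"
  shows "V (\<lambda>x. \<Sum>\<kappa>\<in>I. c \<kappa> * mono \<kappa> x) = (\<lambda>x. \<Sum>\<kappa>\<in>I. c \<kappa> * m \<kappa> x)"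
  using assms
proof (induction I rule: finite_induct)
  case empty
  show ?case
    using V_cmult[OF homog_polyfun_imp_polyfun[OF homog_polyfun_zero[of 0]], of 0] by simp
next
  case (insert a I)
  have "homog_polyfun n (\<lambda>x. \<Sum>\<kappa>\<in>I. c \<kappa> * mono \<kappa> x)"
  proof (intro homog_polyfun_sum homog_polyfun_cmult)
    fix \<kappa> assume "\<kappa> \<in> I"
    then have "mdeg \<kappa> = n" using insert by auto
    then show "homog_polyfun n (mono \<kappa>)" using homog_polyfun_mono[of \<kappa>] by simp
  qed (use insert in auto)
  then have "V (\<lambda>x. c a * mono a x + 1 * (\<Sum>\<kappa>\<in>I. c \<kappa> * mono \<kappa> x))
      = (\<lambda>x. c a * V (mono a) x + 1 * V (\<lambda>x. \<Sum>\<kappa>\<in>I. c \<kappa> * mono \<kappa> x) x)"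
    by (intro V_lincomb homog_polyfun_imp_polyfun[OF homog_polyfun_mono]) (rule homog_polyfun_imp_polyfun)
  then show ?case using insert by (simp add: moment_def)
qed

lemma homog_polyfun_moment: "homog_polyfun (mdeg \<kappa>) (m \<kappa>)"
  unfolding moment_def using V_image[of "mdeg \<kappa>"] homog_polyfun_mono[of \<kappa>] by blast

lemma hpoly_moment: "\<exists>B. hpoly (mdeg \<kappa>) B (m \<kappa>)"
  using homog_polyfun_moment homog_polyfun_hpoly by blast

lemma pf_moment: "pf (m \<kappa>)"
  using hpoly_moment hpoly_pf by blast

lemma moment_zero: "m (\<lambda>_. 0) = (\<lambda>x. 1)"
  by (simp add: moment_def V_one)

lemma moment_scaleR: "m \<kappa> (s *\<^sub>R x) = s ^ mdeg \<kappa> * m \<kappa> x"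
  using hpoly_moment[of \<kappa>] hpoly_scaleR by blast

text \<open>The intertwining relation for a monomial, extended over the hyperplanes by continuity:
  moments behave under \<open>T i\<close> as monomials do under partial derivatives.\<close>

lemma T_moment: "T i (m \<kappa>) = (\<lambda>x. real (\<kappa> i) * m (\<kappa>(i := \<kappa> i - 1)) x)"
proof -
  obtain \<beta> where \<beta>: "\<forall>\<alpha>\<in>R. \<alpha> \<bullet> \<beta> \<noteq> 0"
    using positive unfolding positive_subsystem_def by blast
  show ?thesis
  proof (rule continuous_eq_off_hyperplanes[of Rp \<beta>])
    show "continuous_on UNIV (T i (m \<kappa>))" by (intro pf_continuous pf_T pf_moment)
    show "continuous_on UNIV (\<lambda>x. real (\<kappa> i) * m (\<kappa>(i := \<kappa> i - 1)) x)"
      by (intro pf_continuous pf_cmult pf_moment)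
    fix x assume x: "\<forall>\<alpha>\<in>Rp. \<alpha> \<bullet> x \<noteq> 0"
    have "T i (m \<kappa>) x = dunkl i Rp k (m \<kappa>) x" using T_eq_dunkl[OF pf_moment x] by simp
    also have "\<dots> = V (partial_deriv i (mono \<kappa>)) x"
      unfolding moment_def
      by (rule V_dunkl[OF homog_polyfun_imp_polyfun[OF homog_polyfun_mono] x])
    also have "\<dots> = real (\<kappa> i) * m (\<kappa>(i := \<kappa> i - 1)) x"
      unfolding partial_deriv_mono
      by (subst V_cmult[OF homog_polyfun_imp_polyfun[OF homog_polyfun_mono]]) (simp add: moment_def)
    finally show "T i (m \<kappa>) x = real (\<kappa> i) * m (\<kappa>(i := \<kappa> i - 1)) x" .
  qed (use \<beta> finite_Rp Rp_root in auto)
qed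

text \<open>On the unit sphere the lowering relation and the induction hypothesis bound
  \<open>Tdir x (m \<kappa>) x\<close> by the sum of the \<open>\<kappa> i\<close>, which is the
  degree. The maximum principle divides by exactly this number, so no constant accumulates.\<close>

lemma moment_bound: "\<bar>m \<kappa> x\<bar> \<le> norm x ^ mdeg \<kappa>"
proof (induction "mdeg \<kappa>" arbitrary: \<kappa> x)
  case 0
  then have "\<kappa> = (\<lambda>_. 0)" by (simp add: mdeg_eq_0_iff[symmetric])
  then show ?case by (simp add: moment_zero)
next
  case (Suc n)
  obtain B where B: "hpoly (mdeg \<kappa>) B (m \<kappa>)" using hpoly_moment by blast
  have "\<bar>m \<kappa> x\<bar> \<le> 1 * norm x ^ mdeg \<kappa>"
  proof (rule hpoly_max_principle[OF B])
    fix x :: "real^'n" assume x: "norm x = 1"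
    have "\<bar>Tdir x (m \<kappa>) x\<bar> \<le> (\<Sum>i\<in>UNIV. \<bar>x $ i * (real (\<kappa> i) * m (\<kappa>(i := \<kappa> i - 1)) x)\<bar>)"
      unfolding Tdir_def T_moment by (rule sum_abs)
    also have "\<dots> \<le> (\<Sum>i\<in>UNIV. real (\<kappa> i))"
    proof (rule sum_mono)
      fix i
      show "\<bar>x $ i * (real (\<kappa> i) * m (\<kappa>(i := \<kappa> i - 1)) x)\<bar> \<le> real (\<kappa> i)"
      proof (cases "\<kappa> i = 0")
        case False
        then obtain \<mu> where \<mu>: "\<kappa> = inc i \<mu>" using inc_decomp by blast
        have "\<bar>m \<mu> x\<bar> \<le> norm x ^ mdeg \<mu>" using Suc \<mu> by simp
        moreover have "\<bar>x $ i\<bar> \<le> 1" using component_le_norm_cart[of x i] x by simp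
        ultimately have "\<bar>x $ i\<bar> * \<bar>m \<mu> x\<bar> \<le> 1 * 1" using x by (intro mult_mono) auto
        then have "real (\<kappa> i) * (\<bar>x $ i\<bar> * \<bar>m \<mu> x\<bar>) \<le> real (\<kappa> i) * 1"
          by (intro mult_left_mono) auto
        moreover have "\<kappa>(i := \<kappa> i - 1) = \<mu>" unfolding \<mu> by simp
        ultimately show ?thesis by (simp add: abs_mult mult_ac)
      qed simp
    qed
    also have "\<dots> = real (mdeg \<kappa>) * 1" by (simp add: mdeg_def)
    finally show "\<bar>Tdir x (m \<kappa>) x\<bar> \<le> real (mdeg \<kappa>) * 1" .
  qed (use Suc in simp)
  then show ?case by simp
qed

text \<open>Surjectivity of \<open>V\<close> in each degree: a homogeneous polynomial is the image
  of one of the same degree, and \<open>V\<close> sends monomials to moments.\<close>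

lemma hpoly_moment_span:
  assumes "hpoly n B f"
  shows "\<exists>c. f = (\<lambda>x. \<Sum>\<kappa> | mdeg \<kappa> = n. c \<kappa> * m \<kappa> x)"
proof -
  have "f \<in> V ` {p. homog_polyfun n p}" using V_image hpoly_homog_polyfun[OF assms] by blast
  then obtain p where "homog_polyfun n p" "f = V p" by blast
  then obtain c where "f = V (\<lambda>x. \<Sum>\<kappa> | mdeg \<kappa> = n. c \<kappa> * mono \<kappa> x)"
    unfolding homog_polyfun_iff by blast
  then show ?thesis by (subst (asm) V_mono_sum[of _ n]) auto
qed

lemma T_moment_sum:
  assumes "finite I"
  shows "T i (\<lambda>x. \<Sum>\<kappa>\<in>I. c \<kappa> * m \<kappa> x) = (\<lambda>x. \<Sum>\<kappa>\<in>I. c \<kappa> * T i (m \<kappa>) x)"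
  using assms by (subst T_sum) (auto intro!: pf_cmult pf_moment simp: T_cmult pf_moment)

lemma T_T_moment: "T i (T j (m \<kappa>)) = T j (T i (m \<kappa>))"
proof (cases "i = j")
  case False
  then show ?thesis
    by (simp add: T_moment T_cmult pf_moment fun_upd_twist mult.left_commute)
qed simp

text \<open>On moments the operators lower exponents and therefore commute, and the moments span.
  This replaces the usual computation with pairs of roots.\<close>

lemma T_commute:
  assumes "hpoly n B f"
  shows "T i (T j f) = T j (T i f)"
proof -
  obtain c where f: "f = (\<lambda>x. \<Sum>\<kappa> | mdeg \<kappa> = n. c \<kappa> * m \<kappa> x)"
    using hpoly_moment_span[OF assms] by blast
  have "T i (T j f) = (\<lambda>x. \<Sum>\<kappa> | mdeg \<kappa> = n. c \<kappa> * T i (T j (m \<kappa>)) x)" for i j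
    unfolding f T_moment_sum[OF finite_mdeg]
    by (subst T_sum) (auto intro!: pf_cmult pf_T pf_moment simp: T_cmult pf_T pf_moment)
  then show ?thesis using T_T_moment[of i j] by simp
qed

lemma T_hpoly_ex: "hpoly n B f \<Longrightarrow> \<exists>C. hpoly (n - 1) C (T i f)"
proof (cases "n = 0")
  case True
  assume "hpoly n B f"
  then show ?thesis using True T_hpoly_0[of B f i] hpoly_zero[of 0] by auto
next
  case False
  assume "hpoly n B f"
  then show ?thesis using T_hpoly[of n B f i] False by blast
qed

lemma T_lap:
  assumes f: "hpoly n B f"
  shows "T i (lap f) = lap (T i f)"
proof
  fix x
  have pf: "pf f" using f hpoly_pf by blast
  have "T i (lap f) x = (\<Sum>j\<in>UNIV. T i (T j (T j f)) x)"
    unfolding lap_def[abs_def] by (subst T_sum) (auto intro!: pf_T pf)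
  also have "\<dots> = (\<Sum>j\<in>UNIV. T j (T j (T i f)) x)"
  proof (intro sum.cong refl)
    fix j
    obtain C where "hpoly (n - 1) C (T j f)" using T_hpoly_ex[OF f] by blast
    then have "T i (T j (T j f)) = T j (T i (T j f))" by (rule T_commute)
    also have "T i (T j f) = T j (T i f)" by (rule T_commute[OF f])
    finally show "T i (T j (T j f)) x = T j (T j (T i f)) x" by simp
  qed
  finally show "T i (lap f) x = lap (T i f) x" by (simp add: lap_def)
qed

section \<open>Powers of the Dunkl Laplacian\<close>

lemma lap_hpoly_small: "hpoly n B f \<Longrightarrow> n < 2 \<Longrightarrow> lap f = (\<lambda>x. 0)"
proof
  fix x assume f: "hpoly n B f" and n: "n < 2"
  have "T i (T i f) = (\<lambda>x. 0)" for i
  proof (cases n)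
    case 0
    then show ?thesis using T_hpoly_0[of B f] f T_const by simp
  next
    case (Suc l)
    then show ?thesis using T_hpoly[OF f, of i] n T_hpoly_0[of _ "T i f" i] by auto
  qed
  then show "lap f x = 0" by (simp add: lap_def)
qed

text \<open>Two applications of a Dunkl operator, summed over the coordinates.\<close>

definition lap_bound :: real where
  "lap_bound = real CARD('n) * T_growth\<^sup>2"

lemma lap_bound_nonneg: "lap_bound \<ge> 0"
  unfolding lap_bound_def by simp

lemma lap_hpoly:
  assumes f: "hpoly n B f" and n: "n \<ge> 2"
  shows "hpoly (n - 2) (lap_bound * (real n * real (n - 1)) * B) (lap f)"
proof -
  have "hpoly (n - 2) (\<Sum>i\<in>(UNIV::'n set). T_growth * real (n - 1) * (T_growth * real n * B)) (lap f)"
    unfolding lap_def[abs_def]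
  proof (intro hpoly_sum)
    fix i
    show "hpoly (n - 2) (T_growth * real (n - 1) * (T_growth * real n * B)) (T i (T i f))"
      using T_hpoly[OF T_hpoly[OF f, of i], of i] n by (simp add: numeral_2_eq_2)
  qed simp
  then show ?thesis by (simp add: lap_bound_def power2_eq_square mult_ac)
qed

text \<open>The degree factors of successive Laplacians multiply to the falling factorial
  \<open>fact n / fact (n - 2 * j)\<close>. Its numerator will cancel the \<open>1 / fact n\<close>
  of level \<open>n\<close> in the generating function.\<close>

lemma lap_pow_hpoly:
  assumes f: "hpoly n B f"
  shows "(2 * j \<le> n \<longrightarrow> hpoly (n - 2 * j) (lap_bound ^ j * (fact n / fact (n - 2 * j)) * B) ((lap ^^ j) f))
       \<and> (n < 2 * j \<longrightarrow> (lap ^^ j) f = (\<lambda>x. 0))"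
proof (induction j)
  case 0
  then show ?case using f by simp
next
  case (Suc j)
  consider "2 * Suc j \<le> n" | "2 * j \<le> n" "n < 2 * Suc j" | "n < 2 * j" by linarith
  then show ?case
  proof cases
    case 1
    define l where "l = n - 2 * Suc j"
    have l: "n - 2 * j = l + 2" using 1 by (simp add: l_def)
    have "hpoly (l + 2) (lap_bound ^ j * (fact n / fact (l + 2)) * B) ((lap ^^ j) f)"
      using Suc 1 l by simp
    from lap_hpoly[OF this] have "hpoly l
       (lap_bound * (real (l + 2) * real (l + 1)) * (lap_bound ^ j * (fact n / fact (l + 2)) * B)) ((lap ^^ Suc j) f)"
      by simp
    moreover have "lap_bound * (real (l + 2) * real (l + 1)) * (lap_bound ^ j * (fact n / fact (l + 2)) * B)
        = lap_bound ^ Suc j * (fact n / fact l) * B"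
    proof -
      have "fact (l + 2) = real (l + 2) * real (l + 1) * fact l" by (simp add: numeral_2_eq_2)
      then show ?thesis by (simp del: of_nat_add of_nat_Suc)
    qed
    ultimately show ?thesis using 1 by (simp add: l_def mult.assoc)
  next
    case 2
    then have "hpoly (n - 2 * j) (lap_bound ^ j * (fact n / fact (n - 2 * j)) * B) ((lap ^^ j) f)"
      using Suc by simp
    then have "lap ((lap ^^ j) f) = (\<lambda>x. 0)" using 2 by (intro lap_hpoly_small) auto
    then show ?thesis using 2 by simp
  next
    case 3
    then show ?thesis using Suc lap_zero by simp
  qed
qed

lemma lap_pow_hpoly_ex: "hpoly n B f \<Longrightarrow> \<exists>l C. hpoly l C ((lap ^^ j) f)"
  using lap_pow_hpoly[of n B f j] hpoly_zero by (metis not_le)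

lemma pf_lap_pow: "pf f \<Longrightarrow> pf ((lap ^^ j) f)"
  by (induction j) (auto intro: pf_lap)

lemma lap_pow_cmult: "pf f \<Longrightarrow> (lap ^^ j) (\<lambda>x. c * f x) = (\<lambda>x. c * (lap ^^ j) f x)"
  by (induction j) (auto simp: lap_cmult pf_lap_pow)

lemma lap_pow_sum:
  assumes "finite I" "\<And>a. a \<in> I \<Longrightarrow> pf (f a)"
  shows "(lap ^^ j) (\<lambda>x. \<Sum>a\<in>I. f a x) = (\<lambda>x. \<Sum>a\<in>I. (lap ^^ j) (f a) x)"
  by (induction j) (auto simp: lap_sum pf_lap_pow assms)

text \<open>Since \<open>lap\<close> commutes with Dunkl operators, each of the \<open>Suc j\<close>
  Laplacians contributes the same commutator term. The exponent is \<open>Suc j\<close> so that no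
  predecessor occurs.\<close>

lemma lap_pow_inner_mult:
  assumes f: "hpoly n B f"
  shows "(lap ^^ Suc j) (\<lambda>x. (a \<bullet> x) * f x) =
    (\<lambda>x. (a \<bullet> x) * (lap ^^ Suc j) f x + 2 * real (Suc j) * Tdir a ((lap ^^ j) f) x)"
proof (induction j)
  case 0
  then show ?case using lap_inner_mult[OF f] by simp
next
  case (Suc j)
  obtain l C where g: "hpoly l C ((lap ^^ j) f)" using lap_pow_hpoly_ex[OF f] by blast
  obtain l' C' where g': "hpoly l' C' ((lap ^^ Suc j) f)" using lap_pow_hpoly_ex[OF f] by blast
  have pfd: "pf (Tdir a h)" if "pf h" for h
    unfolding Tdir_def[abs_def] using that by (intro pf_sum pf_cmult pf_T) auto
  have lapT: "lap (Tdir a ((lap ^^ j) f)) = Tdir a ((lap ^^ Suc j) f)"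
  proof
    fix x
    have "lap (Tdir a ((lap ^^ j) f)) x = (\<Sum>i\<in>UNIV. a $ i * lap (T i ((lap ^^ j) f)) x)"
      unfolding Tdir_def[abs_def]
      by (subst lap_sum) (auto intro!: pf_cmult pf_T hpoly_pf[OF g] simp: lap_cmult pf_T hpoly_pf[OF g])
    then show "lap (Tdir a ((lap ^^ j) f)) x = Tdir a ((lap ^^ Suc j) f) x"
      by (simp add: Tdir_def T_lap[OF g])
  qed
  have pf1: "pf (\<lambda>x. (a \<bullet> x) * (lap ^^ Suc j) f x)"
    by (intro pf_mult pf_inner hpoly_pf[OF g'])
  have pf2: "pf (\<lambda>x. 2 * real (Suc j) * Tdir a ((lap ^^ j) f) x)"
    by (intro pf_cmult pfd hpoly_pf[OF g])
  have "(lap ^^ Suc (Suc j)) (\<lambda>x. (a \<bullet> x) * f x)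
      = lap (\<lambda>x. (a \<bullet> x) * (lap ^^ Suc j) f x + 2 * real (Suc j) * Tdir a ((lap ^^ j) f) x)"
    using Suc by simp
  also have "\<dots> = (\<lambda>x. (a \<bullet> x) * lap ((lap ^^ Suc j) f) x + 2 * Tdir a ((lap ^^ Suc j) f) x
      + 2 * real (Suc j) * Tdir a ((lap ^^ Suc j) f) x)"
    unfolding lap_add[OF pf1 pf2] lap_inner_mult[OF g'] lap_cmult[OF pfd[OF hpoly_pf[OF g]]] lapT ..
  finally show ?case by (simp add: algebra_simps)
qed

section \<open>Homogeneous components of the Dunkl kernel\<close>

definition K :: "nat \<Rightarrow> real^'n \<Rightarrow> real^'n \<Rightarrow> real" where
  "K n x y = (\<Sum>\<kappa> | mdeg \<kappa> = n. m \<kappa> x / mfact \<kappa> * mono \<kappa> y)"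

text \<open>The component of degree \<open>n - 1\<close>, with value 0 for \<open>n = 0\<close>; the
  eigenvalue relations then hold in every degree without truncated subtraction.\<close>

definition Kpred :: "nat \<Rightarrow> real^'n \<Rightarrow> real^'n \<Rightarrow> real" where
  "Kpred n x y = (case n of 0 \<Rightarrow> 0 | Suc l \<Rightarrow> K l x y)"

lemma K_0: "K 0 x y = 1"
  by (simp add: K_def mdeg_level_zero moment_zero)

lemma hpoly_moment_sum:
  "\<exists>B. hpoly n B (\<lambda>x. \<Sum>\<kappa> | mdeg \<kappa> = n. c \<kappa> * m \<kappa> x)"
proof -
  obtain b where b: "\<And>\<kappa>. hpoly (mdeg \<kappa>) (b \<kappa>) (m \<kappa>)" using hpoly_moment by metis
  have "hpoly n (\<Sum>\<kappa> | mdeg \<kappa> = n. \<bar>c \<kappa>\<bar> * b \<kappa>) (\<lambda>x. \<Sum>\<kappa> | mdeg \<kappa> = n. c \<kappa> * m \<kappa> x)"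
    by (intro hpoly_sum hpoly_cmult) (use b in auto)
  then show ?thesis by blast
qed

lemma K_alt: "K n x y = (\<Sum>\<kappa> | mdeg \<kappa> = n. (mono \<kappa> y / mfact \<kappa>) * m \<kappa> x)"
  unfolding K_def by (intro sum.cong refl) simp

lemma hpoly_K_left: "\<exists>B. hpoly n B (\<lambda>x. K n x y)"
  unfolding K_alt by (rule hpoly_moment_sum)

lemma hpoly_K_right: "\<exists>B. hpoly n B (K n x)"
proof -
  have "hpoly n (\<Sum>\<kappa> | mdeg \<kappa> = n. \<bar>m \<kappa> x / mfact \<kappa>\<bar> * 1) (K n x)"
    unfolding K_def[abs_def] by (intro hpoly_sum hpoly_cmult) (use hpoly_mono in auto)
  then show ?thesis by blast
qed

text \<open>The weight \<open>g\<close> is arbitrary so that one index shift serves monomials, Dunkl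
  operators applied to monomials, and unknown coefficients.\<close>

lemma sum_moment_level_pred:
  fixes g :: "('n \<Rightarrow> nat) \<Rightarrow> real"
  shows "(\<Sum>\<kappa> | mdeg \<kappa> = Suc n. (g \<kappa> / mfact \<kappa>) * T i (m \<kappa>) x)
    = (\<Sum>\<mu> | mdeg \<mu> = n. g (inc i \<mu>) * (m \<mu> x / mfact \<mu>))"
proof -
  have "(\<Sum>\<kappa> | mdeg \<kappa> = Suc n. (g \<kappa> / mfact \<kappa>) * T i (m \<kappa>) x)
     = (\<Sum>\<kappa> | mdeg \<kappa> = Suc n. real (\<kappa> i) / mfact \<kappa> * (g \<kappa> * m (\<kappa>(i := \<kappa> i - 1)) x))"
    by (intro sum.cong refl) (simp add: T_moment)
  also have "\<dots> = (\<Sum>\<mu> | mdeg \<mu> = n. g (inc i \<mu>) * m ((inc i \<mu>)(i := inc i \<mu> i - 1)) x / mfact \<mu>)"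
    by (rule sum_mdeg_Suc)
  finally show ?thesis by simp
qed

text \<open>The kernel is a series of moments in \<open>x\<close>, so in this variable the
  eigenvalue relation is the lowering relation taken termwise.\<close>

lemma T_K_left: "T i (\<lambda>x. K n x y) x = y $ i * Kpred n x y"
proof (cases n)
  case 0
  then show ?thesis by (simp add: K_0 T_const Kpred_def)
next
  case (Suc l)
  have "T i (\<lambda>x. K n x y) x = (\<Sum>\<kappa> | mdeg \<kappa> = Suc l. (mono \<kappa> y / mfact \<kappa>) * T i (m \<kappa>) x)"
    unfolding K_alt T_moment_sum[OF finite_mdeg] Suc ..
  also have "\<dots> = (\<Sum>\<mu> | mdeg \<mu> = l. mono (inc i \<mu>) y * (m \<mu> x / mfact \<mu>))"
    by (rule sum_moment_level_pred)
  also have "\<dots> = y $ i * K l x y"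
    unfolding K_def sum_distrib_left by (intro sum.cong refl) (simp add: mono_inc)
  finally show ?thesis by (simp add: Suc Kpred_def)
qed

text \<open>By equivariance, the eigenvalue relation in \<open>x\<close> and the induction
  hypothesis, every Dunkl operator gives the same result on both sides. In positive degree this
  forces equality.\<close>

lemma K_reflection:
  assumes \<beta>: "\<beta> \<in> R"
  shows "K n (reflection \<beta> x) y = K n x (reflection \<beta> y)"
proof (induction n arbitrary: x y)
  case 0
  then show ?case by (simp add: K_0)
next
  case (Suc n)
  obtain B C where B: "hpoly (Suc n) B (\<lambda>x. K (Suc n) x y)" and C: "hpoly (Suc n) C (\<lambda>x. K (Suc n) x (reflection \<beta> y))"
    using hpoly_K_left by metis
  have B': "hpoly (Suc n) B (\<lambda>x. K (Suc n) (reflection \<beta> x) y)"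
    by (rule hpoly_reflection[OF _ B]) (simp add: root_norm \<beta>)
  have "T i (\<lambda>x. K (Suc n) (reflection \<beta> x) y - K (Suc n) x (reflection \<beta> y)) x = 0" for i x
  proof -
    have "T i (\<lambda>x. K (Suc n) (reflection \<beta> x) y) x = Tdir (axis i 1) (\<lambda>x. K (Suc n) (reflection \<beta> x) y) x"
      by (simp add: Tdir_def axis_def if_distrib[of "\<lambda>c. c * _"] cong: if_cong)
    also have "\<dots> = Tdir (reflection \<beta> (axis i 1)) (\<lambda>x. K (Suc n) x y) (reflection \<beta> x)"
      by (rule Tdir_reflection[OF \<beta> B])
    also have "\<dots> = (\<Sum>j\<in>UNIV. reflection \<beta> (axis i 1) $ j * y $ j) * K n (reflection \<beta> x) y"
      unfolding Tdir_def T_K_left by (simp add: Kpred_def sum_distrib_right mult.assoc)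
    also have "(\<Sum>j\<in>UNIV. reflection \<beta> (axis i 1) $ j * y $ j) = reflection \<beta> (axis i 1) \<bullet> y"
      by (simp add: inner_vec_def)
    also have "\<dots> = reflection \<beta> y $ i"
      by (simp add: inner_reflection[symmetric] inner_axis')
    finally have "T i (\<lambda>x. K (Suc n) (reflection \<beta> x) y) x = reflection \<beta> y $ i * K n x (reflection \<beta> y)"
      by (simp add: Suc)
    then show ?thesis
      using T_diff[OF hpoly_pf[OF B'] hpoly_pf[OF C], of i] T_K_left[of i "Suc n" "reflection \<beta> y" x]
      by (simp add: Kpred_def)
  qed
  then have "K (Suc n) (reflection \<beta> x) y - K (Suc n) x (reflection \<beta> y) = 0"
    using hpoly_eq_0[OF hpoly_diff[OF B' C]] by blast
  then show ?case by simp
qed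

text \<open>The difference of both sides is homogeneous of positive degree in \<open>x\<close> and annihilated by every
  Dunkl operator in \<open>x\<close>; the two commutators produce the same reflection terms because
  \<open>K (\<sigma> x) y = K x (\<sigma> y)\<close>.\<close>

lemma T_K_right: "T i (K n x) y = x $ i * Kpred n x y"
proof (induction n arbitrary: x y i)
  case 0
  have "K 0 x = (\<lambda>y. 1)" by (simp add: K_0 fun_eq_iff)
  then show ?case by (simp add: T_const Kpred_def)
next
  case (Suc n)
  \<comment> \<open>With \<open>y\<close> fixed, the left side is read as a homogeneous polynomial
    in \<open>x\<close>; the operator in \<open>y\<close> only affects its coefficients.\<close>
  define L where "L x = (\<Sum>\<kappa> | mdeg \<kappa> = Suc n. (T i (mono \<kappa>) y / mfact \<kappa>) * m \<kappa> x)" for x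
  have TK: "T i (K (Suc n) x) y = L x" for x
  proof -
    have "T i (K (Suc n) x) y = (\<Sum>\<kappa> | mdeg \<kappa> = Suc n. m \<kappa> x / mfact \<kappa> * T i (mono \<kappa>) y)"
      unfolding K_def[abs_def] by (subst T_sum)
        (auto intro!: pf_cmult pf_mono simp: T_cmult[OF pf_mono] simp del: times_divide_eq_left)
    then show ?thesis unfolding L_def by (simp add: mult.commute)
  qed
  obtain B where B: "hpoly (Suc n) B L"
    using hpoly_moment_sum[of "Suc n" "\<lambda>\<kappa>. T i (mono \<kappa>) y / mfact \<kappa>"]
    unfolding L_def[abs_def] by blast
  obtain C0 where C0: "hpoly n C0 (\<lambda>x. K n x y)" using hpoly_K_left by blast
  define M where "M x = (axis i 1 \<bullet> x) * K n x y" for x :: "real^'n"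
  have C: "hpoly (Suc n) C0 M"
    unfolding M_def[abs_def] by (rule hpoly_inner[OF _ C0]) (simp add: norm_axis_1)
  have "T j (\<lambda>x. L x - M x) x = 0" for j x
  proof -
    obtain D where D: "hpoly n D (K n x)" using hpoly_K_right by blast
    have "T j L x = (\<Sum>\<kappa> | mdeg \<kappa> = Suc n. (T i (mono \<kappa>) y / mfact \<kappa>) * T j (m \<kappa>) x)"
      unfolding L_def[abs_def] T_moment_sum[OF finite_mdeg] ..
    also have "\<dots> = (\<Sum>\<mu> | mdeg \<mu> = n. T i (mono (inc j \<mu>)) y * (m \<mu> x / mfact \<mu>))"
      by (rule sum_moment_level_pred)
    also have "\<dots> = (\<Sum>\<mu> | mdeg \<mu> = n. (m \<mu> x / mfact \<mu>) * T i (mono (inc j \<mu>)) y)"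
      by (simp only: mult.commute)
    also have "\<dots> = T i (\<lambda>y. \<Sum>\<mu> | mdeg \<mu> = n. (m \<mu> x / mfact \<mu>) * mono (inc j \<mu>) y) y"
      by (subst T_sum)
        (auto intro!: pf_cmult pf_mono simp: T_cmult[OF pf_mono] simp del: times_divide_eq_left)
    also have "(\<lambda>y. \<Sum>\<mu> | mdeg \<mu> = n. (m \<mu> x / mfact \<mu>) * mono (inc j \<mu>) y) = (\<lambda>y. (axis j 1 \<bullet> y) * K n x y)"
      unfolding K_def sum_distrib_left by (intro ext sum.cong refl) (simp add: mono_inc inner_axis')
    finally have 1: "T j L x = y $ j * (x $ i * Kpred n x y) + axis j 1 $ i * K n x y
       + (\<Sum>\<alpha>\<in>Rp. (k \<alpha> * \<alpha> $ i * \<alpha> $ j) * K n x (reflection \<alpha> y))"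
      unfolding T_inner_mult[OF hpoly_pf[OF D]] by (simp add: Suc inner_axis')
    have "T j M x = x $ i * (y $ j * Kpred n x y) + axis i 1 $ j * K n x y
       + (\<Sum>\<alpha>\<in>Rp. (k \<alpha> * \<alpha> $ j * \<alpha> $ i) * K n (reflection \<alpha> x) y)"
      unfolding M_def[abs_def] T_inner_mult[OF hpoly_pf[OF C0]] by (simp add: T_K_left inner_axis')
    also have "(\<Sum>\<alpha>\<in>Rp. (k \<alpha> * \<alpha> $ j * \<alpha> $ i) * K n (reflection \<alpha> x) y)
       = (\<Sum>\<alpha>\<in>Rp. (k \<alpha> * \<alpha> $ i * \<alpha> $ j) * K n x (reflection \<alpha> y))"
      by (intro sum.cong refl) (simp add: K_reflection Rp_root mult_ac)
    also have "axis i (1::real) $ j = axis j 1 $ i" by (simp add: axis_def)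
    finally have "T j L x = T j M x" using 1 by (simp add: mult_ac)
    then show ?thesis using T_diff[OF hpoly_pf[OF B] hpoly_pf[OF C], of j] by simp
  qed
  then have "L x - M x = 0" for x using hpoly_eq_0[OF hpoly_diff[OF B C]] by blast
  then have "L x = M x" by simp
  then show ?case by (simp add: TK M_def Kpred_def inner_axis')
qed

lemma lap_K_small: "n < 2 \<Longrightarrow> lap (K n x) = (\<lambda>y. 0)"
  using hpoly_K_right[of n x] lap_hpoly_small by blast

lemma lap_K: "lap (K (Suc (Suc n)) x) = (\<lambda>y. (norm x)\<^sup>2 * K n x y)"
proof
  fix y
  obtain B where B: "hpoly (Suc n) B (K (Suc n) x)" using hpoly_K_right by blast
  have "T i (K (Suc (Suc n)) x) = (\<lambda>y. x $ i * K (Suc n) x y)" for i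
    by (auto simp: T_K_right Kpred_def)
  then have "T i (T i (K (Suc (Suc n)) x)) y = (x $ i * x $ i) * K n x y" for i
    using T_cmult[OF hpoly_pf[OF B], of i "x $ i"] by (simp add: T_K_right Kpred_def)
  then show "lap (K (Suc (Suc n)) x) y = (norm x)\<^sup>2 * K n x y"
    by (simp add: lap_def power2_norm_eq_inner inner_vec_def sum_distrib_right)
qed

text \<open>The degreewise form of the fact that \<open>exp (- t \<Delta>)\<close>, acting in
  \<open>y\<close>, multiplies the kernel by \<open>exp (- t |x|^2)\<close>.\<close>

lemma lap_pow_K:
  "(lap ^^ j) (K n x) = (\<lambda>y. if 2 * j \<le> n then (norm x)\<^sup>2 ^ j * K (n - 2 * j) x y else 0)"
proof (induction j)
  case (Suc j)
  have pfK: "pf (K l x)" for l using hpoly_K_right hpoly_pf by blast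
  consider "2 * Suc j \<le> n" | "2 * j \<le> n" "n < 2 * Suc j" | "n < 2 * j" by linarith
  then show ?case
  proof cases
    case 1
    define l where "l = n - 2 * Suc j"
    have l: "n - 2 * j = Suc (Suc l)" using 1 by (simp add: l_def)
    have "(lap ^^ Suc j) (K n x) = lap (\<lambda>y. (norm x)\<^sup>2 ^ j * K (Suc (Suc l)) x y)"
      using Suc 1 l by simp
    also have "\<dots> = (\<lambda>y. (norm x)\<^sup>2 ^ Suc j * K l x y)"
      unfolding lap_cmult[OF pfK] lap_K by (simp add: mult_ac)
    finally show ?thesis using 1 by (simp add: l_def)
  next
    case 2
    then have "(lap ^^ Suc j) (K n x) = lap (\<lambda>y. (norm x)\<^sup>2 ^ j * K (n - 2 * j) x y)"
      using Suc by simp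
    also have "\<dots> = (\<lambda>y. 0)" using 2 by (simp add: lap_cmult pfK lap_K_small)
    finally show ?thesis using 2 by simp
  next
    case 3
    then show ?thesis using Suc lap_zero by simp
  qed
qed simp

end

section \<open>Integration by parts for Dunkl operators\<close>

lemma continuous_imp_borel: "continuous_on UNIV f \<Longrightarrow> f \<in> borel_measurable borel"
  by (rule borel_measurable_continuous_onI)

lemma pf_borel: "pf f \<Longrightarrow> (f :: 'a::euclidean_space \<Rightarrow> real) \<in> borel_measurable borel"
  by (intro continuous_imp_borel pf_continuous)

lemma one_plus_square_le_exp: "1 + u\<^sup>2 \<le> exp (2 * \<bar>u\<bar>)" for u :: real
proof -
  have "1 + u\<^sup>2 \<le> (1 + \<bar>u\<bar>)\<^sup>2" by (simp add: power2_eq_square algebra_simps)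
  also have "\<dots> \<le> exp \<bar>u\<bar> ^ 2" by (intro power_mono exp_ge_add_one_self) auto
  also have "\<dots> = exp (2 * \<bar>u\<bar>)" by (simp add: exp_double)
  finally show ?thesis .
qed

text \<open>Numerator and denominator both change sign under the reflection.\<close>

lemma divdiff_reflection:
  assumes "pf f" "\<alpha> \<bullet> \<alpha> = 2"
  shows "divdiff \<alpha> f (reflection \<alpha> x) = divdiff \<alpha> f x"
proof -
  have nz: "\<alpha> \<noteq> 0" using assms(2) by auto
  have u: "\<alpha> \<bullet> reflection \<alpha> x = - (\<alpha> \<bullet> x)" for x
    using assms(2) by (simp add: reflection_def inner_simps)
  have "divdiff \<alpha> f = (\<lambda>x. divdiff \<alpha> f (reflection \<alpha> x))"
  proof (rule divdiff_eqI[OF nz])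
    show "continuous_on UNIV (\<lambda>x. divdiff \<alpha> f (reflection \<alpha> x))"
      by (intro pf_continuous pf_compose_reflection[OF pf_divdiff[OF assms(1) nz]])
    fix x
    have "f (reflection \<alpha> x) - f x = - (\<alpha> \<bullet> x) * divdiff \<alpha> f (reflection \<alpha> x)"
      using divdiff_mult[OF assms(1) nz, of "reflection \<alpha> x"] assms(2) by (simp add: reflection_reflection u)
    then show "f x - f (reflection \<alpha> x) = (\<alpha> \<bullet> x) * divdiff \<alpha> f (reflection \<alpha> x)" by simp
  qed
  then show ?thesis by metis
qed

text \<open>The defect of the ordinary Leibniz rule is \<open>\<alpha> \<bullet> x\<close> times a
  product of divided differences. For a root this is odd under the reflection, and the oddness later
  removes it from the adjoint formula.\<close>

lemma divdiff_product:
  assumes "pf f" "pf g" "\<alpha> \<noteq> 0"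
  shows "divdiff \<alpha> f x * g x + f x * divdiff \<alpha> g x
    = divdiff \<alpha> (\<lambda>x. f x * g x) x + (\<alpha> \<bullet> x) * (divdiff \<alpha> f x * divdiff \<alpha> g x)"
proof -
  have "divdiff \<alpha> (\<lambda>x. f x * g x) = (\<lambda>x. divdiff \<alpha> f x * g x + f (reflection \<alpha> x) * divdiff \<alpha> g x)"
  proof (rule divdiff_eqI[OF assms(3)])
    show "continuous_on UNIV (\<lambda>x. divdiff \<alpha> f x * g x + f (reflection \<alpha> x) * divdiff \<alpha> g x)"
      by (intro pf_continuous pf_add pf_mult pf_divdiff
          pf_compose_reflection[OF assms(1)] assms)
    fix x
    have "f x * g x - f (reflection \<alpha> x) * g (reflection \<alpha> x)
      = (f x - f (reflection \<alpha> x)) * g x + f (reflection \<alpha> x) * (g x - g (reflection \<alpha> x))"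
      by (simp add: algebra_simps)
    also have "\<dots> = (\<alpha> \<bullet> x) * (divdiff \<alpha> f x * g x + f (reflection \<alpha> x) * divdiff \<alpha> g x)"
      unfolding divdiff_mult[OF assms(1,3), of x] divdiff_mult[OF assms(2,3), of x] by (simp add: algebra_simps)
    finally show "f x * g x - f (reflection \<alpha> x) * g (reflection \<alpha> x)
      = (\<alpha> \<bullet> x) * (divdiff \<alpha> f x * g x + f (reflection \<alpha> x) * divdiff \<alpha> g x)" .
  qed
  then have "divdiff \<alpha> f x * g x + f x * divdiff \<alpha> g x - divdiff \<alpha> (\<lambda>x. f x * g x) x
    = (f x - f (reflection \<alpha> x)) * divdiff \<alpha> g x" by (simp add: algebra_simps)
  then show ?thesis unfolding divdiff_mult[OF assms(1,3), of x] by simp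
qed

section \<open>The weight function and its regularisation\<close>

context dunkl_setting
begin

text \<open>A smooth, reflection-invariant regularisation of the weight, which may fail to be
  differentiable on the hyperplanes.\<close>

definition weps :: "real \<Rightarrow> real^'n \<Rightarrow> real" where
  "weps \<epsilon> x = exp (\<Sum>\<alpha>\<in>Rp. k \<alpha> * ln ((\<alpha> \<bullet> x)\<^sup>2 + \<epsilon>))"

text \<open>An exponential rate obtained from \<open>1 + u^2 \<le> exp (2 |u|)\<close> and
  Cauchy-Schwarz. It does not involve \<open>\<epsilon>\<close>, so for
  \<open>\<epsilon> \<le> 1\<close> one bound dominates all regularisations and their limit.\<close>

definition wrate :: real where
  "wrate = (\<Sum>\<alpha>\<in>Rp. k \<alpha> * (2 * norm \<alpha>))"

lemma weps_reflection: "\<beta> \<in> R \<Longrightarrow> weps \<epsilon> (reflection \<beta> x) = weps \<epsilon> x"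
proof -
  assume \<beta>: "\<beta> \<in> R"
  define g where "g \<alpha> = k \<alpha> * ln ((\<alpha> \<bullet> x)\<^sup>2 + \<epsilon>)" for \<alpha>
  have "(\<Sum>\<alpha>\<in>Rp. g (reflection \<beta> \<alpha>)) = (\<Sum>\<alpha>\<in>Rp. g \<alpha>)"
    by (rule sum_Rp_reflection) (auto simp: g_def k_uminus \<beta>)
  moreover have "g (reflection \<beta> \<alpha>) = k \<alpha> * ln ((\<alpha> \<bullet> reflection \<beta> x)\<^sup>2 + \<epsilon>)" if "\<alpha> \<in> Rp" for \<alpha>
    using that by (simp add: g_def k_reflection \<beta> Rp_root inner_reflection)
  ultimately show ?thesis by (simp add: weps_def g_def)
qed

lemma weps_pos: "weps \<epsilon> x > 0"
  by (simp add: weps_def)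

lemma weps_bound:
  assumes "0 < \<epsilon>" "\<epsilon> \<le> 1"
  shows "weps \<epsilon> x \<le> exp (wrate * norm x)"
proof -
  have "k \<alpha> * ln ((\<alpha> \<bullet> x)\<^sup>2 + \<epsilon>) \<le> k \<alpha> * (2 * norm \<alpha>) * norm x" if "\<alpha> \<in> Rp" for \<alpha>
  proof -
    have p: "(\<alpha> \<bullet> x)\<^sup>2 + \<epsilon> > 0" using assms by (simp add: add_nonneg_pos)
    have "(\<alpha> \<bullet> x)\<^sup>2 + \<epsilon> \<le> exp (2 * \<bar>\<alpha> \<bullet> x\<bar>)" using one_plus_square_le_exp[of "\<alpha> \<bullet> x"] assms by simp
    then have "ln ((\<alpha> \<bullet> x)\<^sup>2 + \<epsilon>) \<le> 2 * \<bar>\<alpha> \<bullet> x\<bar>"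
      using p by (metis exp_gt_zero ln_exp ln_le_cancel_iff)
    also have "\<dots> \<le> 2 * norm \<alpha> * norm x" using Cauchy_Schwarz_ineq2[of \<alpha> x] by simp
    finally show ?thesis
      using mult_left_mono[OF _ k_nonneg[OF Rp_root[OF that]]] by (metis mult.assoc)
  qed
  then have "(\<Sum>\<alpha>\<in>Rp. k \<alpha> * ln ((\<alpha> \<bullet> x)\<^sup>2 + \<epsilon>)) \<le> (\<Sum>\<alpha>\<in>Rp. k \<alpha> * (2 * norm \<alpha>) * norm x)"
    by (rule sum_mono)
  then show ?thesis by (simp add: weps_def wrate_def sum_distrib_right)
qed

lemma weps_measurable [measurable]: "weps \<epsilon> \<in> borel_measurable borel"
  unfolding weps_def[abs_def] by measurable

lemma exp_growth_weps: "0 < \<epsilon> \<Longrightarrow> \<epsilon> \<le> 1 \<Longrightarrow> exp_growth (weps \<epsilon>)"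
  by (rule exp_growthI[of _ 1 wrate]) (use weps_bound weps_pos in \<open>auto simp: abs_of_pos\<close>)

definition eps :: "nat \<Rightarrow> real" where
  "eps n = 1 / real (Suc n)"

lemma eps: "0 < eps n" "eps n \<le> 1" and eps_lim: "eps \<longlonglongrightarrow> 0"
  unfolding eps_def using LIMSEQ_inverse_real_of_nat by (auto simp: inverse_eq_divide)

lemma weps_lim: "(\<lambda>n. weps (eps n) x) \<longlonglongrightarrow> weight Rp k x"
proof -
  have "(\<lambda>n. exp (k \<alpha> * ln ((\<alpha> \<bullet> x)\<^sup>2 + eps n))) \<longlonglongrightarrow> (if k \<alpha> = 0 then 1 else \<bar>\<alpha> \<bullet> x\<bar> powr (2 * k \<alpha>))"
    if "\<alpha> \<in> Rp" for \<alpha>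
  proof -
    have "k \<alpha> \<ge> 0" using k_nonneg Rp_root that by blast
    \<comment> \<open>A root with \<open>k \<alpha> = 0\<close> contributes the factor 1 even on its
      hyperplane, where \<open>powr\<close> would give 0. For \<open>k \<alpha> > 0\<close> the
      regularised factor tends to 0 there.\<close>
    then consider "k \<alpha> = 0" | "k \<alpha> > 0" "\<alpha> \<bullet> x = 0" | "k \<alpha> > 0" "\<alpha> \<bullet> x \<noteq> 0"
      by linarith
    then show ?thesis
    proof cases
      case 2
      have "(\<lambda>n. eps n powr k \<alpha>) \<longlonglongrightarrow> 0"
        by (rule tendsto_zero_powrI[OF eps_lim tendsto_const]) (use 2 less_imp_le[OF eps(1)] in auto)
      then show ?thesis using 2 eps(1) by (simp add: powr_def less_imp_neq[symmetric])
    next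
      case 3
      have "(\<lambda>n. exp (k \<alpha> * ln ((\<alpha> \<bullet> x)\<^sup>2 + eps n))) \<longlonglongrightarrow> exp (k \<alpha> * ln ((\<alpha> \<bullet> x)\<^sup>2 + 0))"
        using 3 by (intro tendsto_intros eps_lim) auto
      moreover have "exp (k \<alpha> * ln ((\<alpha> \<bullet> x)\<^sup>2 + 0)) = \<bar>\<alpha> \<bullet> x\<bar> powr (2 * k \<alpha>)"
      proof -
        have "ln ((\<alpha> \<bullet> x)\<^sup>2) = 2 * ln \<bar>\<alpha> \<bullet> x\<bar>"
          using 3 ln_realpow[of "\<bar>\<alpha> \<bullet> x\<bar>" 2] by simp
        then show ?thesis using 3 by (simp add: powr_def mult_ac)
      qed
      ultimately show ?thesis using 3 by simp
    qed simp
  qed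
  then have "(\<lambda>n. \<Prod>\<alpha>\<in>Rp. exp (k \<alpha> * ln ((\<alpha> \<bullet> x)\<^sup>2 + eps n))) \<longlonglongrightarrow> weight Rp k x"
    unfolding weight_def by (rule tendsto_prod)
  then show ?thesis by (simp add: weps_def exp_sum finite_Rp)
qed

lemma weight_measurable [measurable]: "weight Rp k \<in> borel_measurable borel"
  unfolding weight_def[abs_def] by measurable

lemma weight_nonneg: "weight Rp k x \<ge> 0"
  unfolding weight_def by (intro prod_nonneg) auto

lemma weight_bound: "weight Rp k x \<le> exp (wrate * norm x)"
  by (rule LIMSEQ_le_const2[OF weps_lim]) (use weps_bound eps in auto)

lemma exp_growth_weight: "exp_growth (weight Rp k)"
  by (rule exp_growthI[of _ 1 wrate]) (use weight_bound weight_nonneg in auto)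

lemma weight_reflection: "\<beta> \<in> R \<Longrightarrow> weight Rp k (reflection \<beta> x) = weight Rp k x"
  using weps_lim[of "reflection \<beta> x"] weps_lim[of x] LIMSEQ_unique by (simp add: weps_reflection) blast

text \<open>The unnormalised weighted Gaussian integral. The decay \<open>b\<close> stays free
  because \<open>c_k\<close> belongs to \<open>b = 1\<close> and the \<open>k\<close>-Gaussian to
  \<open>b = 1 / (4 t)\<close>.\<close>

definition W :: "real \<Rightarrow> (real^'n \<Rightarrow> real) \<Rightarrow> real" where
  "W b f = (LINT x|lborel. f x * weight Rp k x * gauss b x)"

lemma integrable_W: "exp_growth f \<Longrightarrow> b > 0 \<Longrightarrow> integrable lborel (\<lambda>x. f x * weight Rp k x * gauss b x)"
  by (intro integrable_exp_growth exp_growth_mult exp_growth_weight)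

text \<open>A separate sequence \<open>g\<close> is allowed because integration by parts leaves a
  factor \<open>u^2 / (u^2 + \<epsilon>)\<close>, bounded by 1, that also varies with
  \<open>n\<close>.\<close>

lemma W_lim:
  assumes f: "exp_growth f" and b: "b > 0" and g: "\<And>n. g n \<in> borel_measurable borel"
    and le: "\<And>n x. \<bar>g n x\<bar> \<le> \<bar>f x\<bar>" and lim: "\<And>x. (\<lambda>n. g n x * weps (eps n) x) \<longlonglongrightarrow> f x * weight Rp k x"
  shows "(\<lambda>n. LINT x|lborel. g n x * weps (eps n) x * gauss b x) \<longlonglongrightarrow> W b f"
  unfolding W_def
proof (rule integral_dominated_convergence)
  note [measurable] = exp_growth_measurable[OF f] g
  have "exp_growth (\<lambda>x. \<bar>f x\<bar>)" using f unfolding exp_growth_def by auto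
  moreover have "exp_growth (\<lambda>x::real^'n. exp (wrate * norm x))"
    by (rule exp_growthI[of _ 1 wrate]) auto
  ultimately show "integrable lborel (\<lambda>x. \<bar>f x\<bar> * exp (wrate * norm x) * gauss b x)"
    using b by (intro integrable_exp_growth exp_growth_mult)
  show "(\<lambda>x. f x * weight Rp k x * gauss b x) \<in> borel_measurable lborel" by measurable
  show "(\<lambda>x. g n x * weps (eps n) x * gauss b x) \<in> borel_measurable lborel" for n by measurable
  show "AE x in lborel. (\<lambda>n. g n x * weps (eps n) x * gauss b x)
      \<longlonglongrightarrow> f x * weight Rp k x * gauss b x"
    by (intro AE_I2 tendsto_mult lim tendsto_const)
  show "AE x in lborel. norm (g n x * weps (eps n) x * gauss b x)
      \<le> \<bar>f x\<bar> * exp (wrate * norm x) * gauss b x" for n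
  proof (rule AE_I2)
    fix x
    have "\<bar>g n x\<bar> * weps (eps n) x \<le> \<bar>f x\<bar> * exp (wrate * norm x)"
      using weps_bound[OF eps] less_imp_le[OF weps_pos] le by (intro mult_mono) auto
    then show "norm (g n x * weps (eps n) x * gauss b x)
        \<le> \<bar>f x\<bar> * exp (wrate * norm x) * gauss b x"
      by (simp add: abs_mult weps_pos abs_of_pos)
  qed
qed

lemma W_reflection:
  assumes "f \<in> borel_measurable borel" "\<beta> \<in> R"
  shows "W b (\<lambda>x. f (reflection \<beta> x)) = W b f"
proof -
  note [measurable] = assms(1)
  have "W b f = (LINT x|lborel. f (reflection \<beta> x) * weight Rp k (reflection \<beta> x) * exp (- b * (norm (reflection \<beta> x))\<^sup>2))"
    unfolding W_def
    by (rule integral_reflection[symmetric]) (use assms in \<open>auto simp: root_norm\<close>)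
  also have "\<dots> = W b (\<lambda>x. f (reflection \<beta> x))"
    using assms by (simp add: W_def weight_reflection norm_reflection root_norm)
  finally show ?thesis by simp
qed

lemma weps_has_derivative:
  assumes "\<epsilon> > 0"
  shows "((\<lambda>s. weps \<epsilon> (x + s *\<^sub>R axis i 1)) has_real_derivative
     (weps \<epsilon> x * (\<Sum>\<alpha>\<in>Rp. k \<alpha> * \<alpha> $ i * (2 * (\<alpha> \<bullet> x) / ((\<alpha> \<bullet> x)\<^sup>2 + \<epsilon>))))) (at 0)"
proof -
  have p: "(\<alpha> \<bullet> y)\<^sup>2 + \<epsilon> > 0" for \<alpha> y :: "real^'n" using assms by (simp add: add_nonneg_pos)
  have "((\<lambda>s. k \<alpha> * ln ((\<alpha> \<bullet> (x + s *\<^sub>R axis i 1))\<^sup>2 + \<epsilon>)) has_real_derivative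
      k \<alpha> * \<alpha> $ i * (2 * (\<alpha> \<bullet> x) / ((\<alpha> \<bullet> x)\<^sup>2 + \<epsilon>))) (at 0)" for \<alpha>
    unfolding inner_add_right inner_scaleR_right inner_axis
    using p[of \<alpha> x] by (auto intro!: derivative_eq_intros simp: field_simps)
  then have "((\<lambda>s. \<Sum>\<alpha>\<in>Rp. k \<alpha> * ln ((\<alpha> \<bullet> (x + s *\<^sub>R axis i 1))\<^sup>2 + \<epsilon>)) has_real_derivative
      (\<Sum>\<alpha>\<in>Rp. k \<alpha> * \<alpha> $ i * (2 * (\<alpha> \<bullet> x) / ((\<alpha> \<bullet> x)\<^sup>2 + \<epsilon>)))) (at 0)"
    by (intro DERIV_sum)
  from DERIV_fun_exp[OF this] show ?thesis by (simp add: weps_def)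
qed

lemma gauss_has_derivative:
  "((\<lambda>s. exp (- b * (norm (x + s *\<^sub>R axis i 1))\<^sup>2)) has_real_derivative
     (- 2 * b * x $ i * gauss b x)) (at 0)"
proof -
  have eq: "(norm (x + s *\<^sub>R axis i 1))\<^sup>2 = (norm x)\<^sup>2 + 2 * s * x $ i + s\<^sup>2" for s :: real
    unfolding power2_norm_eq_inner
    by (simp add: inner_simps inner_axis inner_axis' inner_axis_axis power2_eq_square algebra_simps)
  show ?thesis unfolding eq by (auto intro!: derivative_eq_intros)
qed

lemma exp_growth_quotient: "\<epsilon> > 0 \<Longrightarrow> exp_growth (\<lambda>x. (\<alpha> \<bullet> x) / ((\<alpha> \<bullet> x)\<^sup>2 + \<epsilon>))"
proof -
  assume \<epsilon>: "\<epsilon> > 0"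
  have p: "(\<alpha> \<bullet> y)\<^sup>2 + \<epsilon> \<ge> \<epsilon>" for y by simp
  have "exp_growth (\<lambda>x. 1 / ((\<alpha> \<bullet> x)\<^sup>2 + \<epsilon>))"
  proof (rule exp_growth_bounded[of _ "1 / \<epsilon>"])
    fix x
    show "\<bar>1 / ((\<alpha> \<bullet> x)\<^sup>2 + \<epsilon>)\<bar> \<le> 1 / \<epsilon>" using \<epsilon> p[of x] by (simp add: frac_le)
  qed measurable
  from exp_growth_mult[OF exp_growth_pf[OF pf_inner[of \<alpha>]] this] show ?thesis by simp
qed

lemma exp_growth_sum:
  fixes f :: "'i \<Rightarrow> 'a::euclidean_space \<Rightarrow> real"
  assumes "finite I" "\<And>i. i \<in> I \<Longrightarrow> exp_growth (f i)"
  shows "exp_growth (\<lambda>x. \<Sum>i\<in>I. f i x)"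
  using assms by (induction I rule: finite_induct) (auto intro: exp_growth_const exp_growth_add)

text \<open>The derivative of \<open>p\<close> times the regularised density integrates to 0.
  Reflection symmetry then turns the logarithmic derivative of the weight into the difference terms
  of the Dunkl operator, damped by \<open>u^2 / (u^2 + \<epsilon>)\<close> with
  \<open>u = \<alpha> \<bullet> x\<close>.\<close>

lemma weps_integration_by_parts:
  assumes p: "pf p" and b: "b > 0" and \<epsilon>: "0 < \<epsilon>" "\<epsilon> \<le> 1"
  shows "(LINT x|lborel. partial_deriv i p x * weps \<epsilon> x * gauss b x)
    + (\<Sum>\<alpha>\<in>Rp. k \<alpha> * \<alpha> $ i * (LINT x|lborel. ((\<alpha> \<bullet> x)\<^sup>2 / ((\<alpha> \<bullet> x)\<^sup>2 + \<epsilon>) * divdiff \<alpha> p x) * weps \<epsilon> x * gauss b x))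
    = 2 * b * (LINT x|lborel. (x $ i * p x) * weps \<epsilon> x * gauss b x)"
proof -
  let ?g = "\<lambda>x::real^'n. weps \<epsilon> x * gauss b x"
  \<comment> \<open>Half the derivative of \<open>ln (u^2 + \<epsilon>)\<close> at
    \<open>u = \<alpha> \<bullet> x\<close>.\<close>
  define q where "q \<alpha> x = (\<alpha> \<bullet> x) / ((\<alpha> \<bullet> x)\<^sup>2 + \<epsilon>)" for \<alpha> x :: "real^'n"
  have q: "exp_growth (q \<alpha>)" for \<alpha> unfolding q_def[abs_def] by (rule exp_growth_quotient[OF \<epsilon>(1)])
  have int: "integrable lborel (\<lambda>x. f x * ?g x)" if "exp_growth f" for f
    using integrable_exp_growth[OF exp_growth_mult[OF that exp_growth_weps[OF \<epsilon>]] b] by (simp add: mult.assoc)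
  have gp: "exp_growth p" "exp_growth (partial_deriv i p)" "exp_growth (\<lambda>x. x $ i * p x)"
    by (intro exp_growth_pf p pf_partial_deriv pf_mult pf_nth)+
  define G where "G x = (partial_deriv i p x + (\<Sum>\<alpha>\<in>Rp. (2 * k \<alpha> * \<alpha> $ i) * (p x * q \<alpha> x))
      + (- 2 * b) * (x $ i * p x))" for x
  have gs: "exp_growth (\<lambda>x. \<Sum>\<alpha>\<in>Rp. (2 * k \<alpha> * \<alpha> $ i) * (p x * q \<alpha> x))"
    by (intro exp_growth_sum finite_Rp exp_growth_mult[OF exp_growth_const] exp_growth_mult gp q)
  have G: "exp_growth G"
    unfolding G_def[abs_def] by (intro exp_growth_add exp_growth_mult[OF exp_growth_const] gp gs)
  have "(LINT x|lborel. G x * ?g x) = 0"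
  proof (rule integral_partial_derivative_eq_0[where i = i and b = b and G = "\<lambda>x. G x * weps \<epsilon> x" and F = "\<lambda>x. p x * ?g x"])
    fix x
    have "((\<lambda>s. p (x + s *\<^sub>R axis i 1) * ?g (x + s *\<^sub>R axis i 1)) has_real_derivative
       (partial_deriv i p x * ?g x +
        ((weps \<epsilon> x * (\<Sum>\<alpha>\<in>Rp. k \<alpha> * \<alpha> $ i * (2 * (\<alpha> \<bullet> x) / ((\<alpha> \<bullet> x)\<^sup>2 + \<epsilon>)))) * gauss b x
          + (- 2 * b * x $ i * gauss b x) * weps \<epsilon> x) * p x)) (at 0)"
      using DERIV_mult[OF has_partial_deriv[OF p, of x i]
          DERIV_mult[OF weps_has_derivative[OF \<epsilon>(1), of x i] gauss_has_derivative[of b x i]]] by simp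
    moreover have "(\<Sum>\<alpha>\<in>Rp. (2 * k \<alpha> * \<alpha> $ i) * (p x * q \<alpha> x)) = (\<Sum>\<alpha>\<in>Rp. k \<alpha> * \<alpha> $ i * (2 * (\<alpha> \<bullet> x) / ((\<alpha> \<bullet> x)\<^sup>2 + \<epsilon>))) * p x"
      unfolding sum_distrib_right by (intro sum.cong refl) (simp add: q_def)
    ultimately show "((\<lambda>s. p (x + s *\<^sub>R axis i 1) * ?g (x + s *\<^sub>R axis i 1)) has_real_derivative G x * ?g x) (at 0)"
      unfolding G_def by (simp add: algebra_simps)
  qed (use int gp b G exp_growth_weps[OF \<epsilon>] exp_growth_mult in auto)
  moreover have "(LINT x|lborel. G x * ?g x) = (LINT x|lborel. partial_deriv i p x * ?g x)
     + (\<Sum>\<alpha>\<in>Rp. (2 * k \<alpha> * \<alpha> $ i) * (LINT x|lborel. (p x * q \<alpha> x) * ?g x)) - 2 * b * (LINT x|lborel. (x $ i * p x) * ?g x)"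
  proof -
    have "(LINT x|lborel. G x * ?g x) = (LINT x|lborel. partial_deriv i p x * ?g x
        + (\<Sum>\<alpha>\<in>Rp. (2 * k \<alpha> * \<alpha> $ i) * ((p x * q \<alpha> x) * ?g x)) + (- 2 * b) * ((x $ i * p x) * ?g x))"
      unfolding G_def distrib_right sum_distrib_right by (simp add: mult.assoc)
    also have "\<dots> = (LINT x|lborel. partial_deriv i p x * ?g x)
        + (\<Sum>\<alpha>\<in>Rp. LINT x|lborel. (2 * k \<alpha> * \<alpha> $ i) * ((p x * q \<alpha> x) * ?g x)) + (LINT x|lborel. (- 2 * b) * ((x $ i * p x) * ?g x))"
      by (subst Bochner_Integration.integral_add Bochner_Integration.integral_sum;
          (intro Bochner_Integration.integrable_add Bochner_Integration.integrable_sum integrable_mult_right int gp q exp_growth_mult)?)+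
         simp
    finally show ?thesis by simp
  qed
  \<comment> \<open>\<open>q \<alpha>\<close> is odd under the reflection in \<open>\<alpha>\<close>
    and the density is invariant, so symmetrising replaces \<open>2 p\<close> by the difference of
    \<open>p\<close> and its reflection, which is divisible by
    \<open>\<alpha> \<bullet> x\<close>.\<close>
  moreover have "2 * (LINT x|lborel. (p x * q \<alpha> x) * ?g x)
      = (LINT x|lborel. ((\<alpha> \<bullet> x)\<^sup>2 / ((\<alpha> \<bullet> x)\<^sup>2 + \<epsilon>) * divdiff \<alpha> p x) * ?g x)" if \<alpha>: "\<alpha> \<in> Rp" for \<alpha>
  proof -
    have n2: "\<alpha> \<bullet> \<alpha> = 2" and nz: "\<alpha> \<noteq> 0" using \<alpha> by (auto simp: root_norm Rp_root root_nonzero)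
    have pr: "exp_growth (\<lambda>x. p (reflection \<alpha> x))" by (intro exp_growth_pf pf_compose_reflection[OF p])
    have u: "q \<alpha> (reflection \<alpha> x) = - q \<alpha> x" for x
      using n2 by (simp add: q_def reflection_def inner_simps)
    have "(LINT x|lborel. (p x * q \<alpha> x) * ?g x)
        = (LINT x|lborel. (p (reflection \<alpha> x) * q \<alpha> (reflection \<alpha> x)) * ?g (reflection \<alpha> x))"
      by (rule integral_reflection[symmetric, OF _ n2])
         (use exp_growth_measurable[OF exp_growth_mult[OF gp(1) q]] in measurable)
    also have "\<dots> = (LINT x|lborel. - ((p (reflection \<alpha> x) * q \<alpha> x) * ?g x))"
      using \<alpha> n2 by (simp add: u weps_reflection Rp_root norm_reflection)
    finally have "2 * (LINT x|lborel. (p x * q \<alpha> x) * ?g x)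
        = (LINT x|lborel. (p x * q \<alpha> x) * ?g x) - (LINT x|lborel. (p (reflection \<alpha> x) * q \<alpha> x) * ?g x)"
      by simp
    also have "\<dots> = (LINT x|lborel. (p x * q \<alpha> x) * ?g x - (p (reflection \<alpha> x) * q \<alpha> x) * ?g x)"
      by (rule Bochner_Integration.integral_diff[symmetric]; intro int exp_growth_mult gp q pr)
    also have "\<dots> = (LINT x|lborel. ((\<alpha> \<bullet> x)\<^sup>2 / ((\<alpha> \<bullet> x)\<^sup>2 + \<epsilon>) * divdiff \<alpha> p x) * ?g x)"
    proof (intro Bochner_Integration.integral_cong refl)
      fix x
      have "(p x * q \<alpha> x) * ?g x - (p (reflection \<alpha> x) * q \<alpha> x) * ?g x = ((p x - p (reflection \<alpha> x)) * q \<alpha> x) * ?g x"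
        by (simp add: algebra_simps)
      also have "(p x - p (reflection \<alpha> x)) * q \<alpha> x = (\<alpha> \<bullet> x)\<^sup>2 / ((\<alpha> \<bullet> x)\<^sup>2 + \<epsilon>) * divdiff \<alpha> p x"
        unfolding divdiff_mult[OF p nz, of x] q_def by (simp add: power2_eq_square)
      finally show "(p x * q \<alpha> x) * ?g x - (p (reflection \<alpha> x) * q \<alpha> x) * ?g x
          = ((\<alpha> \<bullet> x)\<^sup>2 / ((\<alpha> \<bullet> x)\<^sup>2 + \<epsilon>) * divdiff \<alpha> p x) * ?g x" .
    qed
    finally show ?thesis .
  qed
  then have "(\<Sum>\<alpha>\<in>Rp. (2 * k \<alpha> * \<alpha> $ i) * (LINT x|lborel. (p x * q \<alpha> x) * ?g x))
    = (\<Sum>\<alpha>\<in>Rp. k \<alpha> * \<alpha> $ i * (LINT x|lborel. ((\<alpha> \<bullet> x)\<^sup>2 / ((\<alpha> \<bullet> x)\<^sup>2 + \<epsilon>) * divdiff \<alpha> p x) * ?g x))"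
    by (intro sum.cong refl) (simp add: mult_ac)
  ultimately show ?thesis by (simp add: mult.assoc)
qed

section \<open>Adjoints of Dunkl operators under the weighted Gaussian integral\<close>

lemma W_add: "exp_growth f \<Longrightarrow> exp_growth g \<Longrightarrow> b > 0 \<Longrightarrow> W b (\<lambda>x. f x + g x) = W b f + W b g"
  unfolding W_def distrib_right by (intro Bochner_Integration.integral_add integrable_W)

lemma W_cmult: "W b (\<lambda>x. c * f x) = c * W b f"
  unfolding W_def mult.assoc by simp

lemma W_sum:
  assumes "finite I" "\<And>i. i \<in> I \<Longrightarrow> exp_growth (f i)" "b > 0"
  shows "W b (\<lambda>x. \<Sum>i\<in>I. f i x) = (\<Sum>i\<in>I. W b (f i))"
  using assms
proof (induction I rule: finite_induct)
  case (insert a I)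
  then show ?case by (simp add: W_add exp_growth_sum)
qed (simp add: W_def)

lemma W_T:
  assumes p: "pf p" and b: "b > 0"
  shows "W b (T i p) = 2 * b * W b (\<lambda>x. x $ i * p x)"
proof -
  have gp: "exp_growth (partial_deriv i p)" "exp_growth (\<lambda>x. x $ i * p x)"
    by (intro exp_growth_pf p pf_partial_deriv pf_mult pf_nth)+
  have gd: "exp_growth (divdiff \<alpha> p)" if "\<alpha> \<in> Rp" for \<alpha>
    by (intro exp_growth_pf pf_divdiff p root_nonzero Rp_root that)
  define A where "A n = (LINT x|lborel. partial_deriv i p x * weps (eps n) x * gauss b x)" for n
  define D where "D n \<alpha> = (LINT x|lborel. ((\<alpha> \<bullet> x)\<^sup>2 / ((\<alpha> \<bullet> x)\<^sup>2 + eps n) * divdiff \<alpha> p x) * weps (eps n) x * gauss b x)" for n \<alpha>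
  define C where "C n = (LINT x|lborel. (x $ i * p x) * weps (eps n) x * gauss b x)" for n
  have A: "A \<longlonglongrightarrow> W b (partial_deriv i p)"
    unfolding A_def
    by (rule W_lim[OF gp(1) b]) (auto intro: exp_growth_measurable gp tendsto_mult weps_lim)
  have C: "C \<longlonglongrightarrow> W b (\<lambda>x. x $ i * p x)"
    unfolding C_def
    by (rule W_lim[OF gp(2) b]) (auto intro: exp_growth_measurable gp tendsto_mult weps_lim)
  have D: "(\<lambda>n. k \<alpha> * \<alpha> $ i * D n \<alpha>) \<longlonglongrightarrow> k \<alpha> * \<alpha> $ i * W b (divdiff \<alpha> p)" if \<alpha>: "\<alpha> \<in> Rp" for \<alpha>
  \<comment> \<open>For \<open>k \<alpha> = 0\<close> the summand is 0. It is split off because the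
    weight need not vanish on that hyperplane, where the damping factor stays 0 instead of tending
    to 1.\<close>
  proof (cases "k \<alpha> = 0")
    case False
    note [measurable] = exp_growth_measurable[OF gd[OF \<alpha>]]
    have "(\<lambda>n. D n \<alpha>) \<longlonglongrightarrow> W b (divdiff \<alpha> p)"
      unfolding D_def
    proof (rule W_lim[OF gd[OF \<alpha>] b])
      show "(\<lambda>x. (\<alpha> \<bullet> x)\<^sup>2 / ((\<alpha> \<bullet> x)\<^sup>2 + eps n) * divdiff \<alpha> p x) \<in> borel_measurable borel" for n
        by measurable
      show "\<bar>(\<alpha> \<bullet> x)\<^sup>2 / ((\<alpha> \<bullet> x)\<^sup>2 + eps n) * divdiff \<alpha> p x\<bar> \<le> \<bar>divdiff \<alpha> p x\<bar>" for n x
      proof -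
        have "(\<alpha> \<bullet> x)\<^sup>2 + eps n > 0" using eps(1)[of n] by (simp add: add_nonneg_pos)
        then have "0 \<le> (\<alpha> \<bullet> x)\<^sup>2 / ((\<alpha> \<bullet> x)\<^sup>2 + eps n)" "(\<alpha> \<bullet> x)\<^sup>2 / ((\<alpha> \<bullet> x)\<^sup>2 + eps n) \<le> 1"
          using eps(1)[of n] by auto
        then show ?thesis
          using mult_left_le_one_le[of "\<bar>divdiff \<alpha> p x\<bar>"] unfolding abs_mult by (metis abs_ge_zero abs_of_nonneg)
      qed
      fix x
      show "(\<lambda>n. (\<alpha> \<bullet> x)\<^sup>2 / ((\<alpha> \<bullet> x)\<^sup>2 + eps n) * divdiff \<alpha> p x * weps (eps n) x)
          \<longlonglongrightarrow> divdiff \<alpha> p x * weight Rp k x"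
      proof (cases "\<alpha> \<bullet> x = 0")
        case True
        then have "weight Rp k x = 0"
          unfolding weight_def using \<alpha> False finite_Rp by (intro prod_zero) auto
        then show ?thesis using True by simp
      next
        case False
        have "(\<lambda>n. (\<alpha> \<bullet> x)\<^sup>2 / ((\<alpha> \<bullet> x)\<^sup>2 + eps n) * divdiff \<alpha> p x * weps (eps n) x)
          \<longlonglongrightarrow> (\<alpha> \<bullet> x)\<^sup>2 / ((\<alpha> \<bullet> x)\<^sup>2 + 0) * divdiff \<alpha> p x * weight Rp k x"
          using False by (intro tendsto_intros eps_lim weps_lim) auto
        then show ?thesis using False by simp
      qed
    qed
    then show ?thesis by (intro tendsto_mult tendsto_const)
  qed simp
  have "(\<lambda>n. A n + (\<Sum>\<alpha>\<in>Rp. k \<alpha> * \<alpha> $ i * D n \<alpha>))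
      \<longlonglongrightarrow> W b (partial_deriv i p) + (\<Sum>\<alpha>\<in>Rp. k \<alpha> * \<alpha> $ i * W b (divdiff \<alpha> p))"
    by (intro tendsto_add A tendsto_sum D)
  moreover have "A n + (\<Sum>\<alpha>\<in>Rp. k \<alpha> * \<alpha> $ i * D n \<alpha>) = 2 * b * C n" for n
    unfolding A_def C_def D_def by (rule weps_integration_by_parts[OF p b eps])
  ultimately have "(\<lambda>n. 2 * b * C n) \<longlonglongrightarrow> W b (partial_deriv i p) + (\<Sum>\<alpha>\<in>Rp. k \<alpha> * \<alpha> $ i * W b (divdiff \<alpha> p))"
    by simp
  moreover have "(\<lambda>n. 2 * b * C n) \<longlonglongrightarrow> 2 * b * W b (\<lambda>x. x $ i * p x)"
    by (intro tendsto_mult tendsto_const C)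
  ultimately have "W b (partial_deriv i p) + (\<Sum>\<alpha>\<in>Rp. k \<alpha> * \<alpha> $ i * W b (divdiff \<alpha> p)) = 2 * b * W b (\<lambda>x. x $ i * p x)"
    by (rule LIMSEQ_unique)
  moreover have "W b (T i p) = W b (partial_deriv i p) + (\<Sum>\<alpha>\<in>Rp. W b (\<lambda>x. (k \<alpha> * \<alpha> $ i) * divdiff \<alpha> p x))"
    unfolding T_def[abs_def]
    using W_add[OF gp(1) exp_growth_sum[of Rp "\<lambda>\<alpha> x. k \<alpha> * \<alpha> $ i * divdiff \<alpha> p x"] b]
      W_sum[of Rp "\<lambda>\<alpha> x. k \<alpha> * \<alpha> $ i * divdiff \<alpha> p x" b]
    by (simp add: finite_Rp gd b exp_growth_mult[OF exp_growth_const])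
  ultimately show ?thesis by (simp add: W_cmult)
qed

text \<open>\<open>W_T\<close> applied to the product of \<open>f\<close> and \<open>g\<close>. The
  Leibniz defects \<open>h \<alpha>\<close> are odd under reflections that preserve the measure, so
  they integrate to 0.\<close>

lemma W_T_adjoint:
  assumes f: "pf f" and g: "pf g" and b: "b > 0"
  shows "W b (\<lambda>x. T i f x * g x) + W b (\<lambda>x. f x * T i g x) = 2 * b * W b (\<lambda>x. x $ i * (f x * g x))"
proof -
  have fg: "pf (\<lambda>x. f x * g x)" using f g by (rule pf_mult)
  have nz: "\<alpha> \<noteq> 0" if "\<alpha> \<in> Rp" for \<alpha> using that by (simp add: root_nonzero Rp_root)
  define h where "h \<alpha> x = (\<alpha> \<bullet> x) * (divdiff \<alpha> f x * divdiff \<alpha> g x)" for \<alpha> x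
  have pfh: "pf (h \<alpha>)" if "\<alpha> \<in> Rp" for \<alpha>
    unfolding h_def[abs_def] by (intro pf_mult pf_inner pf_divdiff f g nz that)
  have Wh: "W b (h \<alpha>) = 0" if \<alpha>: "\<alpha> \<in> Rp" for \<alpha>
  proof -
    have n2: "\<alpha> \<bullet> \<alpha> = 2" using \<alpha> by (simp add: root_norm Rp_root)
    have "(\<lambda>x. h \<alpha> (reflection \<alpha> x)) = (\<lambda>x. (-1) * h \<alpha> x)"
      unfolding h_def using n2
      by (simp add: divdiff_reflection f g) (simp add: reflection_def inner_simps)
    then have "W b (h \<alpha>) = (-1) * W b (h \<alpha>)"
      using W_reflection[OF pf_borel[OF pfh[OF \<alpha>]] Rp_root[OF \<alpha>], of b] W_cmult[of b "-1" "h \<alpha>"] by simp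
    then show ?thesis by simp
  qed
  have "T i f x * g x + f x * T i g x = T i (\<lambda>x. f x * g x) x + (\<Sum>\<alpha>\<in>Rp. (k \<alpha> * \<alpha> $ i) * h \<alpha> x)" for x
  proof -
    have "(\<Sum>\<alpha>\<in>Rp. k \<alpha> * \<alpha> $ i * divdiff \<alpha> f x) * g x + f x * (\<Sum>\<alpha>\<in>Rp. k \<alpha> * \<alpha> $ i * divdiff \<alpha> g x)
      = (\<Sum>\<alpha>\<in>Rp. (k \<alpha> * \<alpha> $ i) * (divdiff \<alpha> f x * g x + f x * divdiff \<alpha> g x))"
      unfolding sum_distrib_left sum_distrib_right sum.distrib[symmetric]
      by (intro sum.cong refl) (simp add: algebra_simps)
    also have "\<dots> = (\<Sum>\<alpha>\<in>Rp. (k \<alpha> * \<alpha> $ i) * (divdiff \<alpha> (\<lambda>x. f x * g x) x + h \<alpha> x))"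
      by (intro sum.cong refl) (simp add: h_def divdiff_product f g nz)
    also have "\<dots> = (\<Sum>\<alpha>\<in>Rp. k \<alpha> * \<alpha> $ i * divdiff \<alpha> (\<lambda>x. f x * g x) x) + (\<Sum>\<alpha>\<in>Rp. (k \<alpha> * \<alpha> $ i) * h \<alpha> x)"
      unfolding sum.distrib[symmetric] by (simp add: distrib_left)
    finally show ?thesis
      unfolding T_def partial_deriv_mult[OF f g] by (simp add: algebra_simps)
  qed
  then have "(\<lambda>x. T i f x * g x + f x * T i g x) = (\<lambda>x. T i (\<lambda>x. f x * g x) x + (\<Sum>\<alpha>\<in>Rp. (k \<alpha> * \<alpha> $ i) * h \<alpha> x))"
    by blast
  then have "W b (\<lambda>x. T i f x * g x + f x * T i g x) = W b (\<lambda>x. T i (\<lambda>x. f x * g x) x + (\<Sum>\<alpha>\<in>Rp. (k \<alpha> * \<alpha> $ i) * h \<alpha> x))"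
    by simp
  moreover have "W b (\<lambda>x. T i f x * g x + f x * T i g x) = W b (\<lambda>x. T i f x * g x) + W b (\<lambda>x. f x * T i g x)"
    using b by (intro W_add exp_growth_pf pf_mult pf_T f g)
  moreover have "W b (\<lambda>x. T i (\<lambda>x. f x * g x) x + (\<Sum>\<alpha>\<in>Rp. (k \<alpha> * \<alpha> $ i) * h \<alpha> x))
     = W b (T i (\<lambda>x. f x * g x)) + W b (\<lambda>x. \<Sum>\<alpha>\<in>Rp. (k \<alpha> * \<alpha> $ i) * h \<alpha> x)"
    using b by (intro W_add exp_growth_pf pf_T fg pf_sum pf_cmult pfh finite_Rp)
  moreover have "W b (\<lambda>x. \<Sum>\<alpha>\<in>Rp. (k \<alpha> * \<alpha> $ i) * h \<alpha> x) = 0"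
    using b by (subst W_sum) (auto intro!: finite_Rp exp_growth_pf pf_cmult pfh simp: W_cmult Wh)
  ultimately show ?thesis using W_T[OF fg b, of i] by simp
qed

section \<open>Scaling and positivity of the total mass\<close>

lemma weight_scaleR: "s > 0 \<Longrightarrow> weight Rp k (s *\<^sub>R x) = s powr (2 * gamma_k Rp k) * weight Rp k x"
proof -
  assume s: "s > 0"
  have "weight Rp k (s *\<^sub>R x) = (\<Prod>\<alpha>\<in>Rp. s powr (2 * k \<alpha>) * (if k \<alpha> = 0 then 1 else \<bar>\<alpha> \<bullet> x\<bar> powr (2 * k \<alpha>)))"
    unfolding weight_def using s by (intro prod.cong refl) (auto simp: abs_mult powr_mult)
  also have "\<dots> = s powr (2 * gamma_k Rp k) * weight Rp k x"
    unfolding prod.distrib weight_def gamma_k_def using s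
    by (simp add: powr_sum[symmetric] sum_distrib_left finite_Rp)
  finally show ?thesis .
qed

text \<open>Substitution by \<open>sqrt (4 t)\<close>: the weight is homogeneous of degree
  \<open>2 * gamma_k Rp k\<close> and the volume of degree \<open>CARD('n)\<close>. This matches the
  power of \<open>4 t\<close> in \<open>gauss_density\<close>.\<close>

lemma W_one_scale:
  assumes "t > 0"
  shows "W (1 / (4 * t)) (\<lambda>x. 1) = (4 * t) powr (gamma_k Rp k + real CARD('n) / 2) * W 1 (\<lambda>x. 1)"
proof -
  define s where "s = sqrt (4 * t)"
  have s: "s > 0" "s\<^sup>2 = 4 * t" using assms by (auto simp: s_def)
  let ?f = "\<lambda>x. weight Rp k x * exp (- (1 / (4 * t)) * (norm x)\<^sup>2)"
  have "W (1 / (4 * t)) (\<lambda>x. 1) = integral\<^sup>L lborel ?f" by (simp add: W_def)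
  also have "\<dots> = integral\<^sup>L (density (distr lborel borel (\<lambda>x. 0 + s *\<^sub>R x)) (\<lambda>_. \<bar>s\<bar> ^ DIM(real^'n))) ?f"
    using lborel_affine[of s "0::real^'n"] s by simp
  also have "\<dots> = integral\<^sup>L (distr lborel borel (\<lambda>x. 0 + s *\<^sub>R x)) (\<lambda>x. s ^ CARD('n) *\<^sub>R ?f x)"
    using s by (subst integral_density) (auto simp: ennreal_power)
  also have "\<dots> = (LINT x|lborel. s ^ CARD('n) *\<^sub>R ?f (0 + s *\<^sub>R x))"
    by (rule integral_distr) auto
  also have "\<dots> = (LINT x|lborel. (s ^ CARD('n) * s powr (2 * gamma_k Rp k)) * (1 * weight Rp k x * exp (- 1 * (norm x)\<^sup>2)))"
  proof (intro Bochner_Integration.integral_cong refl)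
    fix x :: "real^'n"
    have "(1 / (4 * t)) * (norm (s *\<^sub>R x))\<^sup>2 = (norm x)\<^sup>2"
      using s assms by (simp add: power_mult_distrib)
    then show "s ^ CARD('n) *\<^sub>R ?f (0 + s *\<^sub>R x)
        = (s ^ CARD('n) * s powr (2 * gamma_k Rp k)) * (1 * weight Rp k x * exp (- 1 * (norm x)\<^sup>2))"
      using weight_scaleR[OF s(1), of x] by simp
  qed
  also have "\<dots> = (s ^ CARD('n) * s powr (2 * gamma_k Rp k)) * W 1 (\<lambda>x. 1)"
    unfolding W_def by simp
  also have "s ^ CARD('n) * s powr (2 * gamma_k Rp k) = s powr (2 * (gamma_k Rp k + real CARD('n) / 2))"
  proof -
    have "2 * (gamma_k Rp k + real CARD('n) / 2) = real CARD('n) + 2 * gamma_k Rp k" by simp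
    then show ?thesis using powr_realpow[OF s(1), of "CARD('n)"] powr_add[of s "real CARD('n)"] by metis
  qed
  also have "\<dots> = (s powr 2) powr (gamma_k Rp k + real CARD('n) / 2)" by (simp add: powr_powr)
  also have "s powr 2 = 4 * t" using s by simp
  finally show ?thesis .
qed

text \<open>The integrand is nonnegative and can vanish only on finitely many hyperplanes, which
  form a null set.\<close>

lemma W_one_pos: "b > 0 \<Longrightarrow> W b (\<lambda>x. 1) > 0"
proof -
  assume b: "b > 0"
  let ?f = "\<lambda>x. 1 * weight Rp k x * gauss b x"
  have nn: "W b (\<lambda>x. 1) \<ge> 0" unfolding W_def by (intro integral_nonneg_AE) (simp add: weight_nonneg)
  have "W b (\<lambda>x. 1) \<noteq> 0"
  proof
    assume "W b (\<lambda>x. 1) = 0"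
    then have "AE x in lborel. ?f x = 0"
      unfolding W_def using integral_nonneg_eq_0_iff_AE[OF integrable_W[OF exp_growth_const[of 1] b]]
      by (simp add: weight_nonneg)
    moreover have "AE x in lborel. \<forall>\<alpha>\<in>Rp. \<alpha> \<bullet> x \<noteq> 0"
      unfolding AE_finite_all[OF finite_Rp]
    proof
      fix \<alpha> assume "\<alpha> \<in> Rp"
      then have "{x. \<alpha> \<bullet> x = 0} \<in> null_sets lebesgue"
        using negligible_hyperplane[of \<alpha> 0] by (simp add: negligible_iff_null_sets root_nonzero Rp_root)
      then have "{x. \<alpha> \<bullet> x = 0} \<in> null_sets lborel"
        by (subst (asm) null_sets_completion_iff) auto
      then show "AE x in lborel. \<alpha> \<bullet> x \<noteq> 0" by (rule AE_I'[of "{x. \<alpha> \<bullet> x = 0}"]) auto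
    qed
    ultimately have "AE x in (lborel :: (real^'n) measure). False"
    proof eventually_elim
      case (elim x)
      then have "weight Rp k x = 0" by simp
      then show False using elim(2) finite_Rp unfolding weight_def by (auto simp: prod_zero_iff split: if_splits)
    qed
    then show False by (simp add: AE_iff_null null_sets_def)
  qed
  then show ?thesis using nn by simp
qed

end

section \<open>Summation over multi-indices by degree\<close>

lemma bij_betw_mdeg_levels:
  "bij_betw snd (SIGMA n:UNIV. {\<kappa>::'n::finite \<Rightarrow> nat. mdeg \<kappa> = n}) UNIV"
  by (auto simp: bij_betw_def inj_on_def image_iff)

text \<open>Kernel and cocharacters are defined by unordered sums, whereas exponentials and Cauchy
  products are handled as series in the degree; this and the next lemma pass between the
  two.\<close>

lemma has_sum_imp_sums_levels:
  fixes f :: "('n::finite \<Rightarrow> nat) \<Rightarrow> real"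
  assumes "(f has_sum s) UNIV"
  shows "(\<lambda>n. \<Sum>\<kappa> | mdeg \<kappa> = n. f \<kappa>) sums s"
proof -
  have "((\<lambda>z. f (snd z)) has_sum s) (SIGMA n:UNIV. {\<kappa>. mdeg \<kappa> = n})"
    using assms has_sum_reindex_bij_betw[OF bij_betw_mdeg_levels, of f s] by simp
  then have "((\<lambda>n. \<Sum>\<kappa> | mdeg \<kappa> = n. f \<kappa>) has_sum s) UNIV"
    by (rule has_sum_SigmaD) (auto intro!: has_sum_finiteI)
  then show ?thesis by (rule has_sum_imp_sums)
qed

lemma has_sum_levelsI:
  fixes f :: "('n::finite \<Rightarrow> nat) \<Rightarrow> real"
  assumes abs: "summable (\<lambda>n. \<Sum>\<kappa> | mdeg \<kappa> = n. \<bar>f \<kappa>\<bar>)"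
    and s: "(\<lambda>n. \<Sum>\<kappa> | mdeg \<kappa> = n. f \<kappa>) sums s"
  shows "(f has_sum s) UNIV"
proof -
  have "((\<lambda>z. f (snd z)) has_sum s) (SIGMA n:UNIV. {\<kappa>. mdeg \<kappa> = n})"
  proof (rule has_sum_SigmaI)
    show "((\<lambda>\<kappa>. f (snd (n, \<kappa>))) has_sum (\<Sum>\<kappa> | mdeg \<kappa> = n. f \<kappa>)) {\<kappa>. mdeg \<kappa> = n}" for n
      by (auto intro!: has_sum_finiteI)
    have "summable (\<lambda>n. norm (\<Sum>\<kappa> | mdeg \<kappa> = n. f \<kappa>))"
      by (rule summable_comparison_test'[OF abs, of 0]) (auto intro: sum_abs)
    then show "((\<lambda>n. \<Sum>\<kappa> | mdeg \<kappa> = n. f \<kappa>) has_sum s) UNIV"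
      using s by (rule norm_summable_imp_has_sum)
    have "(\<lambda>z. norm (f (snd z))) summable_on (SIGMA n:UNIV. {\<kappa>. mdeg \<kappa> = n})"
      unfolding Infinite_Sum.abs_summable_on_Sigma_iff[of "\<lambda>z. f (snd z)"]
    proof (intro conjI ballI)
      have "summable (\<lambda>n. norm (norm (\<Sum>\<kappa> | mdeg \<kappa> = n. \<bar>f \<kappa>\<bar>)))"
        using abs by (simp add: sum_nonneg)
      then show "(\<lambda>n. norm (\<Sum>\<^sub>\<infinity>\<kappa>\<in>{\<kappa>. mdeg \<kappa> = n}. norm (f (snd (n, \<kappa>))))) summable_on UNIV"
        by (simp add: norm_summable_imp_summable_on)
    qed simp
    then show "(\<lambda>z. f (snd z)) summable_on (SIGMA n:UNIV. {\<kappa>. mdeg \<kappa> = n})"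
      by (rule abs_summable_summable)
  qed
  then show ?thesis
    using has_sum_reindex_bij_betw[OF bij_betw_mdeg_levels, of f s] by simp
qed

text \<open>Once the lower coefficients vanish, dividing by \<open>x ^ n\<close> leaves a power
  series that is 0 off the origin and whose limit at 0 is the next coefficient.\<close>

lemma powser_sums_zero_imp_zero:
  fixes a :: "nat \<Rightarrow> real"
  assumes "\<And>x. (\<lambda>n. a n * x ^ n) sums 0"
  shows "a n = 0"
proof (induction n rule: less_induct)
  case (less n)
  have "((\<lambda>x. 0) \<longlongrightarrow> (\<lambda>l. a (l + n)) 0) (at (0::real))"
  proof (rule powser_limit_0_strong[of 1])
    fix x :: real assume "x \<noteq> 0"
    have "(\<lambda>l. a (l + n) * x ^ (l + n)) sums 0"
      using sums_split_initial_segment[OF assms[of x], of n] less by simp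
    then have "(\<lambda>l. (a (l + n) * x ^ (l + n)) / x ^ n) sums (0 / x ^ n)" by (rule sums_divide)
    then show "(\<lambda>l. a (l + n) * x ^ l) sums 0" using \<open>x \<noteq> 0\<close> by (simp add: power_add)
  qed simp
  then show ?case by (simp add: tendsto_const_iff)
qed

text \<open>An ordinary Cauchy product after placing \<open>\<alpha>\<close> on the even indices.
  The Gaussian factor and the powers of the Laplacian both move in steps of two degrees.\<close>

lemma Cauchy_product_double:
  fixes \<alpha> \<beta> :: "nat \<Rightarrow> real"
  assumes \<alpha>: "summable (\<lambda>j. \<bar>\<alpha> j\<bar>)" and \<beta>: "summable (\<lambda>j. \<bar>\<beta> j\<bar>)"
  shows "(\<lambda>n. \<Sum>j\<le>n. if 2 * j \<le> n then \<alpha> j * \<beta> (n - 2 * j) else 0) sums ((\<Sum>j. \<alpha> j) * (\<Sum>j. \<beta> j))"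
proof -
  define A where "A i = (if even i then \<alpha> (i div 2) else 0)" for i
  have A: "(\<lambda>i. \<bar>A i\<bar>) sums (\<Sum>j. \<bar>\<alpha> j\<bar>)" "A sums (\<Sum>j. \<alpha> j)"
  proof -
    have sm: "strict_mono (\<lambda>j::nat. 2 * j)" by (simp add: strict_mono_def)
    have "A i = 0" if "i \<notin> range (\<lambda>j::nat. 2 * j)" for i
      using that by (auto simp: A_def elim!: evenE)
    then have z: "A i = 0" "\<bar>A i\<bar> = 0" if "i \<notin> range (\<lambda>j::nat. 2 * j)" for i using that by auto
    show "A sums (\<Sum>j. \<alpha> j)"
      using sums_mono_reindex[where f = A, OF sm z(1)] summable_sums[OF summable_rabs_cancel[OF \<alpha>]]
      by (simp add: A_def)
    show "(\<lambda>i. \<bar>A i\<bar>) sums (\<Sum>j. \<bar>\<alpha> j\<bar>)"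
      using sums_mono_reindex[where f = "\<lambda>i. \<bar>A i\<bar>", OF sm z(2)] summable_sums[OF \<alpha>] by (simp add: A_def)
  qed
  have "(\<lambda>n. \<Sum>i\<le>n. A i * \<beta> (n - i)) sums ((\<Sum>i. A i) * (\<Sum>j. \<beta> j))"
    using A(1) \<beta> by (intro Cauchy_product_sums) (auto simp: sums_iff)
  moreover have "(\<Sum>i\<le>n. A i * \<beta> (n - i)) = (\<Sum>j\<le>n. if 2 * j \<le> n then \<alpha> j * \<beta> (n - 2 * j) else 0)" for n
  proof -
    have "(\<Sum>i\<le>n. A i * \<beta> (n - i)) = (\<Sum>i\<in>(\<lambda>j. 2 * j) ` {j. 2 * j \<le> n}. A i * \<beta> (n - i))"
      by (rule sum.mono_neutral_right) (auto simp: A_def elim!: evenE)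
    also have "\<dots> = (\<Sum>j | 2 * j \<le> n. \<alpha> j * \<beta> (n - 2 * j))"
      by (subst sum.reindex) (auto simp: inj_on_def A_def)
    also have "\<dots> = (\<Sum>j\<le>n. if 2 * j \<le> n then \<alpha> j * \<beta> (n - 2 * j) else 0)"
      by (rule sum.mono_neutral_cong_left) auto
    finally show ?thesis .
  qed
  ultimately show ?thesis using A(2) by (simp add: sums_iff)
qed

section \<open>Gaussian moments\<close>

text \<open>The one-variable \<open>a_coef\<close>: \<open>hcoef t n / fact n\<close> are the Taylor
  coefficients of \<open>exp (- t z^2)\<close>.\<close>

definition hcoef :: "real \<Rightarrow> nat \<Rightarrow> real" where
  "hcoef t n = (if even n then fact n / fact (n div 2) * (- t) ^ (n div 2) else 0)"

lemma a_coef_eq_prod: "a_coef t \<kappa> = (\<Prod>i\<in>UNIV. hcoef t (\<kappa> i))"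
proof (cases "\<forall>i. even (\<kappa> i)")
  case True
  then show ?thesis
    by (simp add: a_coef_def hcoef_def mfact_def mdeg_def prod.distrib prod_dividef power_sum)
next
  case False
  then obtain i where "odd (\<kappa> i)" by blast
  then have "(\<Prod>i\<in>UNIV. hcoef t (\<kappa> i)) = 0" by (intro prod_zero) (auto simp: hcoef_def)
  then show ?thesis unfolding a_coef_def by (simp only: if_not_P[OF False])
qed

text \<open>Comparison of coefficients in \<open>f' = - 2 t z f\<close> for
  \<open>f = exp (- t z^2)\<close>. The factors \<open>n\<close> and \<open>n - 1\<close> make it
  hold at 0 and 1 too, where \<open>n - 2\<close> is truncated.\<close>

lemma hcoef_rec: "real n * hcoef t n = - 2 * t * (real n * real (n - 1) * hcoef t (n - 2))"
proof -
  consider "n = 0" | "n = 1" | l where "n = l + 2" by (metis One_nat_def add_2_eq_Suc' not0_implies_Suc)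
  then show ?thesis
  proof cases
    case 3
    show ?thesis
    proof (cases "even l")
      case True
      then obtain r where r: "l = 2 * r" by (elim evenE)
      have f1: "fact n = real n * real (n - 1) * fact l"
        using 3 by (simp add: numeral_2_eq_2)
      have f2: "fact (n div 2) = real (Suc r) * fact r" "(- t) ^ (n div 2) = - t * (- t) ^ r"
        using 3 r by auto
      have n: "real n = 2 * real (Suc r)" using 3 r by simp
      have "hcoef t n = real n * real (n - 1) * fact l / (real (Suc r) * fact r) * (- t * (- t) ^ r)"
        unfolding hcoef_def f1 f2 using 3 True by simp
      also have "\<dots> = - 2 * t * (real (n - 1) * (fact l / fact r * (- t) ^ r))"
        unfolding n by (simp del: of_nat_Suc)
      also have "fact l / fact r * (- t) ^ r = hcoef t (n - 2)" using 3 r by (simp add: hcoef_def)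
      finally show ?thesis by simp
    next
      case False
      then show ?thesis using 3 by (simp add: hcoef_def)
    qed
  qed (auto simp: hcoef_def)
qed

lemma a_coef_rec:
  "real (\<kappa> i) * a_coef t \<kappa> = - 2 * t * (real (\<kappa> i) * real (\<kappa> i - 1) * a_coef t (\<kappa>(i := \<kappa> i - 2)))"
proof -
  have "a_coef t \<kappa> = hcoef t (\<kappa> i) * (\<Prod>j\<in>UNIV - {i}. hcoef t (\<kappa> j))"
    unfolding a_coef_eq_prod by (rule prod_remove_UNIV)
  moreover have "a_coef t (\<kappa>(i := \<kappa> i - 2)) = hcoef t (\<kappa> i - 2) * (\<Prod>j\<in>UNIV - {i}. hcoef t (\<kappa> j))"
    unfolding a_coef_eq_prod by (rule prod_fun_upd_UNIV)
  ultimately show ?thesis using hcoef_rec[of "\<kappa> i" t] by (simp add: mult.assoc[symmetric])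
qed

text \<open>The coefficients of \<open>exp (- t z^2)\<close> times \<open>exp (t z^2)\<close>, which
  is 1. For even \<open>n\<close> this is the binomial expansion of a power of
  \<open>t - t\<close>.\<close>

lemma hcoef_convolution:
  "(\<Sum>r\<le>n. real (n choose r) * hcoef t (n - r) * hcoef (- t) r) = (if n = 0 then 1 else 0)"
proof (cases "even n")
  case False
  then have "n \<noteq> 0" by (metis even_zero)
  moreover have "real (n choose r) * hcoef t (n - r) * hcoef (- t) r = 0" if "r \<le> n" for r
    using that False by (auto simp: hcoef_def)
  ultimately show ?thesis by (simp add: sum.neutral)
next
  case True
  then obtain M where M: "n = 2 * M" by (elim evenE)
  have "(\<Sum>r\<le>n. real (n choose r) * hcoef t (n - r) * hcoef (- t) r)
     = (\<Sum>r\<in>(\<lambda>l. 2 * l) ` {..M}. real (n choose r) * hcoef t (n - r) * hcoef (- t) r)"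
    by (rule sum.mono_neutral_right) (auto simp: M hcoef_def elim!: evenE)
  also have "\<dots> = (\<Sum>l\<le>M. real (n choose (2 * l)) * hcoef t (n - 2 * l) * hcoef (- t) (2 * l))"
    by (subst sum.reindex) (auto simp: inj_on_def)
  also have "\<dots> = (\<Sum>l\<le>M. (fact n / fact M) * (real (M choose l) * t ^ l * (- t) ^ (M - l)))"
  proof (intro sum.cong refl)
    fix l assume "l \<in> {..M}"
    then have l: "l \<le> M" by simp
    have d: "n - 2 * l = 2 * (M - l)" using M by simp
    have b1: "real (n choose (2 * l)) = fact n / (fact (2 * l) * fact (n - 2 * l))"
      using l M by (intro binomial_fact) auto
    have b2: "real (M choose l) = fact M / (fact l * fact (M - l))"
      using l by (rule binomial_fact)
    show "real (n choose (2 * l)) * hcoef t (n - 2 * l) * hcoef (- t) (2 * l)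
      = (fact n / fact M) * (real (M choose l) * t ^ l * (- t) ^ (M - l))"
      unfolding b1 b2 d hcoef_def by (simp add: mult.commute)
  qed
  also have "\<dots> = (fact n / fact M) * (t + - t) ^ M"
    unfolding binomial_ring sum_distrib_left by simp
  finally show ?thesis using M by (auto simp: power_0_left)
qed

context dunkl_intertwined
begin

text \<open>Dividing by the total mass keeps \<open>c_k\<close> and the power of \<open>4 t\<close>
  out of all computations; they enter only when \<open>gauss_density\<close> is identified.\<close>

definition E :: "real \<Rightarrow> (real^'n \<Rightarrow> real) \<Rightarrow> real" where
  "E t f = W (1 / (4 * t)) f / W (1 / (4 * t)) (\<lambda>x. 1)"

lemma gauss_density_eq:
  assumes "t > 0"
  shows "gauss_density Rp k t y
    = weight Rp k y * exp (- (1 / (4 * t)) * (norm y)\<^sup>2) / W (1 / (4 * t)) (\<lambda>x. 1)"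
proof -
  have "c_k Rp k = 1 / W 1 (\<lambda>x. 1)"
    unfolding c_k_def W_def by (simp add: mult.commute)
  then show ?thesis
    unfolding gauss_density_def W_one_scale[OF assms] by (simp add: mult.commute)
qed

lemma has_bochner_integral_E:
  assumes "t > 0" "pf f"
  shows "has_bochner_integral lborel (\<lambda>y. f y * gauss_density Rp k t y) (E t f)"
proof -
  have "integrable lborel (\<lambda>x. f x * weight Rp k x * exp (- (1 / (4 * t)) * (norm x)\<^sup>2))"
    using assms by (intro integrable_W exp_growth_pf) auto
  then have "has_bochner_integral lborel (\<lambda>x. f x * weight Rp k x * exp (- (1 / (4 * t)) * (norm x)\<^sup>2)) (W (1 / (4 * t)) f)"
    unfolding W_def by (rule has_bochner_integral_integrable)
  then have "has_bochner_integral lborel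
     (\<lambda>x. (f x * weight Rp k x * exp (- (1 / (4 * t)) * (norm x)\<^sup>2)) / W (1 / (4 * t)) (\<lambda>x. 1)) (E t f)"
    unfolding E_def by (rule has_bochner_integral_divide_zero)
  then show ?thesis by (simp add: gauss_density_eq[OF assms(1)] mult.assoc)
qed

context
  fixes t :: real
  assumes t: "t > 0"
begin

lemma b_pos: "1 / (4 * t) > 0"
  using t by simp

lemma E_one: "E t (\<lambda>x. 1) = 1"
  using W_one_pos[OF b_pos] by (simp add: E_def)

lemma E_cmult: "E t (\<lambda>x. c * f x) = c * E t f"
  by (simp add: E_def W_cmult)

lemma E_sum: "finite I \<Longrightarrow> (\<And>i. i \<in> I \<Longrightarrow> pf (f i)) \<Longrightarrow> E t (\<lambda>x. \<Sum>i\<in>I. f i x) = (\<Sum>i\<in>I. E t (f i))"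
  unfolding E_def sum_divide_distrib[symmetric] by (subst W_sum) (auto intro: exp_growth_pf simp: b_pos t)

lemma E_add: "pf f \<Longrightarrow> pf g \<Longrightarrow> E t (\<lambda>x. f x + g x) = E t f + E t g"
  unfolding E_def add_divide_distrib[symmetric] by (subst W_add) (auto intro: exp_growth_pf simp: b_pos t)

lemma E_diff: "pf f \<Longrightarrow> pf g \<Longrightarrow> E t (\<lambda>x. f x - g x) = E t f - E t g"
  using E_add[of f "\<lambda>x. (-1) * g x"] E_cmult[of "-1" g] by (simp add: real_polynomial_function_minus)

lemma E_zero: "E t (\<lambda>x. 0) = 0"
  using E_cmult[of 0 "\<lambda>x. 0"] by simp

lemma E_reflection: "pf f \<Longrightarrow> \<beta> \<in> R \<Longrightarrow> E t (\<lambda>x. f (reflection \<beta> x)) = E t f"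
  by (simp add: E_def W_reflection pf_borel)

lemma E_T_adjoint:
  assumes "pf f" "pf g"
  shows "E t (\<lambda>x. x $ i * (f x * g x)) = 2 * t * (E t (\<lambda>x. T i f x * g x) + E t (\<lambda>x. f x * T i g x))"
  using W_T_adjoint[OF assms b_pos, of i] t
  unfolding E_def add_divide_distrib[symmetric] by simp

lemma E_T: "pf f \<Longrightarrow> E t (\<lambda>x. x $ i * f x) = 2 * t * E t (T i f)"
  using E_T_adjoint[of f "\<lambda>x. 1" i] by (simp add: T_const E_zero real_polynomial_function.intros)

text \<open>The Euler identity integrated. The reflection terms cancel by invariance of the measure,
  and each \<open>x_i T_i\<close> becomes \<open>2 t T_i T_i\<close> by adjointness.\<close>

lemma E_moment_rec:
  "real (mdeg \<rho>) * E t (m \<rho>) = 2 * t * (\<Sum>i\<in>UNIV. real (\<rho> i) * real (\<rho> i - 1) * E t (m (\<rho>(i := \<rho> i - 2))))"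
proof -
  obtain B where B: "hpoly (mdeg \<rho>) B (m \<rho>)" using hpoly_moment by blast
  have "real (mdeg \<rho>) * E t (m \<rho>) + (\<Sum>\<alpha>\<in>Rp. k \<alpha> * (E t (m \<rho>) - E t (\<lambda>x. m \<rho> (reflection \<alpha> x))))
      = E t (\<lambda>x. real (mdeg \<rho>) * m \<rho> x + (\<Sum>\<alpha>\<in>Rp. k \<alpha> * (m \<rho> x - m \<rho> (reflection \<alpha> x))))"
    by (simp add: E_add E_cmult E_sum E_diff finite_Rp pf_cmult pf_moment real_polynomial_function_diff
        pf_sum pf_compose_reflection[OF pf_moment])
  also have "\<dots> = E t (\<lambda>x. \<Sum>i\<in>UNIV. x $ i * T i (m \<rho>) x)"
    using Tdir_self_hpoly[OF B] by (simp add: Tdir_def)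
  also have "\<dots> = (\<Sum>i\<in>UNIV. E t (\<lambda>x. x $ i * T i (m \<rho>) x))"
    by (intro E_sum pf_mult pf_nth pf_T pf_moment) auto
  also have "\<dots> = (\<Sum>i\<in>UNIV. 2 * t * (real (\<rho> i) * real (\<rho> i - 1) * E t (m (\<rho>(i := \<rho> i - 2)))))"
  proof (intro sum.cong refl)
    fix i
    have "T i (T i (m \<rho>)) = (\<lambda>x. (real (\<rho> i) * real (\<rho> i - 1)) * m (\<rho>(i := \<rho> i - 2)) x)"
      by (simp add: T_moment T_cmult pf_moment numeral_2_eq_2 mult.assoc)
    then show "E t (\<lambda>x. x $ i * T i (m \<rho>) x) = 2 * t * (real (\<rho> i) * real (\<rho> i - 1) * E t (m (\<rho>(i := \<rho> i - 2))))"
      by (simp only: E_T[OF pf_T[OF pf_moment]] E_cmult)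
  qed
  finally show ?thesis
    by (simp add: E_reflection pf_moment Rp_root sum_distrib_left)
qed

text \<open>\<open>a_coef (- t)\<close> satisfies the same recursion, even coordinate by coordinate.
  The values are the monomial moments of the classical centered Gaussian with variance
  \<open>2 t\<close> in each coordinate.\<close>

lemma E_moment: "E t (m \<rho>) = a_coef (- t) \<rho>"
proof (induction "mdeg \<rho>" arbitrary: \<rho> rule: less_induct)
  case less
  show ?case
  proof (cases "mdeg \<rho> = 0")
    case True
    then have "\<rho> = (\<lambda>_. 0)" unfolding mdeg_eq_0_iff .
    then show ?thesis by (simp add: moment_zero E_one a_coef_def)
  next
    case False
    have "real (mdeg \<rho>) * E t (m \<rho>) = (\<Sum>i\<in>UNIV. 2 * t * (real (\<rho> i) * real (\<rho> i - 1) * E t (m (\<rho>(i := \<rho> i - 2)))))"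
      unfolding E_moment_rec sum_distrib_left ..
    also have "\<dots> = (\<Sum>i\<in>UNIV. real (\<rho> i) * a_coef (- t) \<rho>)"
    proof (intro sum.cong refl)
      fix i
      show "2 * t * (real (\<rho> i) * real (\<rho> i - 1) * E t (m (\<rho>(i := \<rho> i - 2)))) = real (\<rho> i) * a_coef (- t) \<rho>"
      proof (cases "\<rho> i = 0")
        case False
        have "mdeg (\<rho>(i := \<rho> i - 2)) < mdeg \<rho>"
          unfolding mdeg_def using False by (intro sum_strict_mono_ex1) auto
        then have "E t (m (\<rho>(i := \<rho> i - 2))) = a_coef (- t) (\<rho>(i := \<rho> i - 2))" by (rule less)
        then show ?thesis using a_coef_rec[of \<rho> i "- t"] by auto
      qed simp
    qed
    also have "\<dots> = real (mdeg \<rho>) * a_coef (- t) \<rho>"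
      by (simp add: mdeg_def sum_distrib_right)
    finally show ?thesis using False by simp
  qed
qed

section \<open>Appell characters\<close>

lemma finite_le_multiindex: "finite {\<rho>. \<rho> \<le> (\<nu>::'n \<Rightarrow> nat)}"
  and le_multiindex_PiE: "{\<rho>. \<rho> \<le> (\<nu>::'n \<Rightarrow> nat)} = PiE UNIV (\<lambda>i. {..\<nu> i})"
proof -
  show *: "{\<rho>. \<rho> \<le> (\<nu>::'n \<Rightarrow> nat)} = PiE UNIV (\<lambda>i. {..\<nu> i})"
    by (auto simp: le_fun_def PiE_iff)
  show "finite {\<rho>. \<rho> \<le> (\<nu>::'n \<Rightarrow> nat)}" unfolding * by (rule finite_PiE) auto
qed

lemma pf_appell_char: "pf (appell_char V t \<nu>)"
  unfolding appell_char_def[abs_def]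
  by (intro pf_sum finite_le_multiindex pf_cmult pf_moment)

text \<open>Both coefficient families factor over the coordinates, and so does the sum over the box
  \<open>\<rho> \<le> \<nu>\<close>. Each factor is a convolution of the coefficients of mutually
  inverse generating functions.\<close>

lemma E_appell_char: "E t (appell_char V t \<nu>) = (if \<nu> = (\<lambda>_. 0) then 1 else 0)"
proof -
  have "E t (appell_char V t \<nu>) = (\<Sum>\<rho> | \<rho> \<le> \<nu>. mbinom \<nu> \<rho> * a_coef t (\<lambda>i. \<nu> i - \<rho> i) * a_coef (- t) \<rho>)"
    unfolding appell_char_def[abs_def]
    by (subst E_sum) (auto intro!: finite_le_multiindex pf_cmult pf_moment simp: E_cmult E_moment)
  also have "\<dots> = (\<Sum>\<rho>\<in>PiE UNIV (\<lambda>i. {..\<nu> i}). \<Prod>i\<in>UNIV. real (\<nu> i choose \<rho> i) * hcoef t (\<nu> i - \<rho> i) * hcoef (- t) (\<rho> i))"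
    unfolding le_multiindex_PiE a_coef_eq_prod mbinom_def prod.distrib ..
  also have "\<dots> = (\<Prod>i\<in>UNIV. \<Sum>r\<le>\<nu> i. real (\<nu> i choose r) * hcoef t (\<nu> i - r) * hcoef (- t) r)"
    by (rule prod_sum_PiE[symmetric]) auto
  also have "\<dots> = (\<Prod>i\<in>UNIV. if \<nu> i = 0 then 1 else 0)"
    by (simp only: hcoef_convolution)
  also have "\<dots> = (if \<nu> = (\<lambda>_. 0) then 1 else 0)"
  proof (cases "\<nu> = (\<lambda>_. 0)")
    case False
    then obtain i where "\<nu> i \<noteq> 0" by (auto simp: fun_eq_iff)
    then show ?thesis using False by (auto intro!: prod_zero)
  qed simp
  finally show ?thesis .
qed

text \<open>Lowering a moment produces \<open>\<rho> i\<close>, which the absorption identity for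
  binomial coefficients trades for \<open>\<nu> i\<close>; \<open>a_coef\<close> sees only the
  difference of the indices and is unaffected.\<close>

lemma T_appell_char:
  "T i (appell_char V t \<nu>) = (\<lambda>x. real (\<nu> i) * appell_char V t (\<nu>(i := \<nu> i - 1)) x)"
proof
  fix x
  have TR: "T i (appell_char V t \<nu>) x
      = (\<Sum>\<rho> | \<rho> \<le> \<nu>. mbinom \<nu> \<rho> * a_coef t (\<lambda>j. \<nu> j - \<rho> j) * (real (\<rho> i) * m (\<rho>(i := \<rho> i - 1)) x))"
    unfolding appell_char_def[abs_def] by (simp add: T_moment_sum finite_le_multiindex T_moment)
  show "T i (appell_char V t \<nu>) x = real (\<nu> i) * appell_char V t (\<nu>(i := \<nu> i - 1)) x"
  proof (cases "\<nu> i = 0")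
    case True
    then have "\<rho> i = 0" if "\<rho> \<le> \<nu>" for \<rho> using that by (metis le_fun_def le_zero_eq)
    then show ?thesis unfolding TR using True by (simp add: sum.neutral)
  next
    case False
    then obtain \<mu> where \<mu>: "\<nu> = inc i \<mu>" using inc_decomp by blast
    have "T i (appell_char V t \<nu>) x = (\<Sum>\<rho>\<in>inc i ` {\<sigma>. \<sigma> \<le> \<mu>}.
        mbinom \<nu> \<rho> * a_coef t (\<lambda>j. \<nu> j - \<rho> j) * (real (\<rho> i) * m (\<rho>(i := \<rho> i - 1)) x))"
      unfolding TR
    proof (rule sum.mono_neutral_right[OF finite_le_multiindex])
      have "inc i \<sigma> \<le> inc i \<mu>" if "\<sigma> \<le> \<mu>" for \<sigma>
        using that by (auto simp: inc_def le_fun_def)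
      then show "inc i ` {\<sigma>. \<sigma> \<le> \<mu>} \<subseteq> {\<rho>. \<rho> \<le> \<nu>}" using \<mu> by auto
      have "\<rho> i = 0" if "\<rho> \<le> \<nu>" "\<rho> \<notin> inc i ` {\<sigma>. \<sigma> \<le> \<mu>}" for \<rho>
      proof (rule ccontr)
        assume "\<rho> i \<noteq> 0"
        then obtain \<sigma> where \<sigma>: "\<rho> = inc i \<sigma>" using inc_decomp by blast
        have "\<sigma> j \<le> \<mu> j" for j
          using le_funD[OF that(1), of j] \<mu> \<sigma> by (cases "j = i") auto
        then show False using that(2) \<sigma> by (auto simp: le_fun_def)
      qed
      then show "\<forall>\<rho>\<in>{\<rho>. \<rho> \<le> \<nu>} - inc i ` {\<sigma>. \<sigma> \<le> \<mu>}.
          mbinom \<nu> \<rho> * a_coef t (\<lambda>j. \<nu> j - \<rho> j) * (real (\<rho> i) * m (\<rho>(i := \<rho> i - 1)) x) = 0" by simp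
    qed
    also have "\<dots> = (\<Sum>\<sigma> | \<sigma> \<le> \<mu>. mbinom \<nu> (inc i \<sigma>) * a_coef t (\<lambda>j. \<nu> j - inc i \<sigma> j) * (real (Suc (\<sigma> i)) * m \<sigma> x))"
      by (subst sum.reindex) (auto simp: inj_on_def)
    also have "\<dots> = (\<Sum>\<sigma> | \<sigma> \<le> \<mu>. real (\<nu> i) * (mbinom \<mu> \<sigma> * a_coef t (\<lambda>j. \<mu> j - \<sigma> j) * m \<sigma> x))"
    proof (intro sum.cong refl)
      fix \<sigma>
      have d: "(\<lambda>j. \<nu> j - inc i \<sigma> j) = (\<lambda>j. \<mu> j - \<sigma> j)"
        unfolding \<mu> by (auto simp: inc_def)
      have b1: "mbinom \<nu> (inc i \<sigma>) = real (Suc (\<mu> i) choose Suc (\<sigma> i)) * (\<Prod>j\<in>UNIV - {i}. real (\<mu> j choose \<sigma> j))"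
        unfolding mbinom_def \<mu> by (subst prod_remove_UNIV[of _ i]) (auto intro!: prod.cong)
      have b2: "mbinom \<mu> \<sigma> = real (\<mu> i choose \<sigma> i) * (\<Prod>j\<in>UNIV - {i}. real (\<mu> j choose \<sigma> j))"
        unfolding mbinom_def by (rule prod_remove_UNIV)
      have b3: "real (Suc (\<mu> i) choose Suc (\<sigma> i)) * real (Suc (\<sigma> i)) = real (Suc (\<mu> i)) * real (\<mu> i choose \<sigma> i)"
        using Suc_times_binomial_eq[of "\<mu> i" "\<sigma> i"] by (metis of_nat_mult)
      have b4: "mbinom \<nu> (inc i \<sigma>) * real (Suc (\<sigma> i)) = real (\<nu> i) * mbinom \<mu> \<sigma>"
      proof -
        have "mbinom \<nu> (inc i \<sigma>) * real (Suc (\<sigma> i))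
            = (real (Suc (\<mu> i) choose Suc (\<sigma> i)) * real (Suc (\<sigma> i))) * (\<Prod>j\<in>UNIV - {i}. real (\<mu> j choose \<sigma> j))"
          unfolding b1 by (simp only: mult_ac)
        also have "\<dots> = real (\<nu> i) * mbinom \<mu> \<sigma>" unfolding b2 b3 \<mu> inc_apply by (simp only: mult_ac)
        finally show ?thesis .
      qed
      have "mbinom \<nu> (inc i \<sigma>) * a_coef t (\<lambda>j. \<mu> j - \<sigma> j) * (real (Suc (\<sigma> i)) * m \<sigma> x)
          = (mbinom \<nu> (inc i \<sigma>) * real (Suc (\<sigma> i))) * (a_coef t (\<lambda>j. \<mu> j - \<sigma> j) * m \<sigma> x)"
        by (simp only: mult_ac)
      then show "mbinom \<nu> (inc i \<sigma>) * a_coef t (\<lambda>j. \<nu> j - inc i \<sigma> j) * (real (Suc (\<sigma> i)) * m \<sigma> x)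
         = real (\<nu> i) * (mbinom \<mu> \<sigma> * a_coef t (\<lambda>j. \<mu> j - \<sigma> j) * m \<sigma> x)"
        unfolding d b4 by (simp only: mult_ac)
    qed
    also have "\<dots> = real (\<nu> i) * appell_char V t \<mu> x"
      unfolding appell_char_def sum_distrib_left ..
    finally show ?thesis using \<mu> by simp
  qed
qed

section \<open>Appell cocharacters\<close>

text \<open>\<open>S \<kappa> = (2 t)\<^sup>-\<^sup>|\<^sup>\<kappa>\<^sup>| exp (- t \<Delta>) y\<^sup>\<kappa>\<close>; all terms of the exponential series beyond \<open>j = mdeg \<kappa>\<close> vanish.\<close>

definition S :: "('n \<Rightarrow> nat) \<Rightarrow> real^'n \<Rightarrow> real" where
  "S \<kappa> y = (1 / (2 * t)) ^ mdeg \<kappa> * (\<Sum>j\<le>mdeg \<kappa>. (- t) ^ j / fact j * (lap ^^ j) (mono \<kappa>) y)"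

lemma pf_S: "pf (S \<kappa>)"
  unfolding S_def[abs_def] by (intro pf_cmult pf_sum pf_lap_pow pf_mono) simp

lemma S_zero: "S (\<lambda>_. 0) = (\<lambda>y. 1)"
  by (rule ext) (simp add: S_def)

text \<open>The commutator factor \<open>2 (j + 1)\<close> lowers the factorial in the exponential
  series and yields \<open>- 2 t\<close> times the series of \<open>T i\<close>. The prefactor
  \<open>1 / (2 t)\<close> of the additional degree turns this into \<open>- T i\<close>.\<close>

lemma S_inc: "S (inc i \<kappa>) y = (1 / (2 * t)) * (y $ i * S \<kappa> y) - T i (S \<kappa>) y"
proof -
  define n where "n = mdeg \<kappa>"
  define g where "g j = (lap ^^ j) (mono \<kappa>)" for j
  define c where "c j = (- t) ^ j / fact j" for j
  have f: "hpoly n 1 (mono \<kappa>)" unfolding n_def by (rule hpoly_mono)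
  have pfg: "pf (g j)" for j unfolding g_def by (intro pf_lap_pow pf_mono)
  \<comment> \<open>The sum for \<open>inc i \<kappa>\<close> has one term more than the sum for
    \<open>\<kappa>\<close>; this vanishing lets them be matched.\<close>
  have gz: "g (Suc n) y = 0" using lap_pow_hpoly[OF f, of "Suc n"] by (simp add: g_def)
  have eq: "mono (inc i \<kappa>) = (\<lambda>x. (axis i 1 \<bullet> x) * mono \<kappa> x)"
    by (simp add: mono_inc inner_axis' fun_eq_iff)
  have Td: "Tdir (axis i 1) h x = T i h x" for h x
    by (simp add: Tdir_def axis_def if_distrib[of "\<lambda>c. c * _"] cong: if_cong)
  have lp: "(lap ^^ Suc j) (mono (inc i \<kappa>)) y = y $ i * g (Suc j) y + 2 * real (Suc j) * T i (g j) y" for j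
    unfolding eq lap_pow_inner_mult[OF f] Td g_def by (simp add: inner_axis')
  have cS: "c (Suc j) * (2 * real (Suc j)) = - (2 * t) * c j" for j
    unfolding c_def by (simp del: of_nat_Suc)
  have S\<kappa>: "S \<kappa> = (\<lambda>y. (1 / (2 * t)) ^ n * (\<Sum>j\<le>n. c j * g j y))"
    by (simp add: S_def[abs_def] n_def c_def g_def)
  have TS: "T i (S \<kappa>) y = (1 / (2 * t)) ^ n * (\<Sum>j\<le>n. c j * T i (g j) y)"
    unfolding S\<kappa>
    by (subst T_cmult, intro pf_sum pf_cmult pfg, simp, subst T_sum)
       (auto intro!: pf_cmult pfg simp: T_cmult pfg)
  have "(\<Sum>j\<le>Suc n. c j * (lap ^^ j) (mono (inc i \<kappa>)) y)
     = c 0 * (y $ i * g 0 y) + (\<Sum>j\<le>n. c (Suc j) * (lap ^^ Suc j) (mono (inc i \<kappa>)) y)"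
    unfolding sum.atMost_Suc_shift by (simp add: mono_inc g_def)
  also have "(\<Sum>j\<le>n. c (Suc j) * (lap ^^ Suc j) (mono (inc i \<kappa>)) y)
     = (\<Sum>j\<le>n. c (Suc j) * (y $ i * g (Suc j) y)) + (\<Sum>j\<le>n. - (2 * t) * (c j * T i (g j) y))"
    unfolding lp sum.distrib[symmetric] distrib_left
    by (intro sum.cong refl) (metis cS mult.assoc)
  also have "c 0 * (y $ i * g 0 y) + ((\<Sum>j\<le>n. c (Suc j) * (y $ i * g (Suc j) y)) + (\<Sum>j\<le>n. - (2 * t) * (c j * T i (g j) y)))
     = (\<Sum>j\<le>Suc n. c j * (y $ i * g j y)) + (\<Sum>j\<le>n. - (2 * t) * (c j * T i (g j) y))"
    unfolding sum.atMost_Suc_shift by simp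
  also have "(\<Sum>j\<le>Suc n. c j * (y $ i * g j y)) = y $ i * (\<Sum>j\<le>n. c j * g j y)"
    by (simp add: gz sum_distrib_left mult.left_commute)
  also have "(\<Sum>j\<le>n. - (2 * t) * (c j * T i (g j) y)) = - (2 * t) * (\<Sum>j\<le>n. c j * T i (g j) y)"
    by (simp only: sum_distrib_left)
  finally have "S (inc i \<kappa>) y = (1 / (2 * t)) ^ Suc n *
      (y $ i * (\<Sum>j\<le>n. c j * g j y) - (2 * t) * (\<Sum>j\<le>n. c j * T i (g j) y))"
    unfolding S_def mdeg_inc n_def[symmetric] c_def[symmetric] by simp
  then show ?thesis unfolding TS unfolding S\<kappa> using t by (simp add: field_simps)
qed

lemma E_mult_S_inc:
  assumes "pf f"
  shows "E t (\<lambda>y. f y * S (inc i \<kappa>) y) = E t (\<lambda>y. T i f y * S \<kappa> y)"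
proof -
  have p: "pf (\<lambda>y. y $ i * (f y * S \<kappa> y))" "pf (\<lambda>y. f y * T i (S \<kappa>) y)"
    by (intro pf_mult pf_nth assms pf_S pf_T)+
  have "E t (\<lambda>y. f y * S (inc i \<kappa>) y) = E t (\<lambda>y. (1 / (2 * t)) * (y $ i * (f y * S \<kappa> y)) - f y * T i (S \<kappa>) y)"
    unfolding S_inc by (simp add: algebra_simps)
  also have "\<dots> = (1 / (2 * t)) * E t (\<lambda>y. y $ i * (f y * S \<kappa> y)) - E t (\<lambda>y. f y * T i (S \<kappa>) y)"
    by (subst E_diff[OF pf_cmult[OF p(1)] p(2)]) (simp only: E_cmult)
  also have "\<dots> = E t (\<lambda>y. T i f y * S \<kappa> y)"
    unfolding E_T_adjoint[OF assms pf_S] using t by simp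
  finally show ?thesis .
qed

lemma E_appell_char_S: "E t (\<lambda>y. appell_char V t \<nu> y * S \<kappa> y) = (if \<nu> = \<kappa> then mfact \<nu> else 0)"
proof (induction \<kappa> arbitrary: \<nu> rule: multiindex_induct)
  case zero
  then show ?case by (simp add: S_zero E_appell_char)
next
  case (inc i \<kappa>)
  have "E t (\<lambda>y. appell_char V t \<nu> y * S (inc i \<kappa>) y)
      = E t (\<lambda>y. real (\<nu> i) * (appell_char V t (\<nu>(i := \<nu> i - 1)) y * S \<kappa> y))"
    unfolding E_mult_S_inc[OF pf_appell_char] T_appell_char by (simp add: mult.assoc)
  also have "\<dots> = real (\<nu> i) * (if \<nu>(i := \<nu> i - 1) = \<kappa> then mfact \<kappa> else 0)"
    unfolding E_cmult inc by auto
  also have "\<dots> = (if \<nu> = inc i \<kappa> then mfact \<nu> else 0)"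
  proof (cases "\<nu> i = 0")
    case True
    then have "\<nu> \<noteq> inc i \<kappa>" by auto
    then show ?thesis using True by simp
  next
    case False
    then obtain \<mu> where "\<nu> = inc i \<mu>" using inc_decomp by blast
    then show ?thesis by (simp add: mfact_inc)
  qed
  finally show ?case .
qed

lemma E_hpoly_S: "hpoly n B p \<Longrightarrow> n < mdeg \<kappa> \<Longrightarrow> E t (\<lambda>y. p y * S \<kappa> y) = 0"
proof (induction \<kappa> arbitrary: n B p rule: multiindex_induct)
  case (inc i \<kappa>)
  have eq: "E t (\<lambda>y. p y * S (inc i \<kappa>) y) = E t (\<lambda>y. T i p y * S \<kappa> y)"
    by (rule E_mult_S_inc[OF hpoly_pf[OF inc.prems(1)]])
  show ?case
  proof (cases n)
    case 0
    then show ?thesis using eq T_hpoly_0[of B p i] inc.prems by (simp add: E_zero)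
  next
    case (Suc l)
    then obtain C where "hpoly l C (T i p)" using T_hpoly_ex[OF inc.prems(1), of i] by auto
    then show ?thesis using eq inc.IH inc.prems Suc by simp
  qed
qed simp

text \<open>Adjointness takes one coordinate off a monomial. Either the remaining monomial is hit by
  \<open>T i\<close> and the degree falls by two in all, or the character is lowered and both
  degrees fall by one; the inequality between the degrees survives in both cases.\<close>

lemma E_hpoly_appell_char:
  "hpoly n B p \<Longrightarrow> n < mdeg \<nu> \<Longrightarrow> E t (\<lambda>y. p y * appell_char V t \<nu> y) = 0"
proof (induction n arbitrary: B p \<nu> rule: less_induct)
  case (less n)
  obtain c where p: "p = (\<lambda>x. \<Sum>\<kappa> | mdeg \<kappa> = n. c \<kappa> * mono \<kappa> x)"
    using hpoly_homog_polyfun[OF less.prems(1)] unfolding homog_polyfun_iff by blast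
  have z: "E t (\<lambda>y. mono \<kappa> y * appell_char V t \<nu> y) = 0" if \<kappa>: "mdeg \<kappa> = n" for \<kappa>
  proof (cases n)
    case 0
    then have "\<kappa> = (\<lambda>_. 0)" using \<kappa> by (simp add: mdeg_eq_0_iff)
    moreover have "\<nu> \<noteq> (\<lambda>_. 0)" using less.prems(2) by (auto simp: mdeg_def)
    ultimately show ?thesis by (simp add: E_appell_char)
  next
    case (Suc l)
    then have "\<kappa> \<noteq> (\<lambda>_. 0)" using \<kappa> by auto
    then obtain i where "\<kappa> i \<noteq> 0" by (auto simp: fun_eq_iff)
    then obtain \<mu> where \<mu>: "\<kappa> = inc i \<mu>" using inc_decomp by blast
    then have dm: "mdeg \<mu> = l" using \<kappa> Suc by simp
    have h: "hpoly l 1 (mono \<mu>)" using hpoly_mono[of \<mu>] dm by simp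
    have 1: "E t (\<lambda>y. T i (mono \<mu>) y * appell_char V t \<nu> y) = 0"
    proof (cases l)
      case 0
      then show ?thesis using T_hpoly_0[of 1 "mono \<mu>" i] h by (simp add: E_zero)
    next
      case (Suc l')
      then obtain C where "hpoly l' C (T i (mono \<mu>))" using T_hpoly_ex[OF h, of i] by auto
      then show ?thesis using less.IH[of l' C "T i (mono \<mu>)" \<nu>] less.prems(2) Suc \<open>n = Suc l\<close> by simp
    qed
    have 2: "real (\<nu> i) * E t (\<lambda>y. mono \<mu> y * appell_char V t (\<nu>(i := \<nu> i - 1)) y) = 0"
    proof (cases "\<nu> i = 0")
      case False
      then obtain \<sigma> where \<sigma>: "\<nu> = inc i \<sigma>" using inc_decomp by blast
      then have "E t (\<lambda>y. mono \<mu> y * appell_char V t \<sigma> y) = 0"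
        using less.IH[OF _ h] less.prems(2) \<open>n = Suc l\<close> by simp
      then show ?thesis using \<sigma> by simp
    qed simp
    have "E t (\<lambda>y. mono \<kappa> y * appell_char V t \<nu> y) = E t (\<lambda>y. y $ i * (mono \<mu> y * appell_char V t \<nu> y))"
      unfolding \<mu> mono_inc by (simp add: mult.assoc)
    also have "\<dots> = 2 * t * (E t (\<lambda>y. T i (mono \<mu>) y * appell_char V t \<nu> y)
         + E t (\<lambda>y. real (\<nu> i) * (mono \<mu> y * appell_char V t (\<nu>(i := \<nu> i - 1)) y)))"
      unfolding E_T_adjoint[OF pf_mono pf_appell_char] T_appell_char by (simp add: mult.left_commute)
    also have "\<dots> = 0" unfolding E_cmult 1 2 by simp
    finally show ?thesis .
  qed
  have "E t (\<lambda>y. p y * appell_char V t \<nu> y)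
     = E t (\<lambda>y. \<Sum>\<kappa> | mdeg \<kappa> = n. c \<kappa> * (mono \<kappa> y * appell_char V t \<nu> y))"
    unfolding p by (simp add: sum_distrib_right mult.assoc)
  also have "\<dots> = (\<Sum>\<kappa> | mdeg \<kappa> = n. c \<kappa> * E t (\<lambda>y. mono \<kappa> y * appell_char V t \<nu> y))"
    by (subst E_sum)
       (auto intro!: pf_cmult pf_mult pf_mono pf_appell_char simp: E_cmult)
  also have "\<dots> = 0" by (intro sum.neutral) (simp add: z)
  finally show ?case .
qed

end

end

section \<open>Convergence and uniqueness for the generating function of the cocharacters\<close>

context dunkl_intertwined
begin

text \<open>The moment bound combined with the multinomial count of a level; the remaining
  \<open>1 / fact n\<close> is what makes the series converge.\<close>

lemma sum_level_abs_bound: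
  fixes c :: "('n \<Rightarrow> nat) \<Rightarrow> real"
  assumes "\<And>\<kappa>. mdeg \<kappa> = n \<Longrightarrow> \<bar>c \<kappa>\<bar> \<le> M"
  shows "(\<Sum>\<kappa> | mdeg \<kappa> = n. \<bar>m \<kappa> x / mfact \<kappa> * c \<kappa>\<bar>) \<le> (real CARD('n) * norm x) ^ n / fact n * M"
proof -
  have "(\<Sum>\<kappa> | mdeg \<kappa> = n. \<bar>m \<kappa> x / mfact \<kappa> * c \<kappa>\<bar>) \<le> (\<Sum>\<kappa>::'n \<Rightarrow> nat | mdeg \<kappa> = n. (norm x ^ n * M) * (1 / mfact \<kappa>))"
  proof (rule sum_mono)
    fix \<kappa> :: "'n \<Rightarrow> nat" assume "\<kappa> \<in> {\<kappa>. mdeg \<kappa> = n}"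
    then have \<kappa>: "mdeg \<kappa> = n" by simp
    have "\<bar>m \<kappa> x\<bar> * \<bar>c \<kappa>\<bar> \<le> norm x ^ n * M"
      using moment_bound[of \<kappa> x] assms[OF \<kappa>] \<kappa> by (intro mult_mono) auto
    then have "(\<bar>m \<kappa> x\<bar> * \<bar>c \<kappa>\<bar>) * (1 / mfact \<kappa>) \<le> (norm x ^ n * M) * (1 / mfact \<kappa>)"
      by (rule mult_right_mono) simp
    then show "\<bar>m \<kappa> x / mfact \<kappa> * c \<kappa>\<bar> \<le> (norm x ^ n * M) * (1 / mfact \<kappa>)"
      by (simp add: abs_mult)
  qed
  also have "\<dots> = (norm x ^ n * M) * (real CARD('n) ^ n / fact n)"
    unfolding sum_distrib_left[symmetric] sum_inverse_mfact ..
  finally show ?thesis by (simp add: power_mult_distrib mult_ac)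
qed

lemma summable_power_div_fact: "summable (\<lambda>n. c ^ n / fact n :: real)"
  using summable_exp[of c] by (simp add: divide_inverse mult.commute)

lemma
  shows dunkl_kernel_eq_suminf: "dunkl_kernel V x z = (\<Sum>n. K n x z)"
    and summable_abs_K: "summable (\<lambda>n. \<bar>K n x z\<bar>)"
proof -
  have mz: "\<bar>mono \<kappa> z\<bar> \<le> norm z ^ n" if "mdeg \<kappa> = n" for \<kappa> n
    using hpoly_bound[OF hpoly_mono[of \<kappa>], of z] that by simp
  have le: "(\<Sum>\<kappa> | mdeg \<kappa> = n. \<bar>m \<kappa> x / mfact \<kappa> * mono \<kappa> z\<bar>) \<le> (real CARD('n) * norm x * norm z) ^ n / fact n" for n
    using sum_level_abs_bound[where c = "\<lambda>\<kappa>. mono \<kappa> z" and n = n and x = x, OF mz] by (simp add: power_mult_distrib)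
  have sm: "summable (\<lambda>n. \<Sum>\<kappa> | mdeg \<kappa> = n. \<bar>m \<kappa> x / mfact \<kappa> * mono \<kappa> z\<bar>)"
    by (rule summable_comparison_test'[OF summable_power_div_fact, of 0])
       (use le in \<open>simp add: sum_nonneg\<close>)
  show sK: "summable (\<lambda>n. \<bar>K n x z\<bar>)"
    by (rule summable_comparison_test'[OF sm, of 0]) (unfold K_def real_norm_def abs_idempotent, rule sum_abs)
  have "((\<lambda>\<kappa>. m \<kappa> x / mfact \<kappa> * mono \<kappa> z) has_sum (\<Sum>n. K n x z)) UNIV"
    by (rule has_sum_levelsI[OF sm])
       (use summable_sums[OF summable_rabs_cancel[OF sK]] in \<open>simp add: K_def\<close>)
  then show "dunkl_kernel V x z = (\<Sum>n. K n x z)"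
    unfolding dunkl_kernel_def by (rule infsumI)
qed

text \<open>\<open>exp (- t \<Delta>)\<close> applied to the degree \<open>n\<close> part of the
  kernel. Each Laplacian gives \<open>|x|^2\<close> and lowers the degree by two, which produces the
  terms of the Gaussian factor next to lower parts of the kernel.\<close>

lemma sum_level_S:
  assumes t: "t > 0"
  shows "(\<Sum>\<kappa> | mdeg \<kappa> = n. m \<kappa> x / mfact \<kappa> * S t \<kappa> y)
    = (\<Sum>j\<le>n. if 2 * j \<le> n then (- (norm x ^ 2) / (4 * t)) ^ j / fact j * K (n - 2 * j) x ((1 / (2 * t)) *\<^sub>R y) else 0)"
proof -
  define c where "c j = (- t) ^ j / fact j" for j
  have "(\<Sum>\<kappa> | mdeg \<kappa> = n. m \<kappa> x / mfact \<kappa> * S t \<kappa> y)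
     = (\<Sum>\<kappa> | mdeg \<kappa> = n. \<Sum>j\<le>n. (1 / (2 * t)) ^ n * c j * (m \<kappa> x / mfact \<kappa> * (lap ^^ j) (mono \<kappa>) y))"
  proof (intro sum.cong refl)
    fix \<kappa> :: "'n \<Rightarrow> nat" assume "\<kappa> \<in> {\<kappa>. mdeg \<kappa> = n}"
    then show "m \<kappa> x / mfact \<kappa> * S t \<kappa> y
      = (\<Sum>j\<le>n. (1 / (2 * t)) ^ n * c j * (m \<kappa> x / mfact \<kappa> * (lap ^^ j) (mono \<kappa>) y))"
      unfolding S_def[OF t] c_def sum_distrib_left by (auto intro!: sum.cong simp: mult_ac)
  qed
  also have "\<dots> = (\<Sum>j\<le>n. \<Sum>\<kappa> | mdeg \<kappa> = n. (1 / (2 * t)) ^ n * c j * (m \<kappa> x / mfact \<kappa> * (lap ^^ j) (mono \<kappa>) y))"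
    by (rule sum.swap)
  also have "\<dots> = (\<Sum>j\<le>n. (1 / (2 * t)) ^ n * c j * (lap ^^ j) (K n x) y)"
  proof (intro sum.cong refl)
    fix j
    have "(lap ^^ j) (K n x) y = (\<Sum>\<kappa> | mdeg \<kappa> = n. m \<kappa> x / mfact \<kappa> * (lap ^^ j) (mono \<kappa>) y)"
      unfolding K_def[abs_def]
      by (subst lap_pow_sum) (auto intro!: pf_cmult pf_mono simp: lap_pow_cmult[OF pf_mono] simp del: times_divide_eq_left)
    then show "(\<Sum>\<kappa> | mdeg \<kappa> = n. (1 / (2 * t)) ^ n * c j * (m \<kappa> x / mfact \<kappa> * (lap ^^ j) (mono \<kappa>) y))
        = (1 / (2 * t)) ^ n * c j * (lap ^^ j) (K n x) y"
      by (simp only: sum_distrib_left)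
  qed
  also have "\<dots> = (\<Sum>j\<le>n. if 2 * j \<le> n then (- (norm x ^ 2) / (4 * t)) ^ j / fact j * K (n - 2 * j) x ((1 / (2 * t)) *\<^sub>R y) else 0)"
  proof (intro sum.cong refl)
    fix j
    show "(1 / (2 * t)) ^ n * c j * (lap ^^ j) (K n x) y
      = (if 2 * j \<le> n then (- (norm x ^ 2) / (4 * t)) ^ j / fact j * K (n - 2 * j) x ((1 / (2 * t)) *\<^sub>R y) else 0)"
    proof (cases "2 * j \<le> n")
      case True
      define l where "l = n - 2 * j"
      have n: "n = 2 * j + l" using True by (simp add: l_def)
      obtain B where B: "hpoly l B (K l x)" using hpoly_K_right by blast
      \<comment> \<open>Of the \<open>n\<close> powers of \<open>1 / (2 t)\<close>, \<open>l\<close>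
        rescale the argument of the kernel; the other \<open>2 j\<close> combine with
        \<open>(- t) ^ j\<close> to powers of \<open>- 1 / (4 t)\<close>.\<close>
      have "(1 / (2 * t)) ^ n * (- t) ^ j * (norm x ^ 2) ^ j = (1 / (2 * t)) ^ l * ((1 / (2 * t)) ^ 2 * (- t) * norm x ^ 2) ^ j"
        unfolding n power_add power_mult power_mult_distrib by (simp add: mult_ac)
      also have "(1 / (2 * t)) ^ 2 * (- t) * norm x ^ 2 = - (norm x ^ 2) / (4 * t)"
        using t by (simp add: power2_eq_square field_simps)
      finally have eq: "(1 / (2 * t)) ^ n * (- t) ^ j * (norm x ^ 2) ^ j = (1 / (2 * t)) ^ l * (- (norm x ^ 2) / (4 * t)) ^ j" .
      have "(1 / (2 * t)) ^ n * c j * (lap ^^ j) (K n x) y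
          = ((1 / (2 * t)) ^ n * (- t) ^ j * (norm x ^ 2) ^ j) * (K l x y / fact j)"
        using True by (simp add: lap_pow_K c_def l_def)
      also have "\<dots> = (- (norm x ^ 2) / (4 * t)) ^ j / fact j * K l x ((1 / (2 * t)) *\<^sub>R y)"
        unfolding eq hpoly_scaleR[OF B] by simp
      finally show ?thesis using True by (simp add: l_def)
    qed (simp add: lap_pow_K)
  qed
  finally show ?thesis .
qed

lemma S_abs_bound:
  assumes t: "t > 0" and \<kappa>: "mdeg \<kappa> = n"
  shows "\<bar>S t \<kappa> y\<bar> \<le> (1 / (2 * t)) ^ n *
    (\<Sum>j\<le>n. if 2 * j \<le> n then t ^ j / fact j * (lap_bound ^ j * (fact n / fact (n - 2 * j)) * norm y ^ (n - 2 * j)) else 0)"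
proof -
  have "\<bar>\<Sum>j\<le>n. (- t) ^ j / fact j * (lap ^^ j) (mono \<kappa>) y\<bar> \<le> (\<Sum>j\<le>n. \<bar>(- t) ^ j / fact j * (lap ^^ j) (mono \<kappa>) y\<bar>)"
    by (rule sum_abs)
  also have "\<dots> \<le> (\<Sum>j\<le>n. if 2 * j \<le> n then t ^ j / fact j * (lap_bound ^ j * (fact n / fact (n - 2 * j)) * norm y ^ (n - 2 * j)) else 0)"
  proof (rule sum_mono)
    fix j
    have f: "hpoly n 1 (mono \<kappa>)" using hpoly_mono[of \<kappa>] \<kappa> by simp
    have "\<bar>(- t) ^ j / fact j * (lap ^^ j) (mono \<kappa>) y\<bar> = t ^ j / fact j * \<bar>(lap ^^ j) (mono \<kappa>) y\<bar>"
      using t by (simp add: abs_mult power_abs)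
    also have "\<dots> \<le> (if 2 * j \<le> n then t ^ j / fact j * (lap_bound ^ j * (fact n / fact (n - 2 * j)) * norm y ^ (n - 2 * j)) else 0)"
    proof (cases "2 * j \<le> n")
      case True
      then have "hpoly (n - 2 * j) (lap_bound ^ j * (fact n / fact (n - 2 * j)) * 1) ((lap ^^ j) (mono \<kappa>))"
        using lap_pow_hpoly[OF f, of j] by blast
      from hpoly_bound[OF this, of y]
      have "t ^ j / fact j * \<bar>(lap ^^ j) (mono \<kappa>) y\<bar>
          \<le> t ^ j / fact j * (lap_bound ^ j * (fact n / fact (n - 2 * j)) * 1 * norm y ^ (n - 2 * j))"
        using t by (intro mult_left_mono) auto
      then show ?thesis using True by (simp only: mult_1_right if_True)
    next
      case False
      then show ?thesis using lap_pow_hpoly[OF f, of j] by simp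
    qed
    finally show "\<bar>(- t) ^ j / fact j * (lap ^^ j) (mono \<kappa>) y\<bar>
      \<le> (if 2 * j \<le> n then t ^ j / fact j * (lap_bound ^ j * (fact n / fact (n - 2 * j)) * norm y ^ (n - 2 * j)) else 0)" .
  qed
  finally show ?thesis
    unfolding S_def[OF t] \<kappa> abs_mult using t by (simp add: abs_of_pos power_abs[symmetric] mult_left_mono divide_right_mono)
qed

text \<open>The numerator of the falling factorial cancels \<open>1 / fact n\<close>. What remains
  is a Cauchy product of the exponential series of \<open>u^2 t lap_bound\<close> and of
  \<open>u |y|\<close>.\<close>

lemma summable_level_abs_S:
  assumes t: "t > 0"
  shows "summable (\<lambda>n. \<Sum>\<kappa> | mdeg \<kappa> = n. \<bar>m \<kappa> x / mfact \<kappa> * S t \<kappa> y\<bar>)"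
proof -
  define u where "u = real CARD('n) * norm x / (2 * t)"
  define A where "A j = (u ^ 2 * t * lap_bound) ^ j / fact j" for j
  define B where "B l = (u * norm y) ^ l / fact l" for l
  have u: "u \<ge> 0" using t by (simp add: u_def)
  have nn: "A j \<ge> 0" "B j \<ge> 0" for j
    using u t lap_bound_nonneg by (auto simp: A_def B_def)
  have "summable (\<lambda>n. \<Sum>j\<le>n. if 2 * j \<le> n then A j * B (n - 2 * j) else 0)"
  proof (rule sums_summable[OF Cauchy_product_double])
    show "summable (\<lambda>j. \<bar>A j\<bar>)" "summable (\<lambda>j. \<bar>B j\<bar>)"
      unfolding abs_of_nonneg[OF nn(1)] abs_of_nonneg[OF nn(2)]
      unfolding A_def B_def by (rule summable_power_div_fact)+
  qed
  then show ?thesis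
  proof (rule summable_comparison_test'[of _ 0])
    fix n
    have "(\<Sum>\<kappa> | mdeg \<kappa> = n. \<bar>m \<kappa> x / mfact \<kappa> * S t \<kappa> y\<bar>)
      \<le> (real CARD('n) * norm x) ^ n / fact n * ((1 / (2 * t)) ^ n *
        (\<Sum>j\<le>n. if 2 * j \<le> n then t ^ j / fact j * (lap_bound ^ j * (fact n / fact (n - 2 * j)) * norm y ^ (n - 2 * j)) else 0))"
      by (rule sum_level_abs_bound) (rule S_abs_bound[OF t])
    also have "\<dots> = (\<Sum>j\<le>n. if 2 * j \<le> n then A j * B (n - 2 * j) else 0)"
      unfolding sum_distrib_left
    proof (intro sum.cong refl)
      fix j
      show "(real CARD('n) * norm x) ^ n / fact n * ((1 / (2 * t)) ^ n *
        (if 2 * j \<le> n then t ^ j / fact j * (lap_bound ^ j * (fact n / fact (n - 2 * j)) * norm y ^ (n - 2 * j)) else 0))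
        = (if 2 * j \<le> n then A j * B (n - 2 * j) else 0)"
      proof (cases "2 * j \<le> n")
        case True
        define l where "l = n - 2 * j"
        have n: "n = 2 * j + l" using True by (simp add: l_def)
        have "(real CARD('n) * norm x) ^ n * (1 / (2 * t)) ^ n = u ^ n"
          unfolding u_def by (simp add: power_mult_distrib power_divide)
        also have "\<dots> = (u ^ 2) ^ j * u ^ l" unfolding n by (simp add: power_add power_mult)
        finally have un: "(real CARD('n) * norm x) ^ n * (1 / (2 * t)) ^ n = (u ^ 2) ^ j * u ^ l" .
        have "(real CARD('n) * norm x) ^ n / fact n * ((1 / (2 * t)) ^ n *
            (t ^ j / fact j * (lap_bound ^ j * (fact n / fact l) * norm y ^ l)))
          = ((real CARD('n) * norm x) ^ n * (1 / (2 * t)) ^ n) * (t ^ j / fact j * (lap_bound ^ j * norm y ^ l / fact l))"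
          by (simp add: field_simps)
        also have "\<dots> = A j * B l"
          unfolding un unfolding A_def B_def power_mult_distrib by (simp add: field_simps)
        finally show ?thesis using True by (simp add: l_def)
      qed simp
    qed
    finally show "norm (\<Sum>\<kappa> | mdeg \<kappa> = n. \<bar>m \<kappa> x / mfact \<kappa> * S t \<kappa> y\<bar>)
        \<le> (\<Sum>j\<le>n. if 2 * j \<le> n then A j * B (n - 2 * j) else 0)"
      by (simp add: sum_nonneg)
  qed
qed

lemma has_sum_S:
  assumes t: "t > 0"
  shows "((\<lambda>\<kappa>. m \<kappa> x / mfact \<kappa> * S t \<kappa> y) has_sum
        (exp (- (norm x ^ 2) / (4 * t)) * dunkl_kernel V x ((1 / (2 * t)) *\<^sub>R y))) UNIV"
proof (rule has_sum_levelsI[OF summable_level_abs_S[OF t]])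
  define z where "z = - (norm x ^ 2) / (4 * t)"
  have "(\<lambda>j. z ^ j / fact j) sums exp z"
    using exp_converges[of z] by (simp add: divide_inverse mult.commute)
  moreover have "summable (\<lambda>j. \<bar>z ^ j / fact j\<bar>)"
    using summable_power_div_fact[of "\<bar>z\<bar>"] by (simp add: power_abs)
  ultimately show "(\<lambda>n. \<Sum>\<kappa> | mdeg \<kappa> = n. m \<kappa> x / mfact \<kappa> * S t \<kappa> y) sums
      (exp (- (norm x ^ 2) / (4 * t)) * dunkl_kernel V x ((1 / (2 * t)) *\<^sub>R y))"
    unfolding sum_level_S[OF t] dunkl_kernel_eq_suminf z_def[symmetric]
    using Cauchy_product_double[OF _ summable_abs_K, of "\<lambda>j. z ^ j / fact j"] by (simp add: sums_iff)
qed

text \<open>\<open>T i\<close> carries a relation in degree \<open>Suc n\<close> to one in degree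
  \<open>n\<close> with shifted coefficients, so independence descends to degree 0, where the only
  moment is 1.\<close>

lemma moment_level_independent:
  assumes "\<And>x. (\<Sum>\<kappa> | mdeg \<kappa> = n. d \<kappa> / mfact \<kappa> * m \<kappa> x) = 0" and "mdeg \<kappa> = n"
  shows "d \<kappa> = 0"
  using assms
proof (induction n arbitrary: d \<kappa>)
  case 0
  then have "\<kappa> = (\<lambda>_. 0)" by (simp add: mdeg_eq_0_iff)
  then show ?case using 0 by (simp add: mdeg_level_zero moment_zero)
next
  case (Suc n)
  have "\<kappa> \<noteq> (\<lambda>_. 0)" using Suc.prems(2) by auto
  then obtain i where "\<kappa> i \<noteq> 0" by (auto simp: fun_eq_iff)
  then obtain \<mu> where \<mu>: "\<kappa> = inc i \<mu>" using inc_decomp by blast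
  have "(\<Sum>\<sigma> | mdeg \<sigma> = n. d (inc i \<sigma>) / mfact \<sigma> * m \<sigma> x) = 0" for x
  proof -
    have "(\<lambda>x. \<Sum>\<kappa> | mdeg \<kappa> = Suc n. d \<kappa> / mfact \<kappa> * m \<kappa> x) = (\<lambda>x. 0)" using Suc.prems(1) by simp
    then have "T i (\<lambda>x. \<Sum>\<kappa> | mdeg \<kappa> = Suc n. d \<kappa> / mfact \<kappa> * m \<kappa> x) x = 0" by (simp only: T_const)
    then have "(\<Sum>\<kappa> | mdeg \<kappa> = Suc n. d \<kappa> / mfact \<kappa> * T i (m \<kappa>) x) = 0"
      unfolding T_moment_sum[OF finite_mdeg] .
    then show ?thesis unfolding sum_moment_level_pred by simp
  qed
  then have "d (inc i \<mu>) = 0" using Suc.IH[of "\<lambda>\<sigma>. d (inc i \<sigma>)" \<mu>] Suc.prems(2) \<mu> by simp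
  then show ?case using \<mu> by simp
qed

text \<open>Replacing \<open>x\<close> by \<open>s x\<close> separates the degrees: the sum becomes
  a power series in \<open>s\<close>, so each homogeneous level vanishes by itself.\<close>

lemma has_sum_moment_zero:
  assumes "\<And>x. ((\<lambda>\<kappa>. m \<kappa> x / mfact \<kappa> * d \<kappa>) has_sum 0) UNIV"
  shows "d \<kappa> = 0"
proof (rule moment_level_independent[OF _ refl])
  fix x
  define Q where "Q n = (\<Sum>\<kappa> | mdeg \<kappa> = n. m \<kappa> x / mfact \<kappa> * d \<kappa>)" for n
  have "(\<lambda>n. Q n * s ^ n) sums 0" for s
  proof -
    have "(\<lambda>n. \<Sum>\<kappa> | mdeg \<kappa> = n. m \<kappa> (s *\<^sub>R x) / mfact \<kappa> * d \<kappa>) sums 0"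
      by (rule has_sum_imp_sums_levels[OF assms])
    moreover have "(\<Sum>\<kappa> | mdeg \<kappa> = n. m \<kappa> (s *\<^sub>R x) / mfact \<kappa> * d \<kappa>) = Q n * s ^ n" for n
      unfolding Q_def sum_distrib_right by (intro sum.cong refl) (simp add: moment_scaleR)
    ultimately show ?thesis by simp
  qed
  then have "Q (mdeg \<kappa>) = 0" by (rule powser_sums_zero_imp_zero)
  then show "(\<Sum>\<mu> | mdeg \<mu> = mdeg \<kappa>. d \<mu> / mfact \<mu> * m \<mu> x) = 0"
    by (simp add: Q_def mult.commute)
qed

text \<open>The definite description denotes: absolute convergence gives existence, and independence
  of the moments gives uniqueness.\<close>

lemma appell_cochar_eq_S:
  assumes t: "t > 0"
  shows "appell_cochar V t \<kappa> y = S t \<kappa> y"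
proof -
  have "(THE c. \<forall>x. ((\<lambda>\<kappa>. m \<kappa> x / mfact \<kappa> * c \<kappa>) has_sum
        (exp (- (norm x ^ 2) / (4 * t)) * dunkl_kernel V x ((1 / (2 * t)) *\<^sub>R y))) UNIV) = (\<lambda>\<kappa>. S t \<kappa> y)"
  proof (rule the_equality)
    show "\<forall>x. ((\<lambda>\<kappa>. m \<kappa> x / mfact \<kappa> * S t \<kappa> y) has_sum
        (exp (- (norm x ^ 2) / (4 * t)) * dunkl_kernel V x ((1 / (2 * t)) *\<^sub>R y))) UNIV"
      using has_sum_S[OF t] by blast
    fix c assume c: "\<forall>x. ((\<lambda>\<kappa>. m \<kappa> x / mfact \<kappa> * c \<kappa>) has_sum
        (exp (- (norm x ^ 2) / (4 * t)) * dunkl_kernel V x ((1 / (2 * t)) *\<^sub>R y))) UNIV"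
    have "((\<lambda>\<kappa>. m \<kappa> x / mfact \<kappa> * (c \<kappa> - S t \<kappa> y)) has_sum 0) UNIV" for x
      using has_sum_add[OF c[rule_format, of x] has_sum_cmult_right[OF has_sum_S[OF t, of x y], of "-1"]]
      by (simp add: right_diff_distrib)
    then have "c \<kappa> - S t \<kappa> y = 0" for \<kappa> by (rule has_sum_moment_zero)
    then show "c = (\<lambda>\<kappa>. S t \<kappa> y)" by auto
  qed
  then show ?thesis unfolding appell_cochar_def by simp
qed

lemma E_polyfun_deg_lt:
  assumes t: "t > 0" and p: "polyfun_deg_lt d p" and g: "pf g"
    and z: "\<And>\<kappa>. mdeg \<kappa> < d \<Longrightarrow> E t (\<lambda>y. mono \<kappa> y * g y) = 0"
  shows "pf p" and "E t (\<lambda>y. p y * g y) = 0"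
proof -
  obtain c where c: "finite {\<kappa>. c \<kappa> \<noteq> 0}" "\<And>\<kappa>. c \<kappa> \<noteq> 0 \<Longrightarrow> mdeg \<kappa> < d"
    "p = (\<lambda>x. \<Sum>\<kappa>\<in>{\<kappa>. c \<kappa> \<noteq> 0}. c \<kappa> * mono \<kappa> x)"
    using p unfolding polyfun_deg_lt_def by blast
  show "pf p" unfolding c(3) by (intro pf_sum c(1) pf_cmult pf_mono)
  have "E t (\<lambda>y. p y * g y) = E t (\<lambda>y. \<Sum>\<kappa>\<in>{\<kappa>. c \<kappa> \<noteq> 0}. c \<kappa> * (mono \<kappa> y * g y))"
    unfolding c(3) sum_distrib_right mult.assoc ..
  also have "\<dots> = (\<Sum>\<kappa>\<in>{\<kappa>. c \<kappa> \<noteq> 0}. c \<kappa> * E t (\<lambda>y. mono \<kappa> y * g y))"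
    using c(1) by (subst E_sum[OF t])
      (auto intro!: pf_cmult pf_mult pf_mono g simp: E_cmult[OF t])
  also have "\<dots> = 0" by (intro sum.neutral) (use c(2) z in auto)
  finally show "E t (\<lambda>y. p y * g y) = 0" .
qed

end

theorem theorem4p5:
  fixes R Rp :: "(real^'n::finite) set" and k :: "real^'n \<Rightarrow> real"
    and V :: "(real^'n \<Rightarrow> real) \<Rightarrow> real^'n \<Rightarrow> real"
    and t :: real and \<nu> \<rho> :: "'n \<Rightarrow> nat" and p :: "real^'n \<Rightarrow> real"
  assumes "root_system R" and "positive_subsystem R Rp" and "multiplicity R k"
    and "intertwiner Rp k V" and "t > 0"
    and "polyfun_deg_lt (mdeg \<nu>) p"
  shows "has_bochner_integral lborel
           (\<lambda>y. appell_char V t \<nu> y * appell_cochar V t \<rho> y * gauss_density Rp k t y)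
           (if \<nu> = \<rho> then mfact \<nu> else 0)
       \<and> has_bochner_integral lborel
           (\<lambda>y. p y * appell_cochar V t \<nu> y * gauss_density Rp k t y) 0
       \<and> has_bochner_integral lborel
           (\<lambda>y. p y * appell_char V t \<nu> y * gauss_density Rp k t y) 0"
proof -
  interpret dunkl_intertwined R Rp k V
    using assms(1-4) by unfold_locales
  note t = \<open>t > 0\<close>
  note pfR = pf_appell_char[OF t] and pfS = pf_S[OF t]
  \<comment> \<open>Monomials are instances of \<open>hpoly\<close> with bound 1, so orthogonality
    to homogeneous polynomials supplies the premise about monomials.\<close>
  note pS = E_polyfun_deg_lt[OF t assms(6) pfS[of \<nu>] E_hpoly_S[OF t hpoly_mono]]
  note pR = E_polyfun_deg_lt(2)[OF t assms(6) pfR[of \<nu>] E_hpoly_appell_char[OF t hpoly_mono]]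
  show ?thesis
    unfolding appell_cochar_eq_S[OF t]
    using has_bochner_integral_E[OF t pf_mult[OF pfR[of \<nu>] pfS[of \<rho>]]]
      has_bochner_integral_E[OF t pf_mult[OF pS(1) pfS[of \<nu>]]]
      has_bochner_integral_E[OF t pf_mult[OF pS(1) pfR[of \<nu>]]]
    by (simp only: E_appell_char_S[OF t] pS(2) pR simp_thms)
qed

end
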